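(* Fix a real $\epsilon\in(0,1/2)$ and an integer function $q(n)$ with $q(n)\ge3$ for all integers $n\ge1$ and $q(n)=\Theta(n^\epsilon)$. Then there is an algorithm that, given any $3$-colorable graph with $n$ vertices, finds a proper $q(n)$-coloring of it in time $2^{\Theta(n^{1-2\epsilon}\log(n))}$.
   Context: A proper $m$-coloring of a graph is a map from its vertices to $[m]$ assigning distinct colors to adjacent vertices; a graph is $3$-colorable if it has a proper $3$-coloring.
   Formalization: The algorithm is given q(n) together with the graph; an algorithm given the graph alone is obtained when q is computable in time 2^{O(n^{1-2ε} log n)}, since for uncomputable ε no graph-only algorithm can have the stated two-sided running time. *)

theory Defs
  imports Complex_Main "HOL-Library.Landau_Symbols"
begin

section \<open>Graphs and colorings\<close>

definition simple_graph :: "'a set \<Rightarrow> 'a set set \<Rightarrow> bool" where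
  "simple_graph V E \<longleftrightarrow> finite V \<and> (\<forall>e\<in>E. e \<subseteq> V \<and> card e = 2)"

definition proper_coloring :: "'a set \<Rightarrow> 'a set set \<Rightarrow> nat \<Rightarrow> ('a \<Rightarrow> nat) \<Rightarrow> bool" where
  "proper_coloring V E m c \<longleftrightarrow>
     (\<forall>v\<in>V. c v \<in> {1..m}) \<and> (\<forall>u\<in>V. \<forall>v\<in>V. {u, v} \<in> E \<longrightarrow> c u \<noteq> c v)"

definition three_colorable :: "'a set \<Rightarrow> 'a set set \<Rightarrow> bool" where
  "three_colorable V E \<longleftrightarrow> (\<exists>c. proper_coloring V E 3 c)"

text \<open>Inputs of the algorithm have vertex set \<open>{..<n}\<close>.\<close>

definition three_colorable_graphs :: "nat \<Rightarrow> nat set set set" where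
  "three_colorable_graphs n = {E. simple_graph {..<n} E \<and> three_colorable {..<n} E}"


section \<open>Algorithms: a structured random access machine\<close>

text \<open>
  A program uses finitely many registers and finitely many unbounded arrays of natural numbers.
  Every elementary operation and every test costs one unit of time. The only arithmetic is addition
  and truncated subtraction: as a step at most doubles the largest number present, \<open>t\<close> steps produce
  numbers with only \<open>t + O(log n)\<close> bits, and the unit-cost measure is polynomially related to Turing
  machine time. (Unit-cost multiplication would destroy this.) The class of time bounds
  \<open>2^\<Theta>(n^(1 - 2\<epsilon>) log n)\<close> with \<open>\<epsilon> < 1/2\<close> is invariant under such polynomial changes.
\<close>

record state =
  reg :: "nat \<Rightarrow> nat"
  arr :: "nat \<Rightarrow> nat \<Rightarrow> nat"

datatype program =
    Const nat nat
  | Add nat nat nat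
  | Sub nat nat nat
  | Load nat nat nat
  | Store nat nat nat
  | Seq program program
  | Cond nat program program
  | While nat program

text \<open>\<open>exec p s t s'\<close>: program \<open>p\<close> started in state \<open>s\<close> halts in state \<open>s'\<close> after exactly \<open>t\<close> steps.\<close>

inductive exec :: "program \<Rightarrow> state \<Rightarrow> nat \<Rightarrow> state \<Rightarrow> bool" where
  Const: "exec (Const x k) s 1 (s\<lparr>reg := (reg s)(x := k)\<rparr>)"
| Add: "exec (Add x y z) s 1 (s\<lparr>reg := (reg s)(x := reg s y + reg s z)\<rparr>)"
| Sub: "exec (Sub x y z) s 1 (s\<lparr>reg := (reg s)(x := reg s y - reg s z)\<rparr>)"
| Load: "exec (Load x a y) s 1 (s\<lparr>reg := (reg s)(x := arr s a (reg s y))\<rparr>)"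
| Store: "exec (Store a y x) s 1 (s\<lparr>arr := (arr s)(a := (arr s a)(reg s y := reg s x))\<rparr>)"
| Seq: "exec p s t s' \<Longrightarrow> exec p' s' t' s'' \<Longrightarrow> exec (Seq p p') s (t + t') s''"
| CondPos: "reg s x > 0 \<Longrightarrow> exec p s t s' \<Longrightarrow> exec (Cond x p p') s (1 + t) s'"
| CondZero: "reg s x = 0 \<Longrightarrow> exec p' s t s' \<Longrightarrow> exec (Cond x p p') s (1 + t) s'"
| WhileZero: "reg s x = 0 \<Longrightarrow> exec (While x p) s 1 s"
| WhilePos: "reg s x > 0 \<Longrightarrow> exec p s t s' \<Longrightarrow> exec (While x p) s' t' s'' \<Longrightarrow>
    exec (While x p) s (1 + t + t') s''"

inductive_cases exec_elims:
  "exec (Const x k) s t s'" "exec (Add x y z) s t s'" "exec (Sub x y z) s t s'"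
  "exec (Load x a y) s t s'" "exec (Store a y x) s t s'" "exec (Seq p p') s t s'"
  "exec (Cond x p p') s t s'" "exec (While x p) s t s'"

lemma exec_deterministic: "exec p s t s' \<Longrightarrow> exec p s u s'' \<Longrightarrow> u = t \<and> s'' = s'"
proof (induction arbitrary: u s'' rule: exec.induct)
  case (Seq p s t s1 p' t' s2)
  from Seq.prems obtain v r w where "exec p s v r" "exec p' r w s''" "u = v + w"
    by (auto elim: exec_elims(6))
  then show ?case using Seq.IH(1)[of v r] Seq.IH(2)[of w s''] by simp
next
  case (CondPos s x p t s1 p')
  from CondPos.prems CondPos.hyps(1) obtain v where "exec p s v s''" "u = 1 + v"
    by (auto elim: exec_elims(7))
  then show ?case using CondPos.IH[of v s''] by simp
next
  case (CondZero s x p' t s1 p)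
  from CondZero.prems CondZero.hyps(1) obtain v where "exec p' s v s''" "u = 1 + v"
    by (auto elim: exec_elims(7))
  then show ?case using CondZero.IH[of v s''] by simp
next
  case (WhileZero s x p)
  then show ?case by (auto elim: exec_elims(8))
next
  case (WhilePos s x p t s1 t' s2)
  from WhilePos.prems WhilePos.hyps(1) obtain v r w
    where "exec p s v r" "exec (While x p) r w s''" "u = 1 + v + w"
    by (auto elim: exec_elims(8))
  then show ?case using WhilePos.IH(1)[of v r] WhilePos.IH(2)[of w s''] by simp
qed (auto elim: exec_elims)

definition running_time :: "program \<Rightarrow> state \<Rightarrow> nat" where
  "running_time p s = (THE t. \<exists>s'. exec p s t s')"

lemma running_time_eq: "exec p s t s' \<Longrightarrow> running_time p s = t"
  unfolding running_time_def using exec_deterministic by blast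


section \<open>Coloring algorithms\<close>

text \<open>
  Register 0 holds \<open>n\<close>, register 1 holds an auxiliary number \<open>a\<close>, and array 0 holds the adjacency
  matrix, row by row; everything else is 0. The coloring is read off from array 1.

  With \<open>a = q n\<close> the number of available colors is part of the input: \<open>q\<close> is an arbitrary function,
  possibly uncomputable, so a finite program cannot in general determine it. With \<open>a = 0\<close> the input is
  the graph alone, and the program has to determine the number of colors itself.
\<close>

definition input :: "nat \<Rightarrow> nat \<Rightarrow> nat set set \<Rightarrow> state" where
  "input n a E = \<lparr>reg = (\<lambda>_. 0)(0 := n, 1 := a),
     arr = (\<lambda>_ _. 0)(0 := (\<lambda>i. if i < n * n \<and> {i div n, i mod n} \<in> E then 1 else 0))\<rparr>"

definition finds_coloring :: "program \<Rightarrow> (nat \<Rightarrow> nat) \<Rightarrow> (nat \<Rightarrow> nat) \<Rightarrow> bool" where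
  "finds_coloring p a q \<longleftrightarrow> (\<forall>n\<ge>1. \<forall>E\<in>three_colorable_graphs n.
     \<exists>t s. exec p (input n (a n) E) t s \<and> proper_coloring {..<n} E (q n) (arr s 1))"

definition worst_case_time :: "program \<Rightarrow> (nat \<Rightarrow> nat) \<Rightarrow> nat \<Rightarrow> nat" where
  "worst_case_time p a n = (MAX E\<in>three_colorable_graphs n. running_time p (input n (a n) E))"

text \<open>
  A program computing \<open>q\<close> is started with \<open>n\<close> in register 0 and 0 elsewhere, and leaves \<open>q n\<close> in
  register 1.
\<close>

definition computable_in_exp_O :: "(nat \<Rightarrow> nat) \<Rightarrow> (nat \<Rightarrow> real) \<Rightarrow> bool" where
  "computable_in_exp_O q f \<longleftrightarrow> (\<exists>r. \<exists>h\<in>O(f). \<forall>n\<ge>1. \<exists>t s.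
     exec r (input n 0 {}) t s \<and> reg s 1 = q n \<and> real t \<le> 2 powr h n)"

end

theory Submission
  imports Defs
begin

text \<open>
  Let \<open>C\<close> be a color class of a 3-coloring, \<open>R\<close> the set of vertices that are not yet colored, and
  \<open>T \<le> d * k\<close>. Grow a set \<open>S \<subseteq> C\<close> by vertices with at least \<open>d\<close> new neighbors in \<open>R\<close>. Its neighborhood avoids
  \<open>C\<close> and is therefore bipartite. If \<open>S\<close> reaches size \<open>k\<close>, at least \<open>T\<close> vertices of \<open>R\<close> are adjacent to \<open>S\<close>;
  color them with two new colors and remove them, which happens at most \<open>n / T\<close> times. Otherwise every vertex
  of \<open>C\<close> has fewer than \<open>d\<close> neighbors in the part \<open>B\<close> of \<open>R\<close> that is not adjacent to \<open>S\<close>. Then the vertices of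
  degree less than \<open>d\<close> in \<open>B\<close> are colored greedily with \<open>d\<close> colors, and the rest of \<open>B\<close> avoids \<open>C\<close>, so two
  more colors finish the coloring. With \<open>d \<approx> q / 4\<close>, \<open>T \<approx> 4 n / q\<close> and \<open>k \<approx> 16 n / q\<^sup>2\<close> at most \<open>q\<close> colors are used,
  and a suitable \<open>S\<close> is found by trying all \<open>(n + 1) ^ k\<close> tuples.

  The program is written in a language of bounded loops with a total semantics, whose compilation into RAM
  programs has an exactly known running time. Loop bounds do not change during a loop, so the running time is
  automatically polynomial in them.
\<close>

section \<open>A language of bounded loops\<close>

text \<open>The program never learns \<open>C\<close>. It tries tuples blindly, checks every
  two-coloring it makes, and lets failed guesses stand: colors inside \<open>R\<close> carry no
  meaning until their vertices leave \<open>R\<close>. It is therefore enough that for every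
  reachable \<open>R\<close> some tuple must succeed.

  Let \<open>h = q div 4\<close>. Since \<open>T\<close> is \<open>n / h\<close> rounded up, at most
  \<open>h\<close> removals occur and use \<open>2 * h\<close> colors; the closing step needs
  \<open>h + 4\<close> more. The sum \<open>3 * h + 4\<close> is at most \<open>4 * h\<close> only
  if \<open>h\<close> is at least 4, which is where the threshold 16 for \<open>q\<close> comes
  from. Smaller \<open>q\<close> gets \<open>d = 1\<close> and \<open>T = k = n + 1\<close>: nothing
  is ever removed and three colors suffice. As \<open>q\<close> tends to infinity, this concerns
  finitely many \<open>n\<close>.

  The claimed time is a two-sided bound, so the program ends with an idle loop over all tuples. A
  polynomial in \<open>(n + 1) ^ k\<close> with \<open>k\<close> of order \<open>n / q ^ 2\<close>
  only changes the constant in the exponent.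

  For the second claim, a foreign program computing \<open>q\<close> has to run first on the same
  memory. It expects the empty graph as input, so the real graph is hidden from it.\<close>

definition set_reg :: "nat \<Rightarrow> nat \<Rightarrow> state \<Rightarrow> state" where
  "set_reg x v s = s\<lparr>reg := (reg s)(x := v)\<rparr>"

definition set_arr :: "nat \<Rightarrow> nat \<Rightarrow> nat \<Rightarrow> state \<Rightarrow> state" where
  "set_arr a i v s = s\<lparr>arr := (arr s)(a := (arr s a)(i := v))\<rparr>"

lemma set_reg_simps [simp]:
  "reg (set_reg x v s) = (reg s)(x := v)" "arr (set_reg x v s) = arr s"
  by (simp_all add: set_reg_def)

lemma set_arr_simps [simp]:
  "reg (set_arr a i v s) = reg s" "arr (set_arr a i v s) = (arr s)(a := (arr s a)(i := v))"
  by (simp_all add: set_arr_def)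

datatype exp = Num nat | Var nat | Plus exp exp | Minus exp exp | Elem nat exp

primrec ev :: "exp \<Rightarrow> state \<Rightarrow> nat" where
  "ev (Num k) s = k"
| "ev (Var x) s = reg s x"
| "ev (Plus a b) s = ev a s + ev b s"
| "ev (Minus a b) s = ev a s - ev b s"
| "ev (Elem a e) s = arr s a (ev e s)"

primrec exp_regs :: "exp \<Rightarrow> nat set" where
  "exp_regs (Num k) = {}"
| "exp_regs (Var x) = {x}"
| "exp_regs (Plus a b) = exp_regs a \<union> exp_regs b"
| "exp_regs (Minus a b) = exp_regs a \<union> exp_regs b"
| "exp_regs (Elem a e) = exp_regs e"

text \<open>Stack discipline: the value ends up in register \<open>r\<close>, and registers from
  \<open>r\<close> on are scratch. The machine has no copy instruction, so a variable is copied by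
  adding it to 0.\<close>

primrec exp_code :: "nat \<Rightarrow> exp \<Rightarrow> program" where
  "exp_code r (Num k) = Const r k"
| "exp_code r (Var x) = Seq (Const r 0) (Add r r x)"
| "exp_code r (Plus a b) = Seq (exp_code r a) (Seq (exp_code (Suc r) b) (Add r r (Suc r)))"
| "exp_code r (Minus a b) = Seq (exp_code r a) (Seq (exp_code (Suc r) b) (Sub r r (Suc r)))"
| "exp_code r (Elem a e) = Seq (exp_code r e) (Load r a r)"

primrec exp_cost :: "exp \<Rightarrow> nat" where
  "exp_cost (Num k) = 1"
| "exp_cost (Var x) = 2"
| "exp_cost (Plus a b) = exp_cost a + (exp_cost b + 1)"
| "exp_cost (Minus a b) = exp_cost a + (exp_cost b + 1)"
| "exp_cost (Elem a e) = exp_cost e + 1"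

text \<open>Arrays are compared in full, registers only below \<open>r\<close>, because compiled
  code leaves temporary values from \<open>r\<close> on.\<close>

definition agree :: "nat \<Rightarrow> state \<Rightarrow> state \<Rightarrow> bool" where
  "agree r s s' \<longleftrightarrow> (\<forall>x<r. reg s' x = reg s x) \<and> arr s' = arr s"

lemma agree_refl [simp]: "agree r s s"
  by (simp add: agree_def)

lemma agree_trans: "agree r s s' \<Longrightarrow> agree r s' s'' \<Longrightarrow> agree r s s''"
  by (simp add: agree_def)

lemma ev_agree: "agree r s s' \<Longrightarrow> exp_regs e \<subseteq> {..<r} \<Longrightarrow> ev e s' = ev e s"
  by (induction e) (auto simp: agree_def)

lemma exec_ConstI: "s' = set_reg x k s \<Longrightarrow> t = 1 \<Longrightarrow> exec (Const x k) s t s'"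
  unfolding set_reg_def using exec.Const by blast

lemma exec_AddI: "s' = set_reg x (reg s y + reg s z) s \<Longrightarrow> t = 1 \<Longrightarrow> exec (Add x y z) s t s'"
  unfolding set_reg_def using exec.Add by blast

lemma exec_SubI: "s' = set_reg x (reg s y - reg s z) s \<Longrightarrow> t = 1 \<Longrightarrow> exec (Sub x y z) s t s'"
  unfolding set_reg_def using exec.Sub by blast

lemma exec_LoadI: "s' = set_reg x (arr s a (reg s y)) s \<Longrightarrow> t = 1 \<Longrightarrow> exec (Load x a y) s t s'"
  unfolding set_reg_def using exec.Load by blast

lemma exec_StoreI: "s' = set_arr a (reg s y) (reg s x) s \<Longrightarrow> t = 1 \<Longrightarrow> exec (Store a y x) s t s'"
  unfolding set_arr_def using exec.Store by blast

lemma exec_SeqI: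
  "exec p s t s' \<Longrightarrow> exec p' s' t' s'' \<Longrightarrow> t'' = t + t' \<Longrightarrow> exec (Seq p p') s t'' s''"
  by (simp add: exec.Seq)

text \<open>The second operand is evaluated one register higher; agreement below
  \<open>Suc r\<close> protects the first operand waiting in \<open>r\<close>.\<close>

lemma exec_exp_code:
  "exp_regs e \<subseteq> {..<r} \<Longrightarrow>
     \<exists>s'. exec (exp_code r e) s (exp_cost e) s' \<and> reg s' r = ev e s \<and> agree r s s'"
proof (induction e arbitrary: r s)
  case (Num k)
  show ?case
    by (rule exI[of _ "set_reg r k s"]) (auto intro!: exec_ConstI simp: agree_def)
next
  case (Var x)
  have "exec (exp_code r (Var x)) s 2 (set_reg r (reg s x) (set_reg r 0 s))"
    unfolding exp_code.simps
    by (rule exec_SeqI[OF exec_ConstI[OF refl refl] exec_AddI[OF _ refl]])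
       (use Var in \<open>auto simp: set_reg_def\<close>)
  then show ?case by (auto simp: agree_def intro!: exI)
next
  case (Plus a b)
  from Plus.IH(1)[of r s] Plus.prems obtain s1
    where s1: "exec (exp_code r a) s (exp_cost a) s1" "reg s1 r = ev a s" "agree r s s1" by auto
  from Plus.IH(2)[of "Suc r" s1] Plus.prems obtain s2
    where s2: "exec (exp_code (Suc r) b) s1 (exp_cost b) s2" "reg s2 (Suc r) = ev b s1"
      "agree (Suc r) s1 s2" by force
  have b: "ev b s1 = ev b s" using ev_agree s1(3) Plus.prems by auto
  have "reg s2 r = ev a s" using s1 s2 by (auto simp: agree_def)
  then have "exec (exp_code r (Plus a b)) s (exp_cost (Plus a b))
      (set_reg r (ev a s + ev b s) s2)"
    using s1 s2 b by (auto intro!: exec_SeqI[OF s1(1)] exec_SeqI[OF s2(1)] exec_AddI)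
  then show ?case using s1 s2 by (auto simp: agree_def intro!: exI)
next
  case (Minus a b)
  from Minus.IH(1)[of r s] Minus.prems obtain s1
    where s1: "exec (exp_code r a) s (exp_cost a) s1" "reg s1 r = ev a s" "agree r s s1" by auto
  from Minus.IH(2)[of "Suc r" s1] Minus.prems obtain s2
    where s2: "exec (exp_code (Suc r) b) s1 (exp_cost b) s2" "reg s2 (Suc r) = ev b s1"
      "agree (Suc r) s1 s2" by force
  have b: "ev b s1 = ev b s" using ev_agree s1(3) Minus.prems by auto
  have "reg s2 r = ev a s" using s1 s2 by (auto simp: agree_def)
  then have "exec (exp_code r (Minus a b)) s (exp_cost (Minus a b))
      (set_reg r (ev a s - ev b s) s2)"
    using s1 s2 b by (auto intro!: exec_SeqI[OF s1(1)] exec_SeqI[OF s2(1)] exec_SubI)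
  then show ?case using s1 s2 by (auto simp: agree_def intro!: exI)
next
  case (Elem a e)
  from Elem.IH[of r s] Elem.prems obtain s1
    where s1: "exec (exp_code r e) s (exp_cost e) s1" "reg s1 r = ev e s" "agree r s s1" by auto
  have "exec (exp_code r (Elem a e)) s (exp_cost (Elem a e))
      (set_reg r (arr s a (ev e s)) s1)"
    using s1 by (auto intro!: exec_SeqI[OF s1(1)] exec_LoadI simp: agree_def)
  then show ?case using s1 by (auto simp: agree_def intro!: exI)
qed

section \<open>Commands: semantics, exact cost and compilation\<close>

datatype cmd =
    Skip
  | Asg nat exp
  | Sto nat exp exp
  | Semi cmd cmd (infixr \<open>;;\<close> 60)
  | Ite exp cmd cmd
  | For nat nat cmd

text \<open>
  \<open>For x y c\<close> runs \<open>c\<close> with \<open>x\<close> set to \<open>m - 1, \<dots>, 0\<close>, where \<open>m\<close> is the value of \<open>y\<close> on entry.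
\<close>

primrec loop :: "(state \<Rightarrow> state) \<Rightarrow> nat \<Rightarrow> nat \<Rightarrow> state \<Rightarrow> state" where
  "loop f x 0 s = s"
| "loop f x (Suc i) s = loop f x i (f (set_reg x i s))"

text \<open>Each round pays 3 for the test and the two instructions that decrement the counter; the
  1 at the end is the failing test.\<close>

primrec loop_cost :: "(state \<Rightarrow> state) \<Rightarrow> (state \<Rightarrow> nat) \<Rightarrow> nat \<Rightarrow> nat \<Rightarrow> state \<Rightarrow> nat" where
  "loop_cost f g x 0 s = 1"
| "loop_cost f g x (Suc i) s = 3 + g (set_reg x i s) + loop_cost f g x i (f (set_reg x i s))"

primrec sem :: "cmd \<Rightarrow> state \<Rightarrow> state" where
  "sem Skip s = s"
| "sem (Asg x e) s = set_reg x (ev e s) s"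
| "sem (Sto a i e) s = set_arr a (ev i s) (ev e s) s"
| "sem (c ;; d) s = sem d (sem c s)"
| "sem (Ite e c d) s = (if 0 < ev e s then sem c s else sem d s)"
| "sem (For x y c) s = loop (sem c) x (reg s y) (set_reg x (reg s y) s)"

text \<open>Exact step counts rather than upper bounds, because \<open>exec\<close> determines the
  number of steps; each clause mirrors the instructions of \<open>code\<close>.\<close>

primrec cost :: "cmd \<Rightarrow> state \<Rightarrow> nat" where
  "cost Skip s = 1"
| "cost (Asg x e) s = exp_cost e + 2"
| "cost (Sto a i e) s = exp_cost i + (exp_cost e + 1)"
| "cost (c ;; d) s = cost c s + cost d (sem c s)"
| "cost (Ite e c d) s = exp_cost e + (1 + (if 0 < ev e s then cost c s else cost d s))"
| "cost (For x y c) s = 2 + loop_cost (sem c) (cost c) x (reg s y) (set_reg x (reg s y) s)"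

primrec code :: "nat \<Rightarrow> cmd \<Rightarrow> program" where
  "code r Skip = Const r 0"
| "code r (Asg x e) = Seq (exp_code r e) (Seq (Const (Suc r) 0) (Add x r (Suc r)))"
| "code r (Sto a i e) = Seq (exp_code r i) (Seq (exp_code (Suc r) e) (Store a r (Suc r)))"
| "code r (c ;; d) = Seq (code r c) (code r d)"
| "code r (Ite e c d) = Seq (exp_code r e) (Cond r (code r c) (code r d))"
| "code r (For x y c) = Seq (Const r 0) (Seq (Add x r y)
     (While x (Seq (Const r 1) (Seq (Sub x x r) (code r c)))))"

primrec written :: "cmd \<Rightarrow> nat set" where
  "written Skip = {}"
| "written (Asg x e) = {x}"
| "written (Sto a i e) = {}"
| "written (c ;; d) = written c \<union> written d"
| "written (Ite e c d) = written c \<union> written d"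
| "written (For x y c) = insert x (written c)"

primrec written_arrs :: "cmd \<Rightarrow> nat set" where
  "written_arrs Skip = {}"
| "written_arrs (Asg x e) = {}"
| "written_arrs (Sto a i e) = {a}"
| "written_arrs (c ;; d) = written_arrs c \<union> written_arrs d"
| "written_arrs (Ite e c d) = written_arrs c \<union> written_arrs d"
| "written_arrs (For x y c) = written_arrs c"

primrec bounds :: "cmd \<Rightarrow> nat set" where
  "bounds Skip = {}"
| "bounds (Asg x e) = {}"
| "bounds (Sto a i e) = {}"
| "bounds (c ;; d) = bounds c \<union> bounds d"
| "bounds (Ite e c d) = bounds c \<union> bounds d"
| "bounds (For x y c) = insert y (bounds c)"

text \<open>The compiled loop uses \<open>x\<close> itself as its counter, so the body must not
  write it. Stability of the bounds is imposed separately, where running times are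
  estimated.\<close>

primrec wf_cmd :: "nat \<Rightarrow> cmd \<Rightarrow> bool" where
  "wf_cmd r Skip \<longleftrightarrow> True"
| "wf_cmd r (Asg x e) \<longleftrightarrow> x < r \<and> exp_regs e \<subseteq> {..<r}"
| "wf_cmd r (Sto a i e) \<longleftrightarrow> exp_regs i \<subseteq> {..<r} \<and> exp_regs e \<subseteq> {..<r}"
| "wf_cmd r (c ;; d) \<longleftrightarrow> wf_cmd r c \<and> wf_cmd r d"
| "wf_cmd r (Ite e c d) \<longleftrightarrow> exp_regs e \<subseteq> {..<r} \<and> wf_cmd r c \<and> wf_cmd r d"
| "wf_cmd r (For x y c) \<longleftrightarrow> x < r \<and> y < r \<and> x \<notin> written c \<and> wf_cmd r c"

lemma loop_reg: "(\<And>s. reg (f s) r = reg s r) \<Longrightarrow> r \<noteq> x \<Longrightarrow> reg (loop f x i s) r = reg s r"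
  by (induction i arbitrary: s) auto

lemma loop_arr: "(\<And>s. arr (f s) a = arr s a) \<Longrightarrow> arr (loop f x i s) a = arr s a"
  by (induction i arbitrary: s) auto

lemma sem_reg: "r \<notin> written c \<Longrightarrow> reg (sem c s) r = reg s r"
  by (induction c arbitrary: s) (auto simp: loop_reg)

lemma sem_arr: "a \<notin> written_arrs c \<Longrightarrow> arr (sem c s) a = arr s a"
  by (induction c arbitrary: s) (auto simp: loop_arr)

text \<open>A simulation up to scratch registers. The machine state \<open>u\<close> is kept general
  because each part of a compound command starts with whatever scratch values the previous part
  left.\<close>

lemma exec_code:
  "wf_cmd r c \<Longrightarrow> agree r s u \<Longrightarrow> \<exists>u'. exec (code r c) u (cost c s) u' \<and> agree r (sem c s) u'"
proof (induction c arbitrary: s u)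
  case Skip
  have "exec (code r Skip) u 1 (set_reg r 0 u)" by (auto intro!: exec_ConstI)
  moreover have "agree r s (set_reg r 0 u)" using Skip by (auto simp: agree_def)
  ultimately show ?case by auto
next
  case (Asg x e)
  from exec_exp_code[of e r u] Asg obtain u1
    where u1: "exec (exp_code r e) u (exp_cost e) u1" "reg u1 r = ev e u" "agree r u u1" by auto
  have "exec (code r (Asg x e)) u (exp_cost e + 2) (set_reg x (ev e u) (set_reg (Suc r) 0 u1))"
    unfolding code.simps
    by (rule exec_SeqI[OF u1(1) exec_SeqI[OF exec_ConstI[OF refl refl] exec_AddI]])
       (use u1 in auto)
  moreover have "ev e u = ev e s" using ev_agree Asg by auto
  moreover have "agree r (set_reg x (ev e s) s) (set_reg x (ev e s) (set_reg (Suc r) 0 u1))"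
    using u1(3) Asg by (auto simp: agree_def)
  ultimately show ?case by auto
next
  case (Sto a i e)
  from exec_exp_code[of i r u] Sto obtain u1
    where u1: "exec (exp_code r i) u (exp_cost i) u1" "reg u1 r = ev i u" "agree r u u1" by auto
  from exec_exp_code[of e "Suc r" u1] Sto obtain u2
    where u2: "exec (exp_code (Suc r) e) u1 (exp_cost e) u2" "reg u2 (Suc r) = ev e u1"
      "agree (Suc r) u1 u2" by force
  have 1: "ev i u = ev i s" using ev_agree Sto by auto
  have 2: "ev e u1 = ev e s" using ev_agree agree_trans[OF Sto.prems(2) u1(3)] Sto by auto
  have 3: "reg u2 r = ev i s" using u1 u2 1 by (auto simp: agree_def)
  have "exec (code r (Sto a i e)) u (cost (Sto a i e) s) (set_arr a (ev i s) (ev e s) u2)"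
    unfolding code.simps
    by (rule exec_SeqI[OF u1(1) exec_SeqI[OF u2(1) exec_StoreI]])
       (use 1 2 3 u2 in auto)
  moreover have "agree r (set_arr a (ev i s) (ev e s) s) (set_arr a (ev i s) (ev e s) u2)"
    using u1(3) u2(3) Sto by (auto simp: agree_def)
  ultimately show ?case by auto
next
  case (Semi c d)
  from Semi.IH(1)[of s u] Semi.prems obtain u1
    where u1: "exec (code r c) u (cost c s) u1" "agree r (sem c s) u1" by auto
  from Semi.IH(2)[of "sem c s" u1] Semi.prems u1 obtain u2
    where u2: "exec (code r d) u1 (cost d (sem c s)) u2" "agree r (sem d (sem c s)) u2" by auto
  show ?case using u1 u2 by (auto intro!: exec_SeqI)
next
  case (Ite e c d)
  from exec_exp_code[of e r u] Ite obtain u1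
    where u1: "exec (exp_code r e) u (exp_cost e) u1" "reg u1 r = ev e u" "agree r u u1" by auto
  have e: "ev e u = ev e s" using ev_agree Ite by auto
  have a: "agree r s u1" using agree_trans Ite u1 by blast
  show ?case
  proof (cases "0 < ev e s")
    case True
    from Ite.IH(1)[of s u1] Ite.prems a obtain u2
      where u2: "exec (code r c) u1 (cost c s) u2" "agree r (sem c s) u2" by auto
    have "exec (code r (Ite e c d)) u (exp_cost e + (1 + cost c s)) u2"
      unfolding code.simps
      by (rule exec.Seq[OF u1(1) exec.CondPos[OF _ u2(1)]]) (use u1 e True in simp)
    then show ?thesis using u2 True by auto
  next
    case False
    from Ite.IH(2)[of s u1] Ite.prems a obtain u2
      where u2: "exec (code r d) u1 (cost d s) u2" "agree r (sem d s) u2" by auto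
    have "exec (code r (Ite e c d)) u (exp_cost e + (1 + cost d s)) u2"
      unfolding code.simps
      by (rule exec.Seq[OF u1(1) exec.CondZero[OF _ u2(1)]]) (use u1 e False in simp)
    then show ?thesis using u2 False by auto
  qed
next
  case (For x y c)
  let ?b = "Seq (Const r 1) (Seq (Sub x x r) (code r c))"
  have x: "x < r" "y < r" "x \<notin> written c" using For by auto
  have while: "\<exists>u'. exec (While x ?b) u (loop_cost (sem c) (cost c) x i s) u' \<and>
      agree r (loop (sem c) x i s) u'"
    if "agree r s u" "reg s x = i" for i s u
    using that
  proof (induction i arbitrary: s u)
    case 0
    then have "reg u x = 0" using x by (simp add: agree_def)
    then have "exec (While x ?b) u 1 u" by (rule exec.WhileZero)
    then show ?case using 0 by (intro exI[of _ u]) simp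
  next
    case (Suc i)
    let ?u1 = "set_reg x i (set_reg r 1 u)"
    have ux: "reg u x = Suc i" using Suc x by (auto simp: agree_def)
    have a: "agree r (set_reg x i s) ?u1" using Suc x by (auto simp: agree_def)
    from For.IH[OF _ a] For.prems obtain u2
      where u2: "exec (code r c) ?u1 (cost c (set_reg x i s)) u2"
        "agree r (sem c (set_reg x i s)) u2" by auto
    have "exec ?b u (1 + (1 + cost c (set_reg x i s))) u2"
      by (rule exec.Seq[OF exec_ConstI[OF refl refl] exec.Seq[OF exec_SubI[OF _ refl] u2(1)]])
         (use ux x in \<open>auto simp: set_reg_def\<close>)
    moreover have "reg (sem c (set_reg x i s)) x = i" using x by (simp add: sem_reg)
    moreover from Suc.IH[OF u2(2) this] obtain u3 where u3:
      "exec (While x ?b) u2 (loop_cost (sem c) (cost c) x i (sem c (set_reg x i s))) u3"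
      "agree r (loop (sem c) x i (sem c (set_reg x i s))) u3" by auto
    ultimately have "exec (While x ?b) u (1 + (1 + (1 + cost c (set_reg x i s))) +
        loop_cost (sem c) (cost c) x i (sem c (set_reg x i s))) u3"
      using ux by (intro exec.WhilePos) auto
    then show ?case using u3 by (auto simp: eval_nat_numeral)
  qed
  let ?s = "set_reg x (reg s y) s" and ?u = "set_reg x (reg s y) (set_reg r 0 u)"
  have "agree r ?s ?u" using For.prems by (auto simp: agree_def)
  from while[OF this, of "reg s y"] obtain u' where u':
    "exec (While x ?b) ?u (loop_cost (sem c) (cost c) x (reg s y) ?s) u'"
    "agree r (loop (sem c) x (reg s y) ?s) u'" by auto
  have "exec (code r (For x y c)) u
      (1 + (1 + loop_cost (sem c) (cost c) x (reg s y) ?s)) u'"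
    unfolding code.simps
    by (rule exec.Seq[OF exec_ConstI[OF refl refl] exec.Seq[OF exec_AddI[OF _ refl] u'(1)]])
       (use x For.prems in \<open>auto simp: agree_def\<close>)
  then show ?case using u' by auto
qed

lemma loop_cost_le:
  assumes "\<And>s. P s \<Longrightarrow> g s \<le> b" "\<And>s. P s \<Longrightarrow> P (f s)" "\<And>s i. P s \<Longrightarrow> P (set_reg x i s)"
  shows "P s \<Longrightarrow> loop_cost f g x i s \<le> 1 + i * (3 + b)"
proof (induction i arbitrary: s)
  case (Suc i)
  have "loop_cost f g x i (f (set_reg x i s)) \<le> 1 + i * (3 + b)"
    using Suc.prems assms by (intro Suc.IH) auto
  moreover have "g (set_reg x i s) \<le> b" using Suc.prems assms by auto
  ultimately show ?case by simp
qed simp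

text \<open>Serves the lower bound on the running time, through the idle loop at the end of the
  program.\<close>

lemma loop_cost_ge: "i \<le> loop_cost f g x i s"
proof (induction i arbitrary: s)
  case (Suc i)
  from Suc[of "f (set_reg x i s)"] show ?case by simp
qed simp

lemma cost_For_ge: "reg s y \<le> cost (For x y c) s"
  using loop_cost_ge[of "reg s y" "sem c" "cost c" x "set_reg x (reg s y) s"] by simp

text \<open>Exponents are added instead of maximized; only the existence of some degree matters
  later.\<close>

lemma power_bound_add:
  fixes m :: nat
  assumes "a \<le> A * m ^ i" "b \<le> B * m ^ j" "1 \<le> m"
  shows "a + b \<le> (A + B) * m ^ (i + j)"
proof -
  have "a \<le> A * m ^ (i + j)"
    using assms(1) power_increasing[of i "i + j" m] assms(3)
    by (meson le_add1 mult_le_mono2 order_trans)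
  moreover have "b \<le> B * m ^ (i + j)"
    using assms(2) power_increasing[of j "i + j" m] assms(3)
    by (meson le_add2 mult_le_mono2 order_trans)
  ultimately show ?thesis by (simp add: algebra_simps)
qed

text \<open>The disjointness lets every loop bound keep its initial value throughout, so one
  \<open>m\<close> controls the rounds of all nested loops. \<open>C\<close> and \<open>D\<close>
  depend on the command only.\<close>

lemma cost_poly:
  "bounds c \<inter> written c = {} \<Longrightarrow> \<exists>C D. \<forall>s. \<forall>m\<ge>1. (\<forall>y\<in>bounds c. reg s y \<le> m) \<longrightarrow> cost c s \<le> C * m ^ D"
proof (induction c)
  case Skip
  show ?case by (intro exI[of _ 1] exI[of _ 0]) auto
next
  case (Asg x e)
  show ?case by (intro exI[of _ "exp_cost e + 2"] exI[of _ 0]) auto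
next
  case (Sto a i e)
  show ?case by (intro exI[of _ "exp_cost i + (exp_cost e + 1)"] exI[of _ 0]) auto
next
  case (Semi c d)
  from Semi.IH(1) Semi.prems obtain C D where c:
    "\<And>s m. m \<ge> 1 \<Longrightarrow> \<forall>y\<in>bounds c. reg s y \<le> m \<Longrightarrow> cost c s \<le> C * m ^ D" by auto
  from Semi.IH(2) Semi.prems obtain C' D' where d:
    "\<And>s m. m \<ge> 1 \<Longrightarrow> \<forall>y\<in>bounds d. reg s y \<le> m \<Longrightarrow> cost d s \<le> C' * m ^ D'" by auto
  have "cost (c ;; d) s \<le> (C + C') * m ^ (D + D')"
    if m: "m \<ge> 1" "\<forall>y\<in>bounds (c ;; d). reg s y \<le> m" for s m
  proof -
    have "\<forall>y\<in>bounds d. reg (sem c s) y \<le> m"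
      using m(2) Semi.prems sem_reg[of _ c s] by fastforce
    then show ?thesis using c[of m s] d[of m "sem c s"] m by (auto intro!: power_bound_add)
  qed
  then show ?case by blast
next
  case (Ite e c d)
  from Ite.IH(1) Ite.prems obtain C D where c:
    "\<And>s m. m \<ge> 1 \<Longrightarrow> \<forall>y\<in>bounds c. reg s y \<le> m \<Longrightarrow> cost c s \<le> C * m ^ D" by auto
  from Ite.IH(2) Ite.prems obtain C' D' where d:
    "\<And>s m. m \<ge> 1 \<Longrightarrow> \<forall>y\<in>bounds d. reg s y \<le> m \<Longrightarrow> cost d s \<le> C' * m ^ D'" by auto
  have "cost (Ite e c d) s \<le> ((exp_cost e + 1) + (C + C')) * m ^ (0 + (D + D'))"
    if m: "m \<ge> 1" "\<forall>y\<in>bounds (Ite e c d). reg s y \<le> m" for s m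
  proof -
    have "cost c s + cost d s \<le> (C + C') * m ^ (D + D')"
      using c[of m s] d[of m s] m by (auto intro!: power_bound_add)
    then have "(exp_cost e + 1) + (cost c s + cost d s) \<le>
        ((exp_cost e + 1) + (C + C')) * m ^ (0 + (D + D'))"
      using m(1) by (intro power_bound_add[of "exp_cost e + 1" "exp_cost e + 1" m 0]) auto
    moreover have "cost (Ite e c d) s \<le> (exp_cost e + 1) + (cost c s + cost d s)" by simp
    ultimately show ?thesis by linarith
  qed
  then show ?case by blast
next
  case (For x y c)
  from For.IH For.prems obtain C D where c:
    "\<And>s m. m \<ge> 1 \<Longrightarrow> \<forall>y\<in>bounds c. reg s y \<le> m \<Longrightarrow> cost c s \<le> C * m ^ D" by auto
  have "cost (For x y c) s \<le> (3 + (3 + C)) * m ^ (0 + (1 + D))"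
    if m: "m \<ge> 1" "\<forall>y\<in>bounds (For x y c). reg s y \<le> m" for s m
  proof -
    have "loop_cost (sem c) (cost c) x (reg s y) (set_reg x (reg s y) s)
        \<le> 1 + reg s y * (3 + C * m ^ D)"
    proof (rule loop_cost_le[where P = "\<lambda>t. \<forall>y\<in>bounds c. reg t y \<le> m"])
      show "\<forall>y\<in>bounds c. reg (sem c t) y \<le> m" if "\<forall>y\<in>bounds c. reg t y \<le> m" for t
        using that For.prems sem_reg[of _ c t] by fastforce
    qed (use c m For.prems in auto)
    also have "\<dots> \<le> 1 + m * (3 + C * m ^ D)" using m by simp
    finally have "cost (For x y c) s \<le> 3 + (3 * m + C * m ^ Suc D)"
      by (simp add: algebra_simps)
    also have "3 * m + C * m ^ Suc D \<le> (3 + C) * m ^ (1 + D)"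
      using m(1) self_le_power[of m "1 + D"] by (simp add: algebra_simps)
    finally have "cost (For x y c) s \<le> 3 + (3 + C) * m ^ (1 + D)" by simp
    also have "\<dots> \<le> (3 + (3 + C)) * m ^ (0 + (1 + D))"
      using m(1) by (intro power_bound_add) auto
    finally show ?thesis .
  qed
  then show ?case by blast
qed

section \<open>Invariants of loops that count down\<close>

lemma loop_inv:
  assumes "\<And>i s. i < m \<Longrightarrow> I (Suc i) s \<Longrightarrow> I i (f (set_reg x i s))"
  shows "j \<le> m \<Longrightarrow> I j s \<Longrightarrow> I 0 (loop f x j s)"
  by (induction j arbitrary: s) (auto simp: assms)

definition same_but :: "nat set \<Rightarrow> nat set \<Rightarrow> state \<Rightarrow> state \<Rightarrow> bool" where
  "same_but W A s t \<longleftrightarrow> (\<forall>r. r \<notin> W \<longrightarrow> reg t r = reg s r) \<and> (\<forall>a. a \<notin> A \<longrightarrow> arr t a = arr s a)"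

lemma same_but_sem: "same_but (written c) (written_arrs c) s (sem c s)"
  by (simp add: same_but_def sem_reg sem_arr)

text \<open>As the counter runs downwards, \<open>I i\<close> usually says that all indices from
  \<open>i\<close> on have been treated. The frame \<open>same_but\<close> is supplied for free, so
  invariants need only mention what changes.\<close>

lemma For_inv:
  assumes "I (reg s y) (set_reg x (reg s y) s)"
    and "\<And>i t. i < reg s y \<Longrightarrow> same_but (insert x (written c)) (written_arrs c) s t \<Longrightarrow>
           I (Suc i) t \<Longrightarrow> I i (sem c (set_reg x i t))"
  shows "I 0 (sem (For x y c) s)"
proof -
  let ?J = "\<lambda>i t. I i t \<and> same_but (insert x (written c)) (written_arrs c) s t"
  have "?J 0 (loop (sem c) x (reg s y) (set_reg x (reg s y) s))"
  proof (rule loop_inv[where I = ?J and m = "reg s y"])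
    fix i t assume "i < reg s y" "?J (Suc i) t"
    then show "?J i (sem c (set_reg x i t))"
      using assms(2) by (auto simp: same_but_def sem_reg sem_arr)
  qed (use assms(1) in \<open>auto simp: same_but_def\<close>)
  then show ?thesis by simp
qed

declare sem.simps(6) [simp del]
declare One_nat_def [simp del]

text \<open>A test counts as true iff its value is positive. The sum of the two truncated
  differences is the distance of the values.\<close>

definition eq_exp :: "exp \<Rightarrow> exp \<Rightarrow> exp" where
  "eq_exp a b = Minus (Num 1) (Plus (Minus a b) (Minus b a))"

definition le_exp :: "exp \<Rightarrow> exp \<Rightarrow> exp" where
  "le_exp a b = Minus (Num 1) (Minus a b)"

definition lt_exp :: "exp \<Rightarrow> exp \<Rightarrow> exp" where
  "lt_exp a b = Minus b a"

text \<open>With truncated subtraction this is the minimum, which is positive iff both arguments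
  are.\<close>

definition and_exp :: "exp \<Rightarrow> exp \<Rightarrow> exp" where
  "and_exp a b = Minus a (Minus a b)"

definition not_exp :: "exp \<Rightarrow> exp" where
  "not_exp a = Minus (Num 1) a"

lemma ev_tests [simp]:
  "0 < ev (eq_exp a b) s \<longleftrightarrow> ev a s = ev b s"
  "0 < ev (le_exp a b) s \<longleftrightarrow> ev a s \<le> ev b s"
  "0 < ev (lt_exp a b) s \<longleftrightarrow> ev a s < ev b s"
  "0 < ev (and_exp a b) s \<longleftrightarrow> 0 < ev a s \<and> 0 < ev b s"
  "0 < ev (not_exp a) s \<longleftrightarrow> ev a s = 0"
  by (auto simp: eq_exp_def le_exp_def lt_exp_def and_exp_def not_exp_def)

lemma exp_regs_tests [simp]:
  "exp_regs (eq_exp a b) = exp_regs a \<union> exp_regs b"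
  "exp_regs (le_exp a b) = exp_regs a \<union> exp_regs b"
  "exp_regs (lt_exp a b) = exp_regs a \<union> exp_regs b"
  "exp_regs (and_exp a b) = exp_regs a \<union> exp_regs b"
  "exp_regs (not_exp a) = exp_regs a"
  by (auto simp: eq_exp_def le_exp_def lt_exp_def and_exp_def not_exp_def)

section \<open>The configuration of the main loop\<close>

abbreviation (input) "rN \<equiv> 0::nat"      abbreviation (input) "rQ \<equiv> 1::nat"
abbreviation (input) "rD \<equiv> 2::nat"      abbreviation (input) "rT \<equiv> 3::nat"
abbreviation (input) "rK \<equiv> 4::nat"      abbreviation (input) "rBase \<equiv> 5::nat"
abbreviation (input) "rTuples \<equiv> 6::nat" abbreviation (input) "rPass \<equiv> 7::nat"
abbreviation (input) "rJ \<equiv> 8::nat"      abbreviation (input) "rF \<equiv> 9::nat"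
abbreviation (input) "rDone \<equiv> 10::nat"  abbreviation (input) "rJJ \<equiv> 11::nat"
abbreviation (input) "rE \<equiv> 12::nat"     abbreviation (input) "rQuot \<equiv> 13::nat"
abbreviation (input) "rI \<equiv> 14::nat"     abbreviation (input) "rZ \<equiv> 15::nat"
abbreviation (input) "rW \<equiv> 16::nat"     abbreviation (input) "rU \<equiv> 17::nat"
abbreviation (input) "rX \<equiv> 18::nat"     abbreviation (input) "rCol \<equiv> 19::nat"
abbreviation (input) "rOk \<equiv> 20::nat"    abbreviation (input) "rCnt \<equiv> 21::nat"
abbreviation (input) "rLu \<equiv> 22::nat"    abbreviation (input) "rMu \<equiv> 23::nat"
abbreviation (input) "rLw \<equiv> 24::nat"    abbreviation (input) "rMw \<equiv> 25::nat"
abbreviation (input) "rDeg \<equiv> 26::nat"   abbreviation (input) "rV \<equiv> 27::nat"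
abbreviation (input) "rC \<equiv> 28::nat"     abbreviation (input) "rBad \<equiv> 29::nat"

abbreviation (input) "aAdj \<equiv> 0::nat"    abbreviation (input) "aCol \<equiv> 1::nat"
abbreviation (input) "aRow \<equiv> 2::nat"    abbreviation (input) "aRest \<equiv> 3::nat"
abbreviation (input) "aNb \<equiv> 4::nat"     abbreviation (input) "aLab \<equiv> 5::nat"
abbreviation (input) "aNeg \<equiv> 6::nat"    abbreviation (input) "aCls \<equiv> 7::nat"
abbreviation (input) "aOut \<equiv> 8::nat"    abbreviation (input) "aLow \<equiv> 9::nat"

text \<open>The machine cannot multiply, so the row offsets \<open>u * n\<close> are tabulated in
  \<open>aRow\<close>.\<close>

definition adj_exp :: "nat \<Rightarrow> nat \<Rightarrow> exp" where
  "adj_exp u w = Elem aAdj (Plus (Elem aRow (Var u)) (Var w))"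

lemma exp_regs_adj [simp]: "exp_regs (adj_exp u w) = {u, w}"
  by (auto simp: adj_exp_def)

definition elt :: "nat \<Rightarrow> nat \<Rightarrow> exp" where
  "elt a x = Elem a (Var x)"

lemma exp_regs_at [simp]: "exp_regs (elt a x) = {x}"
  by (simp add: elt_def)

lemma ev_at [simp]: "ev (elt a x) s = arr s a (reg s x)"
  by (simp add: elt_def)

locale config =
  fixes n q d T k :: nat and E :: "nat set set"
  assumes n_pos: "1 \<le> n" and simple: "simple_graph {..<n} E"
begin

definition adj :: "nat \<Rightarrow> nat \<Rightarrow> bool" where
  "adj u w \<longleftrightarrow> {u, w} \<in> E"

lemma adj_sym: "adj u w \<longleftrightarrow> adj w u"
  by (simp add: adj_def insert_commute)

lemma adj_irrefl [simp]: "\<not> adj u u"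
  using simple by (fastforce simp: adj_def simple_graph_def)

text \<open>The read-only part of the state during the main loop. It explains why the frame lemmas
  below ask for registers above 6 and for arrays other than \<open>aAdj\<close> and
  \<open>aRow\<close>.\<close>

definition cfg :: "state \<Rightarrow> bool" where
  "cfg s \<longleftrightarrow> reg s rN = n \<and> reg s rQ = q \<and> reg s rD = d \<and> reg s rT = T \<and> reg s rK = k \<and>
     reg s rBase = Suc n \<and> reg s rTuples = Suc n ^ k \<and> (\<forall>u<n. arr s aRow u = u * n) \<and>
     (\<forall>u<n. \<forall>w<n. arr s aAdj (u * n + w) = (if adj u w then 1 else 0))"

lemma cfg_set_reg [simp]: "6 < x \<Longrightarrow> cfg (set_reg x v s) \<longleftrightarrow> cfg s"
  by (simp add: cfg_def)

lemma cfg_set_arr [simp]: "a \<noteq> aAdj \<Longrightarrow> a \<noteq> aRow \<Longrightarrow> cfg (set_arr a i v s) \<longleftrightarrow> cfg s"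
  by (simp add: cfg_def)

lemma cfg_same_but:
  assumes "same_but W A s t" "W \<inter> {..6} = {}" "A \<inter> {aAdj, aRow} = {}" "cfg s"
  shows "cfg t"
proof -
  have "reg t r = reg s r" if "r \<le> 6" for r using assms that by (auto simp: same_but_def)
  moreover have "arr t aAdj = arr s aAdj" "arr t aRow = arr s aRow"
    using assms by (auto simp: same_but_def)
  ultimately show ?thesis using assms(4) by (simp add: cfg_def)
qed

lemma cfg_sem:
  "cfg s \<Longrightarrow> written c \<inter> {..6} = {} \<Longrightarrow> written_arrs c \<inter> {aAdj, aRow} = {} \<Longrightarrow> cfg (sem c s)"
  using cfg_same_but same_but_sem by blast

lemma cfg_reg:
  "cfg s \<Longrightarrow> reg s rN = n" "cfg s \<Longrightarrow> reg s rQ = q" "cfg s \<Longrightarrow> reg s rD = d"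
  "cfg s \<Longrightarrow> reg s rT = T" "cfg s \<Longrightarrow> reg s rK = k" "cfg s \<Longrightarrow> reg s rBase = Suc n"
  "cfg s \<Longrightarrow> reg s rTuples = Suc n ^ k"
  by (auto simp: cfg_def)

lemma ev_adj [simp]:
  "cfg s \<Longrightarrow> reg s u < n \<Longrightarrow> reg s w < n \<Longrightarrow> 0 < ev (adj_exp u w) s \<longleftrightarrow> adj (reg s u) (reg s w)"
  by (auto simp: cfg_def adj_exp_def)

end

section \<open>Two-coloring\<close>

text \<open>
  Every vertex carries a label \<open>l\<close>, and \<open>neg l\<close> is the label of the opposite color. Processing an edge \<open>uw\<close>
  identifies the label of \<open>w\<close> with the negated label of \<open>u\<close> everywhere, so equal labels are forced to have
  equal colors in every proper two-coloring. The final color is the parity of the label.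
\<close>

definition neg :: "nat \<Rightarrow> nat" where
  "neg l = (if even l then Suc l else l - 1)"

lemma neg_neg [simp]: "neg (neg l) = l"
  by (auto simp: neg_def elim: oddE)

lemma neg_neq [simp]: "neg l \<noteq> l" "l \<noteq> neg l"
  by (auto simp: neg_def elim: oddE)

lemma neg_inj: "neg l = neg l' \<longleftrightarrow> l = l'"
  by (metis neg_neg)

lemma neg_swap: "neg l = l' \<longleftrightarrow> l = neg l'"
  by (metis neg_neg)

text \<open>\<open>l < neg l\<close> holds exactly for even \<open>l\<close>, so comparing a label
  with its stored negation tests parity without division.\<close>

lemma less_neg_iff: "neg l < neg (neg l) \<longleftrightarrow> \<not> l < neg l"
  by (auto simp: neg_def elim: oddE)

definition relabel :: "cmd" where
  "relabel = For rX rN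
     (Ite (eq_exp (elt aLab rX) (Var rLw)) (Sto aLab (Var rX) (Var rMu) ;; Sto aNeg (Var rX) (Var rLu))
     (Ite (eq_exp (elt aLab rX) (Var rMw)) (Sto aLab (Var rX) (Var rLu) ;; Sto aNeg (Var rX) (Var rMu))
      Skip))"

text \<open>The four labels are copied to registers first, because \<open>relabel\<close> overwrites
  the entries of \<open>u\<close> and \<open>w\<close> themselves.\<close>

definition merge :: "cmd" where
  "merge = Asg rLu (elt aLab rU) ;; Asg rMu (elt aNeg rU) ;; Asg rLw (elt aLab rW) ;;
     Asg rMw (elt aNeg rW) ;; relabel"

definition merge_all :: "cmd" where
  "merge_all = For rX rN (Sto aLab (Var rX) (Plus (Var rX) (Var rX)) ;;
       Sto aNeg (Var rX) (Plus (Num 1) (Plus (Var rX) (Var rX)))) ;;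
     For rU rN (For rW rN (Ite (and_exp (elt aCls rU) (and_exp (elt aCls rW) (adj_exp rU rW))) merge Skip))"

definition two_color :: "cmd" where
  "two_color = merge_all ;;
     For rX rN (Ite (elt aCls rX) (Ite (lt_exp (elt aLab rX) (elt aNeg rX)) (Sto aCol (Var rX) (Var rCol))
       (Sto aCol (Var rX) (Plus (Num 1) (Var rCol)))) Skip)"

lemma written_relabel [simp]:
  "written relabel = {rX}" "written_arrs relabel = {aLab, aNeg}"
  by (auto simp: relabel_def)

lemma written_merge [simp]:
  "written merge = {rLu, rMu, rLw, rMw, rX}" "written_arrs merge = {aLab, aNeg}"
  by (auto simp: merge_def)

lemma written_merge_all [simp]:
  "written merge_all = {rLu, rMu, rLw, rMw, rX, rU, rW}" "written_arrs merge_all = {aLab, aNeg}"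
  by (auto simp: merge_all_def)

lemma written_two_color [simp]:
  "written two_color = {rLu, rMu, rLw, rMw, rX, rU, rW}" "written_arrs two_color = {aLab, aNeg, aCol}"
  by (auto simp: two_color_def)

context config
begin

text \<open>A signed union: the label pair of \<open>w\<close> is absorbed into the pair of
  \<open>u\<close>, with the sign that makes the two ends opposite.\<close>

definition rel :: "(nat \<Rightarrow> nat) \<Rightarrow> nat \<Rightarrow> nat \<Rightarrow> nat \<Rightarrow> nat" where
  "rel l u w x = (if l x = l w then neg (l u) else if l x = neg (l w) then l u else l x)"

definition labels :: "state \<Rightarrow> bool" where
  "labels s \<longleftrightarrow> (\<forall>x<n. arr s aNeg x = neg (arr s aLab x))"

lemma labels_set_reg [simp]: "labels (set_reg x v s) \<longleftrightarrow> labels s"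
  by (simp add: labels_def)

text \<open>\<open>\<chi>\<close> is a two-coloring that exists in the proof only; the labels never
  claim more than what it satisfies.\<close>

definition consistent :: "(nat \<Rightarrow> bool) \<Rightarrow> (nat \<Rightarrow> nat) \<Rightarrow> bool" where
  "consistent \<chi> l \<longleftrightarrow> (\<forall>x<n. \<forall>y<n. (l x = l y \<longrightarrow> \<chi> x = \<chi> y) \<and> (l x = neg (l y) \<longrightarrow> \<chi> x \<noteq> \<chi> y))"

text \<open>Every new label is, up to sign, the old label of some vertex \<open>a\<close>, and the
  sign records whether \<open>x\<close> and \<open>a\<close> have the same color. Comparing two new
  labels thus reduces to comparing two old ones.\<close>

lemma consistent_rel:
  assumes "consistent \<chi> l" "u < n" "w < n" "\<chi> u \<noteq> \<chi> w"
  shows "consistent \<chi> (rel l u w)"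
proof -
  have *: "(l x = l y \<longrightarrow> \<chi> x = \<chi> y) \<and> (l x = neg (l y) \<longrightarrow> \<chi> x \<noteq> \<chi> y)"
    if "x < n" "y < n" for x y
    using that assms(1) unfolding consistent_def by blast
  have signed: "\<exists>a b. a < n \<and> rel l u w x = (if b then l a else neg (l a)) \<and> \<chi> x = (\<chi> a = b)"
    if "x < n" for x
  proof -
    consider "l x = l w" | "l x \<noteq> l w" "l x = neg (l w)" | "l x \<noteq> l w" "l x \<noteq> neg (l w)" by blast
    then show ?thesis
    proof cases
      case 1
      then have "\<chi> x = \<chi> w" using *[OF that assms(3)] by blast
      moreover have "rel l u w x = neg (l u)" using 1 by (simp add: rel_def)
      ultimately show ?thesis using assms(2,4) by (intro exI[of _ u] exI[of _ False]) simp
    next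
      case 2
      then have "\<chi> x \<noteq> \<chi> w" using *[OF that assms(3)] by blast
      moreover have "rel l u w x = l u" using 2 unfolding rel_def by argo
      moreover have "\<chi> x = \<chi> u" using calculation(1) assms(4) by blast
      ultimately show ?thesis using assms(2) by (intro exI[of _ u] exI[of _ True]) simp
    next
      case 3
      then show ?thesis using that
        by (intro exI[of _ x] exI[of _ True]) (auto simp: rel_def)
    qed
  qed
  show ?thesis
    unfolding consistent_def
  proof (intro allI impI)
    fix x y assume xy: "x < n" "y < n"
    from signed[OF xy(1)] obtain a b
      where a: "a < n" "rel l u w x = (if b then l a else neg (l a))" "\<chi> x = (\<chi> a = b)" by blast
    from signed[OF xy(2)] obtain c e
      where c: "c < n" "rel l u w y = (if e then l c else neg (l c))" "\<chi> y = (\<chi> c = e)" by blast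
    show "(rel l u w x = rel l u w y \<longrightarrow> \<chi> x = \<chi> y) \<and>
        (rel l u w x = neg (rel l u w y) \<longrightarrow> \<chi> x \<noteq> \<chi> y)"
      unfolding a(2,3) c(2,3) using *[OF a(1) c(1)]
      by (cases b; cases e) (auto simp: neg_inj neg_swap)
  qed
qed

lemma rel_new: "rel l u w u = neg (rel l u w w)" if "l u \<noteq> l w"
  using that by (auto simp: rel_def)

text \<open>Relabeling acts on label values and commutes with \<open>neg\<close>, so edges treated
  earlier stay separated.\<close>

lemma rel_old: "l a = neg (l b) \<Longrightarrow> rel l u w a = neg (rel l u w b)"
  by (auto simp: rel_def neg_inj neg_swap)

lemma sem_relabel:
  assumes "cfg s" "x < n"
  shows "arr (sem relabel s) aLab x = (if arr s aLab x = reg s rLw then reg s rMu else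
           if arr s aLab x = reg s rMw then reg s rLu else arr s aLab x)"
    and "arr (sem relabel s) aNeg x = (if arr s aLab x = reg s rLw then reg s rLu else
           if arr s aLab x = reg s rMw then reg s rMu else arr s aNeg x)"
proof -
  let ?l = "\<lambda>x. if arr s aLab x = reg s rLw then reg s rMu else
           if arr s aLab x = reg s rMw then reg s rLu else arr s aLab x"
  let ?m = "\<lambda>x. if arr s aLab x = reg s rLw then reg s rLu else
           if arr s aLab x = reg s rMw then reg s rMu else arr s aNeg x"
  let ?I = "\<lambda>i t. \<forall>x<n. arr t aLab x = (if i \<le> x then ?l x else arr s aLab x) \<and>
     arr t aNeg x = (if i \<le> x then ?m x else arr s aNeg x)"
  have "?I 0 (sem relabel s)"
    unfolding relabel_def
    by (rule For_inv[of ?I]) (use assms in \<open>auto simp: same_but_def cfg_reg less_Suc_eq not_le Suc_le_eq\<close>)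
  then show "arr (sem relabel s) aLab x = ?l x" "arr (sem relabel s) aNeg x = ?m x"
    using assms by auto
qed

lemma sem_merge:
  assumes "cfg s" "labels s" "reg s rU < n" "reg s rW < n"
  shows "labels (sem merge s)"
    and "x < n \<Longrightarrow> arr (sem merge s) aLab x = rel (arr s aLab) (reg s rU) (reg s rW) x"
proof -
  let ?s = "set_reg rMw (neg (arr s aLab (reg s rW))) (set_reg rLw (arr s aLab (reg s rW))
     (set_reg rMu (neg (arr s aLab (reg s rU))) (set_reg rLu (arr s aLab (reg s rU)) s)))"
  have m: "sem merge s = sem relabel ?s" using assms by (simp add: merge_def labels_def)
  have c: "cfg ?s" using assms by simp
  show "labels (sem merge s)"
    using assms sem_relabel[OF c] by (auto simp: m labels_def)
  show "arr (sem merge s) aLab x = rel (arr s aLab) (reg s rU) (reg s rW) x" if "x < n"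
    using assms sem_relabel[OF c that] by (simp add: m rel_def)
qed

lemma consistent_cong: "(\<And>x. x < n \<Longrightarrow> l x = l' x) \<Longrightarrow> consistent \<chi> l = consistent \<chi> l'"
  by (simp add: consistent_def)

text \<open>Two invariants support each other: consistency with \<open>\<chi>\<close> guarantees
  that the ends of the next edge carry different labels, and then the merge separates this edge
  without destroying the separation of the earlier ones.\<close>

lemma sem_merge_all:
  fixes \<chi> :: "nat \<Rightarrow> bool"
  assumes s: "cfg s"
    and \<chi>: "\<And>u w. u < n \<Longrightarrow> w < n \<Longrightarrow> 0 < arr s aCls u \<Longrightarrow> 0 < arr s aCls w \<Longrightarrow> adj u w \<Longrightarrow> \<chi> u \<noteq> \<chi> w"
  shows "labels (sem merge_all s) \<and> (\<forall>u<n. \<forall>w<n. 0 < arr s aCls u \<longrightarrow> 0 < arr s aCls w \<longrightarrow> adj u w \<longrightarrow>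
     arr (sem merge_all s) aLab u = neg (arr (sem merge_all s) aLab w))"
proof -
  let ?A = "\<lambda>u w. u < n \<and> w < n \<and> 0 < arr s aCls u \<and> 0 < arr s aCls w \<and> adj u w"
  let ?ok = "\<lambda>t. labels t \<and> consistent \<chi> (arr t aLab)"
  let ?sep = "\<lambda>t u w. arr t aLab u = neg (arr t aLab w)"
  let ?init = "For rX rN (Sto aLab (Var rX) (Plus (Var rX) (Var rX)) ;;
       Sto aNeg (Var rX) (Plus (Num 1) (Plus (Var rX) (Var rX))))"
  let ?inner = "For rW rN (Ite (and_exp (elt aCls rU) (and_exp (elt aCls rW) (adj_exp rU rW))) merge Skip)"
  let ?J = "\<lambda>i t. \<forall>x<n. i \<le> x \<longrightarrow> arr t aLab x = 2 * x \<and> arr t aNeg x = Suc (2 * x)"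
  have "?J 0 (sem ?init s)"
    by (rule For_inv[of ?J]) (use s in \<open>auto simp: cfg_reg\<close>)
  \<comment> \<open>The initial labels \<open>2 * x\<close> are pairwise different and, being even,
    never negations of each other.\<close>
  then have init: "?ok (sem ?init s)"
    by (auto simp: labels_def consistent_def neg_def) presburger+
  let ?s1 = "sem ?init s"
  have s1: "cfg ?s1" "arr ?s1 aCls = arr s aCls"
    using s cfg_sem[OF s, of ?init] sem_arr[of aCls ?init s] by simp_all
  let ?I = "\<lambda>i t. ?ok t \<and> (\<forall>u w. i \<le> u \<longrightarrow> ?A u w \<longrightarrow> ?sep t u w)"
  have "?I 0 (sem (For rU rN ?inner) ?s1)"
  proof (rule For_inv[of ?I])
    show "?I (reg ?s1 rN) (set_reg rU (reg ?s1 rN) ?s1)"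
      using init s1 by (simp add: cfg_reg labels_def)
  next
    fix i t
    assume i: "i < reg ?s1 rN" and t: "same_but (insert rU (written ?inner)) (written_arrs ?inner) ?s1 t"
      and I: "?I (Suc i) t"
    have i: "i < n" using i s1 by (simp add: cfg_reg)
    let ?t = "set_reg rU i t"
    have t1: "cfg t" using cfg_same_but[OF t _ _ s1(1)] by simp
    have t2: "arr t aCls = arr s aCls" using t s1 by (simp add: same_but_def)
    \<comment> \<open>Rows above \<open>i\<close> are complete, row \<open>i\<close> is treated from
      column \<open>j\<close> on.\<close>
    let ?I' = "\<lambda>j t. ?I (Suc i) t \<and> (\<forall>w. j \<le> w \<longrightarrow> ?A i w \<longrightarrow> ?sep t i w)"
    have "?I' 0 (sem ?inner ?t)"
    proof (rule For_inv[of ?I'])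
      show "?I' (reg ?t rN) (set_reg rW (reg ?t rN) ?t)"
        using I t1 by (auto simp: cfg_reg labels_def)
    next
      fix j v
      assume j: "j < reg ?t rN" and
        v: "same_but (insert rW (written (Ite (and_exp (elt aCls rU) (and_exp (elt aCls rW) (adj_exp rU rW))) merge Skip)))
          (written_arrs (Ite (and_exp (elt aCls rU) (and_exp (elt aCls rW) (adj_exp rU rW))) merge Skip)) ?t v"
        and I': "?I' (Suc j) v"
      have j: "j < n" using j t1 by (simp add: cfg_reg)
      let ?v = "set_reg rW j v"
      have v1: "cfg ?v" using cfg_same_but[OF v] t1 by simp
      have v2: "arr v aCls = arr s aCls" "reg v rU = i" using v t2 by (simp_all add: same_but_def)
      show "?I' j (sem (Ite (and_exp (elt aCls rU) (and_exp (elt aCls rW) (adj_exp rU rW))) merge Skip) ?v)"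
      proof (cases "?A i j")
        case False
        then have eq: "sem (Ite (and_exp (elt aCls rU) (and_exp (elt aCls rW) (adj_exp rU rW))) merge Skip) ?v = ?v"
          using v1 v2 i j by auto
        have "?sep v i w" if "j \<le> w" "?A i w" for w
          using I' False that by (cases "w = j") auto
        then have "?I' j v" using I' by blast
        then show ?thesis unfolding eq by simp
      next
        case True
        then have eq: "sem (Ite (and_exp (elt aCls rU) (and_exp (elt aCls rW) (adj_exp rU rW))) merge Skip) ?v = sem merge ?v"
          using v1 v2 i j by simp
        have lv: "labels ?v" using I' by (simp add: labels_def)
        note m = sem_merge[OF v1 lv]
        have \<chi>ij: "\<chi> i \<noteq> \<chi> j" using True \<chi> by auto
        have cv: "consistent \<chi> (arr v aLab)" using I' by simp
        have m1: "labels (sem merge ?v)" using m(1) v2 i j by simp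
        have m2: "arr (sem merge ?v) aLab x = rel (arr v aLab) i j x" if "x < n" for x
          using m(2) that v2 i j by simp
        have "consistent \<chi> (rel (arr v aLab) i j)" by (rule consistent_rel[OF cv i j \<chi>ij])
        then have m3: "consistent \<chi> (arr (sem merge ?v) aLab)"
          using consistent_cong[of "arr (sem merge ?v) aLab" "rel (arr v aLab) i j"] m2 by auto
        \<comment> \<open>Equal labels would force equal values of \<open>\<chi>\<close>, which an
          edge inside the class excludes.\<close>
        have "arr v aLab i \<noteq> arr v aLab j" using cv \<chi>ij i j unfolding consistent_def by blast
        then have m4: "?sep (sem merge ?v) i j" using m2 i j rel_new by simp
        have m5: "?sep (sem merge ?v) a b" if "?sep v a b" "a < n" "b < n" for a b
          using m2 that rel_old by simp
        have "?sep (sem merge ?v) a b" if "Suc i \<le> a" "?A a b" for a b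
          using m5 I' that by blast
        moreover have "?sep (sem merge ?v) i w" if "j \<le> w" "?A i w" for w
        proof (cases "w = j")
          case False
          then have "?sep v i w" using I' that by simp
          then show ?thesis using m5 that by blast
        qed (use m4 in simp)
        ultimately have "?I' j (sem merge ?v)" using m1 m3 by blast
        then show ?thesis unfolding eq .
      qed
    qed
    then have J: "?I' 0 (sem ?inner ?t)" .
    have "?sep (sem ?inner ?t) u w" if "i \<le> u" "?A u w" for u w
    proof (cases "u = i")
      case False
      then have "Suc i \<le> u" using that by simp
      then show ?thesis using J that by blast
    qed (use J that in blast)
    then show "?I i (sem ?inner ?t)" using J by blast
  qed
  then show ?thesis by (auto simp: merge_all_def)
qed

definition cls :: "state \<Rightarrow> nat \<Rightarrow> bool" where
  "cls s x \<longleftrightarrow> x < n \<and> 0 < arr s aCls x"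

text \<open>Holds for every class, bipartite or not: a wrong guess also receives the colors
  \<open>rCol\<close> and \<open>rCol + 1\<close>, and it is left to \<open>check\<close> to
  discover that they are not proper.\<close>

lemma sem_two_color:
  assumes s: "cfg s"
  shows "arr (sem two_color s) aCol x = (if cls s x then
     (if arr (sem merge_all s) aLab x < arr (sem merge_all s) aNeg x then reg s rCol else Suc (reg s rCol))
     else arr s aCol x)"
proof -
  let ?s = "sem merge_all s"
  have c: "cfg ?s" using cfg_sem[OF s, of merge_all] by simp
  have f: "arr ?s aCls = arr s aCls" "reg ?s rCol = reg s rCol" "arr ?s aCol = arr s aCol"
    by (auto simp: sem_arr sem_reg)
  let ?I = "\<lambda>i t. \<forall>x. arr t aCol x = (if cls s x \<and> i \<le> x then
     (if arr ?s aLab x < arr ?s aNeg x then reg s rCol else Suc (reg s rCol)) else arr s aCol x)"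
  have "?I 0 (sem two_color s)"
    unfolding two_color_def sem.simps(4)
    by (rule For_inv[of ?I])
       (use c f in \<open>auto simp: same_but_def cfg_reg cls_def less_Suc_eq not_le Suc_le_eq\<close>)
  then show ?thesis by simp
qed

lemma two_color_proper:
  fixes \<chi> :: "nat \<Rightarrow> bool"
  assumes s: "cfg s"
    and \<chi>: "\<And>u w. cls s u \<Longrightarrow> cls s w \<Longrightarrow> adj u w \<Longrightarrow> \<chi> u \<noteq> \<chi> w"
    and "cls s u" "cls s w" "adj u w"
  shows "arr (sem two_color s) aCol u \<noteq> arr (sem two_color s) aCol w"
proof -
  note m = sem_merge_all[OF s, of \<chi>]
  have "labels (sem merge_all s)" "arr (sem merge_all s) aLab u = neg (arr (sem merge_all s) aLab w)"
    using m \<chi> assms by (auto simp: cls_def)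
  then show ?thesis using assms by (auto simp: sem_two_color labels_def cls_def less_neg_iff)
qed

end

section \<open>One attempt of the main loop\<close>

text \<open>Division by repeated subtraction. The number of rounds must be fixed beforehand;
  \<open>rTuples\<close> exceeds every quotient that occurs and costs only a polynomial
  factor.\<close>

definition divide :: cmd where
  "divide = Asg rQuot (Num 0) ;;
     For rZ rTuples (Ite (le_exp (Var rBase) (Var rJJ))
       (Asg rJJ (Minus (Var rJJ) (Var rBase)) ;; Asg rQuot (Plus (Var rQuot) (Num 1))) Skip) ;;
     Asg rE (Var rJJ) ;; Asg rJJ (Var rQuot)"

definition mark :: cmd where
  "mark = For rW rN (Ite (adj_exp rE rW) (Sto aNb (Var rW) (Num 1)) Skip)"

definition decode :: cmd where
  "decode = Asg rJJ (Var rJ) ;; For rW rN (Sto aNb (Var rW) (Num 0)) ;;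
     For rI rK (divide ;; Ite (lt_exp (Var rE) (Var rN)) mark Skip)"

definition check :: cmd where
  "check = Asg rOk (Num 1) ;; For rU rN (Ite (elt aCls rU)
     (Ite (and_exp (elt aCol rU) (le_exp (elt aCol rU) (Var rQ))) Skip (Asg rOk (Num 0)) ;;
      For rW rN (Ite (and_exp (elt aCls rW) (and_exp (adj_exp rU rW) (eq_exp (elt aCol rU) (elt aCol rW))))
        (Asg rOk (Num 0)) Skip)) Skip)"

definition select :: cmd where
  "select = Asg rCnt (Num 0) ;; For rX rN (Ite (and_exp (elt aRest rX) (elt aNb rX))
     (Sto aCls (Var rX) (Num 1) ;; Asg rCnt (Plus (Num 1) (Var rCnt))) (Sto aCls (Var rX) (Num 0)))"

definition degree :: cmd where
  "degree = Asg rDeg (Num 0) ;; For rW rN (Ite (and_exp (elt aOut rW) (adj_exp rV rW))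
     (Asg rDeg (Plus (Num 1) (Var rDeg))) Skip)"

definition split :: cmd where
  "split =
     For rV rN (Ite (and_exp (elt aRest rV) (not_exp (elt aNb rV)))
       (Sto aOut (Var rV) (Num 1)) (Sto aOut (Var rV) (Num 0))) ;;
     For rV rN (degree ;; Ite (and_exp (elt aOut rV) (lt_exp (Var rDeg) (Var rD)))
       (Sto aLow (Var rV) (Num 1) ;; Sto aCls (Var rV) (Num 0))
       (Sto aLow (Var rV) (Num 0) ;; Sto aCls (Var rV) (elt aOut rV)))"

definition conflict :: cmd where
  "conflict = Asg rBad (Num 0) ;;
     For rW rN (Ite (and_exp (elt aLow rW) (and_exp (adj_exp rV rW)
         (eq_exp (elt aCol rW) (Plus (Var rC) (Var rCol)))))
       (Asg rBad (Num 1)) Skip)"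

text \<open>The loop cannot stop early: later free colors overwrite earlier ones, so the smallest
  free color remains.\<close>

definition color_vertex :: cmd where
  "color_vertex = For rC rD (conflict ;; Ite (Var rBad) Skip (Sto aCol (Var rV) (Plus (Var rC) (Var rCol))))"

text \<open>Color 0 marks a vertex as not yet colored; it lies outside the palette, which starts at
  a positive \<open>rCol\<close>.\<close>

definition greedy :: cmd where
  "greedy = For rV rN (Ite (elt aLow rV) (Sto aCol (Var rV) (Num 0)) Skip) ;;
     For rV rN (Ite (elt aLow rV) color_vertex Skip)"

definition remove :: cmd where
  "remove = For rX rN (Ite (elt aCls rX) (Sto aRest (Var rX) (Num 0)) Skip) ;;
     Asg rF (Plus (Num 2) (Var rF))"

text \<open>The palettes are consecutive: colors up to \<open>rF + 1\<close> are in use already, the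
  next \<open>rD\<close> serve the greedy coloring, and two more serve the vertices of high degree.
  The closing check runs over all vertices and alone decides about success.\<close>

definition finish :: cmd where
  "finish = split ;; Asg rCol (Plus (Num 2) (Var rF)) ;; greedy ;;
     Asg rCol (Plus (Var rD) (Plus (Num 2) (Var rF))) ;; two_color ;;
     For rX rN (Sto aCls (Var rX) (Num 1)) ;; check ;; Asg rDone (Var rOk)"

definition attempt :: cmd where
  "attempt = decode ;; select ;; Asg rCol (Var rF) ;; two_color ;; check ;;
     Ite (Var rOk) (Ite (le_exp (Var rT) (Var rCnt)) remove finish) Skip"

text \<open>Bounded loops cannot run until success. Each pass over all tuples either finishes or
  shrinks the remaining set, so \<open>n + 1\<close> passes are enough.\<close>

definition main :: cmd where
  "main = Asg rF (Num 1) ;; Asg rDone (Num 0) ;; For rX rN (Sto aRest (Var rX) (Num 1)) ;;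
     For rPass rBase (For rJ rTuples (Ite (Var rDone) Skip attempt))"

lemma written_divide [simp]: "written divide = {rQuot, rZ, rJJ, rE}" "written_arrs divide = {}"
  by (auto simp: divide_def)

lemma written_mark [simp]: "written mark = {rW}" "written_arrs mark = {aNb}"
  by (auto simp: mark_def)

lemma written_decode [simp]:
  "written decode = {rQuot, rZ, rJJ, rE, rW, rI}" "written_arrs decode = {aNb}"
  by (auto simp: decode_def)

lemma written_check [simp]: "written check = {rOk, rU, rW}" "written_arrs check = {}"
  by (auto simp: check_def)

lemma written_select [simp]: "written select = {rCnt, rX}" "written_arrs select = {aCls}"
  by (auto simp: select_def)

lemma written_degree [simp]: "written degree = {rDeg, rW}" "written_arrs degree = {}"
  by (auto simp: degree_def)

lemma written_split [simp]: "written split = {rV, rDeg, rW}" "written_arrs split = {aOut, aLow, aCls}"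
  by (auto simp: split_def)

lemma written_conflict [simp]: "written conflict = {rBad, rW}" "written_arrs conflict = {}"
  by (auto simp: conflict_def)

lemma written_color_vertex [simp]:
  "written color_vertex = {rC, rBad, rW}" "written_arrs color_vertex = {aCol}"
  by (auto simp: color_vertex_def)

lemma written_greedy [simp]: "written greedy = {rV, rC, rBad, rW}" "written_arrs greedy = {aCol}"
  by (auto simp: greedy_def)

lemma written_remove [simp]: "written remove = {rX, rF}" "written_arrs remove = {aRest}"
  by (auto simp: remove_def)

lemma written_finish [simp]:
  "written finish = {rV, rDeg, rW, rC, rBad, rCol, rLu, rMu, rLw, rMw, rX, rU, rOk, rDone}"
  "written_arrs finish = {aOut, aLow, aCls, aCol, aLab, aNeg}"
  by (auto simp: finish_def)

section \<open>Correctness of the commands of one attempt\<close>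

context config
begin

text \<open>
  The digits of \<open>j\<close> to the base \<open>Suc n\<close> are the members of a set of at most \<open>k\<close> vertices; the digit \<open>n\<close>
  stands for no vertex.
\<close>

definition digit :: "nat \<Rightarrow> nat \<Rightarrow> nat" where
  "digit j p = j div Suc n ^ p mod Suc n"

lemma exists_digits:
  "(\<forall>p. D p < Suc n) \<Longrightarrow> \<exists>j<Suc n ^ m. \<forall>p<m. digit j p = D p"
proof (induction m arbitrary: D)
  case (Suc m)
  from Suc.IH[of "\<lambda>p. D (Suc p)"] Suc.prems obtain j
    where j: "j < Suc n ^ m" "\<forall>p<m. digit j p = D (Suc p)" by auto
  let ?j = "D 0 + Suc n * j"
  have "Suc n * Suc j \<le> Suc n * Suc n ^ m" using j(1) by (intro mult_le_mono2) simp
  then have "?j < Suc n ^ Suc m" using Suc.prems[rule_format, of 0] by simp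
  moreover have "digit ?j p = D p" if "p < Suc m" for p
  proof (cases p)
    case 0
    then show ?thesis using Suc.prems[rule_format, of 0] by (simp add: digit_def del: mult_Suc)
  next
    case (Suc p')
    have "?j div Suc n = j" using Suc.prems[rule_format, of 0] by (simp del: mult_Suc)
    then have "?j div Suc n ^ Suc p' = j div Suc n ^ p'" by (simp add: div_mult2_eq del: mult_Suc)
    then have "digit ?j p = digit j p'" using Suc by (simp add: digit_def)
    then show ?thesis using j Suc that by simp
  qed
  ultimately show ?case by blast
qed simp

definition chosen :: "nat \<Rightarrow> nat set" where
  "chosen j = {digit j p |p. p < k} \<inter> {..<n}"

text \<open>The lowest digits enumerate \<open>S\<close>, the others are padded with
  \<open>n\<close>.\<close>

lemma exists_chosen:
  assumes "S \<subseteq> {..<n}" "card S \<le> k"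
  shows "\<exists>j<Suc n ^ k. chosen j = S"
proof -
  have "finite S" using assms finite_subset by blast
  then obtain h where h: "bij_betw h {..<card S} S" using ex_bij_betw_nat_finite
    by (metis atLeast0LessThan)
  let ?D = "\<lambda>p. if p < card S then h p else n"
  have hS: "h p \<in> S" if "p < card S" for p using h that by (auto simp: bij_betw_def)
  then have "\<forall>p. ?D p < Suc n" using assms(1) less_SucI by fastforce
  then obtain j where j: "j < Suc n ^ k" "\<forall>p<k. digit j p = ?D p" using exists_digits[of ?D k] by blast
  have "chosen j = S"
  proof
    show "chosen j \<subseteq> S" using j(2) hS by (auto simp: chosen_def split: if_splits)
    show "S \<subseteq> chosen j"
    proof
      fix x assume x: "x \<in> S"
      then have "x \<in> h ` {..<card S}" using h by (simp add: bij_betw_def)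
      then obtain p where "p < card S" "h p = x" by auto
      then show "x \<in> chosen j" using j(2) x assms by (auto simp: chosen_def intro!: exI[of _ p])
    qed
  qed
  then show ?thesis using j by blast
qed

definition on :: "nat \<Rightarrow> state \<Rightarrow> nat set" where
  "on a s = {x. x < n \<and> 0 < arr s a x}"

lemma finite_on [simp]: "finite (on a s)"
  by (simp add: on_def)

lemma on_set_reg [simp]: "on a (set_reg x v s) = on a s"
  by (simp add: on_def)

lemma on_sem: "a \<notin> written_arrs c \<Longrightarrow> on a (sem c s) = on a s"
  by (simp add: on_def sem_arr)

lemma cls_on: "cls s x \<longleftrightarrow> x \<in> on aCls s"
  by (simp add: on_def cls_def)

definition nbs :: "nat set \<Rightarrow> nat set" where
  "nbs S = {w. w < n \<and> (\<exists>x\<in>S. adj x w)}"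

lemma sem_divide:
  assumes s: "cfg s" "reg s rJJ < Suc n ^ k"
  shows "reg (sem divide s) rE = reg s rJJ mod Suc n" "reg (sem divide s) rJJ = reg s rJJ div Suc n"
proof -
  let ?j = "reg s rJJ"
  let ?loop = "For rZ rTuples (Ite (le_exp (Var rBase) (Var rJJ))
       (Asg rJJ (Minus (Var rJJ) (Var rBase)) ;; Asg rQuot (Plus (Var rQuot) (Num 1))) Skip)"
  let ?s = "set_reg rQuot 0 s"
  \<comment> \<open>The second disjunct counts rounds: while \<open>rJJ\<close> is still at least
    the base, every round raises the quotient. At \<open>i = 0\<close> it would make the quotient
    larger than the dividend.\<close>
  let ?I = "\<lambda>i t. reg t rJJ + reg t rQuot * Suc n = ?j \<and> (reg t rJJ < Suc n \<or> Suc n ^ k \<le> reg t rQuot + i)"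
  have I0: "?I 0 (sem ?loop ?s)"
  proof (rule For_inv[of ?I])
    fix i t assume t: "same_but (insert rZ (written (Ite (le_exp (Var rBase) (Var rJJ))
       (Asg rJJ (Minus (Var rJJ) (Var rBase)) ;; Asg rQuot (Plus (Var rQuot) (Num 1))) Skip)))
       (written_arrs (Ite (le_exp (Var rBase) (Var rJJ))
       (Asg rJJ (Minus (Var rJJ) (Var rBase)) ;; Asg rQuot (Plus (Var rQuot) (Num 1))) Skip)) ?s t"
      "?I (Suc i) t"
    have "reg t rBase = Suc n" using t(1) s by (simp add: same_but_def cfg_reg)
    then show "?I i (sem (Ite (le_exp (Var rBase) (Var rJJ))
       (Asg rJJ (Minus (Var rJJ) (Var rBase)) ;; Asg rQuot (Plus (Var rQuot) (Num 1))) Skip) (set_reg rZ i t))"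
      using t(2) by (auto simp: algebra_simps)
  qed (use s in \<open>simp add: cfg_reg\<close>)
  have "\<not> Suc n ^ k \<le> reg (sem ?loop ?s) rQuot"
  proof
    assume "Suc n ^ k \<le> reg (sem ?loop ?s) rQuot"
    also have "\<dots> \<le> reg (sem ?loop ?s) rJJ + reg (sem ?loop ?s) rQuot * Suc n" by simp
    also have "\<dots> = ?j" using I0 by blast
    finally show False using s(2) by simp
  qed
  with I0 have I: "reg (sem ?loop ?s) rJJ + reg (sem ?loop ?s) rQuot * Suc n = ?j"
    "reg (sem ?loop ?s) rJJ < Suc n" by auto
  have "?j mod Suc n = reg (sem ?loop ?s) rJJ" "?j div Suc n = reg (sem ?loop ?s) rQuot"
    unfolding I(1)[symmetric] using I(2) by (simp_all del: mult_Suc_right)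
  then show "reg (sem divide s) rE = ?j mod Suc n" "reg (sem divide s) rJJ = ?j div Suc n"
    by (simp_all add: divide_def)
qed

lemma sem_mark:
  assumes s: "cfg s" "reg s rE < n"
  shows "on aNb (sem mark s) = on aNb s \<union> nbs {reg s rE}"
proof -
  let ?I = "\<lambda>i t. \<forall>w<n. 0 < arr t aNb w \<longleftrightarrow> 0 < arr s aNb w \<or> i \<le> w \<and> adj (reg s rE) w"
  have "?I 0 (sem mark s)"
    unfolding mark_def
  proof (rule For_inv[of ?I])
    fix i t
    assume i: "i < reg s rN" and
      t: "same_but (insert rW (written (Ite (adj_exp rE rW) (Sto aNb (Var rW) (Num 1)) Skip)))
        (written_arrs (Ite (adj_exp rE rW) (Sto aNb (Var rW) (Num 1)) Skip)) s t" "?I (Suc i) t"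
    have "cfg t" using cfg_same_but[OF t(1) _ _ s(1)] by simp
    moreover have "reg t rE = reg s rE" using t(1) by (simp add: same_but_def)
    moreover have "i < n" using i s by (simp add: cfg_reg)
    ultimately show "?I i (sem (Ite (adj_exp rE rW) (Sto aNb (Var rW) (Num 1)) Skip) (set_reg rW i t))"
      using t(2) s(2) by (auto simp: less_Suc_eq not_le Suc_le_eq le_eq_less_or_eq)
  qed (use s in \<open>auto simp: cfg_reg\<close>)
  then show ?thesis by (auto simp: on_def nbs_def)
qed

lemma sem_decode:
  assumes s: "cfg s" "reg s rJ < Suc n ^ k"
  shows "on aNb (sem decode s) = nbs (chosen (reg s rJ))"
proof -
  let ?j = "reg s rJ"
  let ?clear = "For rW rN (Sto aNb (Var rW) (Num 0))"
  let ?s = "set_reg rJJ ?j s"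
  let ?C = "\<lambda>i t. \<forall>x<n. i \<le> x \<longrightarrow> arr t aNb x = 0"
  have "?C 0 (sem ?clear ?s)"
    by (rule For_inv[of ?C]) (use s in \<open>auto simp: cfg_reg\<close>)
  then have clear: "on aNb (sem ?clear ?s) = {}" by (auto simp: on_def)
  let ?s1 = "sem ?clear ?s"
  have s1: "cfg ?s1" "reg ?s1 rJJ = ?j"
    using cfg_sem[of ?s ?clear] s by (simp_all add: sem_reg)
  let ?body = "divide ;; Ite (lt_exp (Var rE) (Var rN)) mark Skip"
  \<comment> \<open>The counter runs down from \<open>k\<close>, so the digits consumed so far are
    those at positions below \<open>k - i\<close>, lowest first.\<close>
  let ?I = "\<lambda>i t. reg t rJJ = ?j div Suc n ^ (k - i) \<and> on aNb t = nbs ({digit ?j p |p. p < k - i} \<inter> {..<n})"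
  have "?I 0 (sem (For rI rK ?body) ?s1)"
  proof (rule For_inv[of ?I])
    fix i t
    assume i: "i < reg ?s1 rK" and
      t: "same_but (insert rI (written ?body)) (written_arrs ?body) ?s1 t" "?I (Suc i) t"
    let ?t = "set_reg rI i t" and ?p = "k - Suc i"
    let ?e = "digit ?j ?p"
    have c: "cfg ?t" using cfg_same_but[OF t(1) _ _ s1(1)] by simp
    have i: "i < k" using i s1 by (simp add: cfg_reg)
    then have p: "k - i = Suc ?p" by simp
    have jj: "reg ?t rJJ = ?j div Suc n ^ ?p" using t(2) by simp
    have "reg ?t rJJ < Suc n ^ k" using jj s(2) by (metis div_le_dividend le_less_trans)
    note d = sem_divide[OF c this]
    have e: "reg (sem divide ?t) rE = ?e" using d(1) jj by (simp add: digit_def)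
    have c': "cfg (sem divide ?t)" using cfg_sem[OF c, of divide] by simp
    have "reg (sem ?body ?t) rJJ = reg (sem divide ?t) rJJ" by (simp add: sem_reg)
    also have "\<dots> = ?j div Suc n ^ ?p div Suc n" using d(2) jj by simp
    also have "\<dots> = ?j div Suc n ^ (k - i)"
      unfolding p by (simp only: div_mult2_eq power_Suc2)
    finally have 1: "reg (sem ?body ?t) rJJ = ?j div Suc n ^ (k - i)" .
    have nb: "on aNb (sem divide ?t) = nbs ({digit ?j p |p. p < ?p} \<inter> {..<n})"
      using t(2) by (simp add: on_sem)
    have D: "{digit ?j p |p. p < k - i} = insert ?e {digit ?j p |p. p < ?p}"
      unfolding p by (auto simp: less_Suc_eq)
    have "on aNb (sem ?body ?t) = nbs ({digit ?j p |p. p < k - i} \<inter> {..<n})"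
    proof (cases "?e < n")
      case True
      then have "on aNb (sem ?body ?t) = on aNb (sem mark (sem divide ?t))"
        using c' e by (simp add: cfg_reg)
      also have "\<dots> = on aNb (sem divide ?t) \<union> nbs {?e}" using sem_mark[OF c'] e True by simp
      finally show ?thesis using nb D True by (auto simp: nbs_def)
    next
      case False
      then have "on aNb (sem ?body ?t) = on aNb (sem divide ?t)" using c' e by (simp add: cfg_reg)
      then show ?thesis using nb D False by (auto simp: nbs_def)
    qed
    with 1 show "?I i (sem ?body ?t)" by blast
  qed (use s1 clear in \<open>auto simp: cfg_reg nbs_def\<close>)
  then show ?thesis by (simp add: decode_def chosen_def)
qed

definition fine :: "state \<Rightarrow> nat set \<Rightarrow> bool" where
  "fine s A \<longleftrightarrow> (\<forall>u\<in>A. 1 \<le> arr s aCol u \<and> arr s aCol u \<le> q) \<and>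
     (\<forall>u\<in>A. \<forall>w\<in>A. adj u w \<longrightarrow> arr s aCol u \<noteq> arr s aCol w)"

lemma sem_check:
  assumes s: "cfg s"
  shows "0 < reg (sem check s) rOk \<longleftrightarrow> fine s (on aCls s)"
proof -
  let ?A = "on aCls s" and ?c = "arr s aCol"
  let ?test = "Ite (and_exp (elt aCls rW) (and_exp (adj_exp rU rW) (eq_exp (elt aCol rU) (elt aCol rW))))
        (Asg rOk (Num 0)) Skip"
  let ?inner = "For rW rN ?test"
  let ?body = "Ite (elt aCls rU)
     (Ite (and_exp (elt aCol rU) (le_exp (elt aCol rU) (Var rQ))) Skip (Asg rOk (Num 0)) ;; ?inner) Skip"
  let ?P = "\<lambda>u w. u \<in> ?A \<longrightarrow> 1 \<le> ?c u \<and> ?c u \<le> q \<and> (w \<in> ?A \<longrightarrow> adj u w \<longrightarrow> ?c u \<noteq> ?c w)"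
  have inner: "0 < reg (sem ?inner t) rOk \<longleftrightarrow> 0 < reg t rOk \<and> (\<forall>w\<in>?A. adj u w \<longrightarrow> ?c u \<noteq> ?c w)"
    if t: "cfg t" "arr t aCls = arr s aCls" "arr t aCol = ?c" "reg t rU = u" "u < n" for t u
  proof -
    let ?I = "\<lambda>i v. 0 < reg v rOk \<longleftrightarrow> 0 < reg t rOk \<and> (\<forall>w\<in>?A. i \<le> w \<longrightarrow> adj u w \<longrightarrow> ?c u \<noteq> ?c w)"
    have "?I 0 (sem ?inner t)"
    proof (rule For_inv[of ?I])
      fix i v
      assume i: "i < reg t rN" and
        v: "same_but (insert rW (written ?test)) (written_arrs ?test) t v" "?I (Suc i) v"
      have "cfg v" using cfg_same_but[OF v(1) _ _ t(1)] by simp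
      moreover have "arr v aCls = arr s aCls" "arr v aCol = ?c" "reg v rU = u"
        using v(1) t by (simp_all add: same_but_def)
      moreover have "i < n" using i t by (simp add: cfg_reg)
      moreover have "i \<in> ?A \<longleftrightarrow> 0 < arr s aCls i" using \<open>i < n\<close> by (simp add: on_def)
      ultimately show "?I i (sem ?test (set_reg rW i v))"
        using v(2) t(5) by (auto simp: Suc_le_eq le_eq_less_or_eq)
    qed (use t in \<open>auto simp: cfg_reg on_def\<close>)
    then show ?thesis by simp
  qed
  let ?s = "set_reg rOk 1 s"
  let ?I = "\<lambda>i t. 0 < reg t rOk \<longleftrightarrow> (\<forall>u\<in>?A. i \<le> u \<longrightarrow> 1 \<le> ?c u \<and> ?c u \<le> q \<and> (\<forall>w\<in>?A. adj u w \<longrightarrow> ?c u \<noteq> ?c w))"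
  have "?I 0 (sem (For rU rN ?body) ?s)"
  proof (rule For_inv[of ?I])
    fix i t
    assume i: "i < reg ?s rN" and
      t: "same_but (insert rU (written ?body)) (written_arrs ?body) ?s t" "?I (Suc i) t"
    let ?t = "set_reg rU i t"
    let ?t' = "if 0 < ?c i \<and> ?c i \<le> q then ?t else set_reg rOk 0 ?t"
    have c: "cfg ?t" using cfg_same_but[OF t(1)] s by simp
    have f: "arr ?t aCls = arr s aCls" "arr ?t aCol = ?c" using t(1) by (simp_all add: same_but_def)
    have i: "i < n" using i s by (simp add: cfg_reg)
    show "?I i (sem ?body ?t)"
    proof (cases "i \<in> ?A")
      case False
      then have "sem ?body ?t = ?t" using f i by (simp add: on_def)
      moreover have "i \<le> u \<longleftrightarrow> Suc i \<le> u" if "u \<in> ?A" for u using that False by (auto simp: le_eq_less_or_eq)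
      ultimately show ?thesis using t(2) by auto
    next
      case True
      then have "sem ?body ?t = sem ?inner ?t'" using f i c by (simp add: on_def cfg_reg)
      moreover have "0 < reg (sem ?inner ?t') rOk \<longleftrightarrow> 0 < reg ?t' rOk \<and> (\<forall>w\<in>?A. adj i w \<longrightarrow> ?c i \<noteq> ?c w)"
        by (rule inner) (use c f i in auto)
      moreover have "0 < reg ?t' rOk \<longleftrightarrow> 0 < reg t rOk \<and> 1 \<le> ?c i \<and> ?c i \<le> q" by auto
      moreover have "(\<forall>u\<in>?A. i \<le> u \<longrightarrow> Q u) \<longleftrightarrow> (\<forall>u\<in>?A. Suc i \<le> u \<longrightarrow> Q u) \<and> Q i" for Q
        using True by (auto simp: Suc_le_eq le_eq_less_or_eq)
      ultimately show ?thesis using t(2) by simp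
    qed
  qed (use s in \<open>auto simp: cfg_reg on_def\<close>)
  then show ?thesis by (auto simp: check_def fine_def)
qed

text \<open>This lemma and the next two peel off the current index, which turns an invariant for
  \<open>Suc i\<close> into one for \<open>i\<close>.\<close>

lemma all_from: "(\<forall>x<n. i \<le> x \<longrightarrow> P x) \<longleftrightarrow> (i < n \<longrightarrow> P i) \<and> (\<forall>x<n. Suc i \<le> x \<longrightarrow> P x)"
  by (auto simp: Suc_le_eq le_eq_less_or_eq)

lemma ex_from: "(\<exists>x\<in>A. i \<le> x \<and> P x) \<longleftrightarrow> i \<in> A \<and> P i \<or> (\<exists>x\<in>A. Suc i \<le> x \<and> P x)"
  for i :: nat
proof -
  have "i \<le> x \<longleftrightarrow> x = i \<or> Suc i \<le> x" for x by auto
  then show ?thesis by metis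
qed

lemma card_from: "i < n \<Longrightarrow> card {x. i \<le> x \<and> x < n \<and> P x} =
    (if P i then 1 else 0) + card {x. Suc i \<le> x \<and> x < n \<and> P x}"
proof -
  assume i: "i < n"
  have "{x. i \<le> x \<and> x < n \<and> P x} = (if P i then insert i else id) {x. Suc i \<le> x \<and> x < n \<and> P x}"
    using i by (auto simp: le_eq_less_or_eq)
  then show ?thesis by simp
qed

lemma sem_select:
  assumes s: "cfg s"
  shows "on aCls (sem select s) = on aRest s \<inter> on aNb s"
    and "reg (sem select s) rCnt = card (on aRest s \<inter> on aNb s)"
proof -
  let ?P = "\<lambda>x. 0 < arr s aRest x \<and> 0 < arr s aNb x"
  let ?s = "set_reg rCnt 0 s"
  let ?body = "Ite (and_exp (elt aRest rX) (elt aNb rX))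
     (Sto aCls (Var rX) (Num 1) ;; Asg rCnt (Plus (Num 1) (Var rCnt))) (Sto aCls (Var rX) (Num 0))"
  let ?I = "\<lambda>i t. (\<forall>x<n. i \<le> x \<longrightarrow> (0 < arr t aCls x \<longleftrightarrow> ?P x)) \<and>
     reg t rCnt = card {x. i \<le> x \<and> x < n \<and> ?P x}"
  have "?I 0 (sem (For rX rN ?body) ?s)"
  proof (rule For_inv[of ?I])
    fix i t
    assume i: "i < reg ?s rN" and
      t: "same_but (insert rX (written ?body)) (written_arrs ?body) ?s t" "?I (Suc i) t"
    have "arr t aRest = arr s aRest" "arr t aNb = arr s aNb" using t(1) by (simp_all add: same_but_def)
    moreover have "i < n" using i s by (simp add: cfg_reg)
    ultimately show "?I i (sem ?body (set_reg rX i t))"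
      using t(2) by (simp add: card_from all_from[of i])
  qed (use s in \<open>auto simp: cfg_reg\<close>)
  moreover have "on aRest s \<inter> on aNb s = {x. 0 \<le> x \<and> x < n \<and> ?P x}" by (auto simp: on_def)
  ultimately show "on aCls (sem select s) = on aRest s \<inter> on aNb s"
    "reg (sem select s) rCnt = card (on aRest s \<inter> on aNb s)"
    by (auto simp: select_def on_def)
qed

definition deg_in :: "nat set \<Rightarrow> nat \<Rightarrow> nat" where
  "deg_in A v = card {w\<in>A. adj v w}"

lemma sem_degree:
  assumes s: "cfg s" "reg s rV < n"
  shows "reg (sem degree s) rDeg = deg_in (on aOut s) (reg s rV)"
proof -
  let ?P = "\<lambda>w. 0 < arr s aOut w \<and> adj (reg s rV) w"
  let ?s = "set_reg rDeg 0 s"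
  let ?body = "Ite (and_exp (elt aOut rW) (adj_exp rV rW)) (Asg rDeg (Plus (Num 1) (Var rDeg))) Skip"
  let ?I = "\<lambda>i t. reg t rDeg = card {x. i \<le> x \<and> x < n \<and> ?P x}"
  have "?I 0 (sem (For rW rN ?body) ?s)"
  proof (rule For_inv[of ?I])
    fix i t
    assume i: "i < reg ?s rN" and
      t: "same_but (insert rW (written ?body)) (written_arrs ?body) ?s t" "?I (Suc i) t"
    have "arr t aOut = arr s aOut" "reg t rV = reg s rV" using t(1) by (simp_all add: same_but_def)
    moreover have "i < n" using i s by (simp add: cfg_reg)
    moreover have "cfg t" using cfg_same_but[OF t(1)] s by simp
    ultimately show "?I i (sem ?body (set_reg rW i t))"
      using t(2) s by (auto simp: card_from)
  qed (use s in \<open>auto simp: cfg_reg\<close>)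
  moreover have "{w \<in> on aOut s. adj (reg s rV) w} = {x. 0 \<le> x \<and> x < n \<and> ?P x}" by (auto simp: on_def)
  ultimately show ?thesis by (simp add: degree_def deg_in_def)
qed

lemma sem_split:
  assumes s: "cfg s"
  defines "B \<equiv> on aRest s - on aNb s"
  shows "on aLow (sem split s) = {v\<in>B. deg_in B v < d}"
    and "on aCls (sem split s) = {v\<in>B. d \<le> deg_in B v}"
proof -
  let ?out = "For rV rN (Ite (and_exp (elt aRest rV) (not_exp (elt aNb rV)))
       (Sto aOut (Var rV) (Num 1)) (Sto aOut (Var rV) (Num 0)))"
  let ?I = "\<lambda>i t. \<forall>x<n. i \<le> x \<longrightarrow> (0 < arr t aOut x \<longleftrightarrow> 0 < arr s aRest x \<and> arr s aNb x = 0)"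
  have "?I 0 (sem ?out s)"
    by (rule For_inv[of ?I]) (use s in \<open>auto simp: cfg_reg same_but_def less_Suc_eq not_le Suc_le_eq le_eq_less_or_eq\<close>)
  then have B: "on aOut (sem ?out s) = B" by (auto simp: on_def B_def)
  let ?s = "sem ?out s"
  have c: "cfg ?s" using cfg_sem[OF s, of ?out] by simp
  let ?body = "degree ;; Ite (and_exp (elt aOut rV) (lt_exp (Var rDeg) (Var rD)))
       (Sto aLow (Var rV) (Num 1) ;; Sto aCls (Var rV) (Num 0))
       (Sto aLow (Var rV) (Num 0) ;; Sto aCls (Var rV) (elt aOut rV))"
  let ?J = "\<lambda>i t. \<forall>x<n. i \<le> x \<longrightarrow> (0 < arr t aLow x \<longleftrightarrow> x \<in> B \<and> deg_in B x < d) \<and>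
    (0 < arr t aCls x \<longleftrightarrow> x \<in> B \<and> \<not> deg_in B x < d)"
  have "?J 0 (sem (For rV rN ?body) ?s)"
  proof (rule For_inv[of ?J])
    fix i t
    assume i: "i < reg ?s rN" and
      t: "same_but (insert rV (written ?body)) (written_arrs ?body) ?s t" "?J (Suc i) t"
    let ?t = "set_reg rV i t"
    have i: "i < n" using i c by (simp add: cfg_reg)
    have c1: "cfg ?t" using cfg_same_but[OF t(1)] c by simp
    have o: "arr t aOut = arr ?s aOut" using t(1) by (simp add: same_but_def)
    then have o': "on aOut ?t = B" using B by (simp add: on_def)
    have iB: "i \<in> B \<longleftrightarrow> 0 < arr t aOut i" using o' i by (auto simp: on_def)
    have dg: "reg (sem degree ?t) rDeg = deg_in B i" using sem_degree[OF c1] i o' by simp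
    have fr: "reg (sem degree ?t) rV = i" "reg (sem degree ?t) rD = d"
      "arr (sem degree ?t) = arr t"
      using c1 by (auto simp: sem_reg sem_arr cfg_reg)
    have "arr (sem ?body ?t) aLow = (arr t aLow)(i := if i \<in> B \<and> deg_in B i < d then 1 else 0)"
      "arr (sem ?body ?t) aCls = (arr t aCls)(i := if i \<in> B \<and> deg_in B i < d then 0 else arr t aOut i)"
      using dg fr iB by simp_all
    then show "?J i (sem ?body ?t)" using t(2) iB by (simp add: all_from[of i])
  qed (use c in \<open>auto simp: cfg_reg\<close>)
  moreover have "B \<subseteq> {..<n}" by (auto simp: B_def on_def)
  ultimately show "on aLow (sem split s) = {v\<in>B. deg_in B v < d}"
    "on aCls (sem split s) = {v\<in>B. d \<le> deg_in B v}"
    by (auto simp: split_def on_def)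
qed

definition free :: "state \<Rightarrow> nat \<Rightarrow> nat \<Rightarrow> bool" where
  "free s v c \<longleftrightarrow> (\<forall>w\<in>on aLow s. adj v w \<longrightarrow> arr s aCol w \<noteq> c)"

lemma sem_conflict:
  assumes s: "cfg s" "reg s rV < n"
  shows "0 < reg (sem conflict s) rBad \<longleftrightarrow> \<not> free s (reg s rV) (reg s rC + reg s rCol)"
proof -
  let ?s = "set_reg rBad 0 s" and ?c = "reg s rC + reg s rCol"
  let ?body = "Ite (and_exp (elt aLow rW) (and_exp (adj_exp rV rW)
         (eq_exp (elt aCol rW) (Plus (Var rC) (Var rCol))))) (Asg rBad (Num 1)) Skip"
  let ?I = "\<lambda>i t. 0 < reg t rBad \<longleftrightarrow> (\<exists>w\<in>on aLow s. i \<le> w \<and> adj (reg s rV) w \<and> arr s aCol w = ?c)"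
  have "?I 0 (sem (For rW rN ?body) ?s)"
  proof (rule For_inv[of ?I])
    fix i t
    assume i: "i < reg ?s rN" and
      t: "same_but (insert rW (written ?body)) (written_arrs ?body) ?s t" "?I (Suc i) t"
    have "arr t aLow = arr s aLow" "arr t aCol = arr s aCol" "reg t rV = reg s rV"
      "reg t rC = reg s rC" "reg t rCol = reg s rCol"
      using t(1) by (simp_all add: same_but_def)
    moreover have "i < n" using i s by (simp add: cfg_reg)
    moreover have "i \<in> on aLow s \<longleftrightarrow> 0 < arr s aLow i" using \<open>i < n\<close> by (simp add: on_def)
    moreover have "cfg t" using cfg_same_but[OF t(1)] s by simp
    ultimately have eq: "reg (sem ?body (set_reg rW i t)) rBad =
        (if i \<in> on aLow s \<and> adj (reg s rV) i \<and> arr s aCol i = ?c then 1 else reg t rBad)"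
      using s by simp
    show "?I i (sem ?body (set_reg rW i t))"
      unfolding ex_from[of _ i] eq using t(2) by auto
  qed (use s in \<open>auto simp: cfg_reg on_def\<close>)
  then show ?thesis by (auto simp: conflict_def free_def)
qed

lemma sem_color_vertex:
  assumes s: "cfg s" "reg s rV < n" and ex: "\<exists>c<d. free s (reg s rV) (c + reg s rCol)"
  shows "\<exists>c<d. free s (reg s rV) (c + reg s rCol) \<and>
     arr (sem color_vertex s) aCol = (arr s aCol)(reg s rV := c + reg s rCol)"
proof -
  let ?v = "reg s rV" and ?b = "reg s rCol"
  let ?body = "conflict ;; Ite (Var rBad) Skip (Sto aCol (Var rV) (Plus (Var rC) (Var rCol)))"
  let ?set = "\<lambda>t. \<exists>c<d. free s ?v (c + ?b) \<and> arr t aCol = (arr s aCol)(?v := c + ?b)"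
  let ?I = "\<lambda>i t. ?set t \<or> arr t aCol = arr s aCol \<and> (\<forall>c<d. i \<le> c \<longrightarrow> \<not> free s ?v (c + ?b))"
  have "?I 0 (sem (For rC rD ?body) s)"
  proof (rule For_inv[of ?I])
    fix i t
    assume i: "i < reg s rD" and
      t: "same_but (insert rC (written ?body)) (written_arrs ?body) s t" "?I (Suc i) t"
    let ?t = "set_reg rC i t"
    have c: "cfg ?t" using cfg_same_but[OF t(1)] s by simp
    have f: "reg t rV = ?v" "reg t rCol = ?b" "arr t aLow = arr s aLow" using t(1) by (simp_all add: same_but_def)
    have i: "i < d" using i s by (simp add: cfg_reg)
    \<comment> \<open>The rounds recolor only the vertex itself, which is not its own neighbor, so
      freeness still means the same as on entry.\<close>
    have "arr t aCol w = arr s aCol w" if "w \<noteq> ?v" for w using t(2) that by auto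
    then have "adj ?v w \<longrightarrow> arr ?t aCol w = arr s aCol w" for w by (cases "w = ?v") simp_all
    moreover have "on aLow ?t = on aLow s" using f by (simp add: on_def)
    ultimately have "free ?t ?v (i + ?b) \<longleftrightarrow> free s ?v (i + ?b)" by (simp add: free_def)
    moreover have "0 < reg (sem conflict ?t) rBad \<longleftrightarrow> \<not> free ?t ?v (i + ?b)"
      using sem_conflict[OF c] f s by simp
    moreover have "reg (sem conflict ?t) rV = ?v" "reg (sem conflict ?t) rCol = ?b"
      "reg (sem conflict ?t) rC = i" "arr (sem conflict ?t) = arr t"
      using f by (auto simp: sem_reg sem_arr)
    ultimately have eq: "arr (sem ?body ?t) aCol =
        (if free s ?v (i + ?b) then (arr t aCol)(?v := i + ?b) else arr t aCol)"
      by simp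
    show "?I i (sem ?body ?t)"
    proof (cases "free s ?v (i + ?b)")
      case True
      have "(arr t aCol)(?v := i + ?b) = (arr s aCol)(?v := i + ?b)" using t(2) by auto
      then have "?set (sem ?body ?t)" using True eq i by auto
      then show ?thesis ..
    next
      case False
      then have "\<forall>c<d. i \<le> c \<longrightarrow> \<not> free s ?v (c + ?b)" if "\<forall>c<d. Suc i \<le> c \<longrightarrow> \<not> free s ?v (c + ?b)"
        using that by (auto simp: Suc_le_eq le_eq_less_or_eq)
      then show ?thesis using t(2) False eq by auto
    qed
  qed (use s in \<open>auto simp: cfg_reg\<close>)
  then show ?thesis using ex by (auto simp: color_vertex_def)
qed

end

section \<open>Greedy coloring and completion of a coloring\<close>

context config
begin

lemma deg_in_mono: "A \<subseteq> B \<Longrightarrow> finite B \<Longrightarrow> deg_in A v \<le> deg_in B v"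
  unfolding deg_in_def by (intro card_mono) auto

text \<open>Pigeonhole: fewer than \<open>d\<close> low neighbors cannot block all \<open>d\<close>
  colors from \<open>b\<close> on, whatever colors they carry.\<close>

lemma exists_free:
  assumes "deg_in (on aLow s) v < d"
  shows "\<exists>c<d. free s v (c + b)"
proof (rule ccontr)
  assume none: "\<not> ?thesis"
  let ?W = "{w\<in>on aLow s. adj v w}"
  have "(\<lambda>c. c + b) ` {..<d} \<subseteq> arr s aCol ` ?W"
  proof
    fix x assume "x \<in> (\<lambda>c. c + b) ` {..<d}"
    then obtain c where c: "c < d" "x = c + b" by auto
    then have "\<not> free s v (c + b)" using none by blast
    then obtain w where "w \<in> ?W" "arr s aCol w = x" using c by (auto simp: free_def)
    then show "x \<in> arr s aCol ` ?W" by blast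
  qed
  then have "card ((\<lambda>c. c + b) ` {..<d}) \<le> card (arr s aCol ` ?W)" by (intro card_mono) auto
  also have "\<dots> \<le> card ?W" by (rule card_image_le) simp
  also have "card ((\<lambda>c. c + b) ` {..<d}) = d" by (subst card_image) (auto simp: inj_on_def)
  finally show False using assms by (simp add: deg_in_def)
qed

text \<open>The degree bound refers to all low vertices and not just to those colored so far, so a
  free color exists in whichever order the vertices are visited.\<close>

lemma sem_greedy:
  assumes s: "cfg s" "1 \<le> reg s rCol" and deg: "\<forall>v\<in>on aLow s. deg_in (on aLow s) v < d"
  defines "b \<equiv> reg s rCol" and "L \<equiv> on aLow s"
  shows "v \<notin> L \<Longrightarrow> arr (sem greedy s) aCol v = arr s aCol v"
    and "v \<in> L \<Longrightarrow> b \<le> arr (sem greedy s) aCol v \<and> arr (sem greedy s) aCol v < b + d"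
    and "v \<in> L \<Longrightarrow> w \<in> L \<Longrightarrow> adj v w \<Longrightarrow> arr (sem greedy s) aCol v \<noteq> arr (sem greedy s) aCol w"
proof -
  let ?clear = "For rV rN (Ite (elt aLow rV) (Sto aCol (Var rV) (Num 0)) Skip)"
  let ?C = "\<lambda>i t. \<forall>x. arr t aCol x = (if i \<le> x \<and> x \<in> L then 0 else arr s aCol x)"
  have clear: "?C 0 (sem ?clear s)"
  proof (rule For_inv[of ?C])
    fix i t
    assume i: "i < reg s rN" and
      t: "same_but (insert rV (written (Ite (elt aLow rV) (Sto aCol (Var rV) (Num 0)) Skip)))
        (written_arrs (Ite (elt aLow rV) (Sto aCol (Var rV) (Num 0)) Skip)) s t" "?C (Suc i) t"
    have "arr t aLow = arr s aLow" using t(1) by (simp add: same_but_def)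
    moreover have "i < n" using i s by (simp add: cfg_reg)
    ultimately have "0 < arr t aLow i \<longleftrightarrow> i \<in> L" by (simp add: L_def on_def)
    then show "?C i (sem (Ite (elt aLow rV) (Sto aCol (Var rV) (Num 0)) Skip) (set_reg rV i t))"
      using t(2) by (auto simp: le_eq_less_or_eq)
  qed (use s in \<open>auto simp: cfg_reg L_def on_def\<close>)
  let ?s = "sem ?clear s"
  have s1: "cfg ?s" "reg ?s rCol = b" "on aLow ?s = L"
    using cfg_sem[OF s(1), of ?clear] by (simp_all add: sem_reg on_sem b_def L_def)
  let ?body = "Ite (elt aLow rV) color_vertex Skip"
  let ?J = "\<lambda>i t. (\<forall>v. v \<notin> L \<longrightarrow> arr t aCol v = arr s aCol v) \<and> (\<forall>v\<in>L. v < i \<longrightarrow> arr t aCol v = 0) \<and>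
     (\<forall>v\<in>L. i \<le> v \<longrightarrow> b \<le> arr t aCol v \<and> arr t aCol v < b + d) \<and>
     (\<forall>v\<in>L. \<forall>w\<in>L. i \<le> v \<longrightarrow> i \<le> w \<longrightarrow> adj v w \<longrightarrow> arr t aCol v \<noteq> arr t aCol w)"
  have "?J 0 (sem (For rV rN ?body) ?s)"
  proof (rule For_inv[of ?J])
    fix i t
    assume i: "i < reg ?s rN" and
      t: "same_but (insert rV (written ?body)) (written_arrs ?body) ?s t" "?J (Suc i) t"
    let ?t = "set_reg rV i t"
    have c: "cfg ?t" using cfg_same_but[OF t(1)] s1 by simp
    have i: "i < n" using i s1 by (simp add: cfg_reg)
    have "arr t aLow = arr ?s aLow" "reg t rCol = b"
      using t(1) s1(2) by (simp_all add: same_but_def)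
    then have L: "on aLow ?t = L" "reg t rCol = b" "0 < arr t aLow i \<longleftrightarrow> i \<in> L"
      using s1(3) i by (auto simp: on_def)
    show "?J i (sem ?body ?t)"
    proof (cases "i \<in> L")
      case False
      then have eq: "sem ?body ?t = ?t" using L by simp
      have "i \<le> v \<longleftrightarrow> Suc i \<le> v" if "v \<in> L" for v using that False by (auto simp: le_eq_less_or_eq)
      then show ?thesis unfolding eq using t(2) by auto
    next
      case True
      have "deg_in (on aLow ?t) i < d" using deg True L(1) L_def by simp
      from sem_color_vertex[OF c, simplified, OF i, unfolded L(2), OF exists_free[OF this, of b]]
      obtain x where x: "x < d" "free ?t i (x + b)"
        "arr (sem color_vertex ?t) aCol = (arr t aCol)(i := x + b)" by auto
      have eq: "arr (sem ?body ?t) aCol = (arr t aCol)(i := x + b)" using True L x(3) by simp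
      have fr: "arr t aCol w \<noteq> x + b" if "w \<in> L" "adj i w" for w
        using x(2) that L(1) by (auto simp: free_def)
      have 1: "arr (sem ?body ?t) aCol v = arr s aCol v" if "v \<notin> L" for v
        using that True t(2) eq by auto
      have 2: "arr (sem ?body ?t) aCol v = 0" if "v \<in> L" "v < i" for v
        using that t(2) eq by auto
      have 3: "b \<le> arr (sem ?body ?t) aCol v \<and> arr (sem ?body ?t) aCol v < b + d" if "v \<in> L" "i \<le> v" for v
        using that t(2) eq x(1) by (cases "v = i") auto
      have 4: "arr (sem ?body ?t) aCol v \<noteq> arr (sem ?body ?t) aCol w"
        if vw: "v \<in> L" "w \<in> L" "i \<le> v" "i \<le> w" "adj v w" for v w
      proof -
        consider "v = i" "w \<noteq> i" | "w = i" "v \<noteq> i" | "v \<noteq> i" "w \<noteq> i" using vw by force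
        then show ?thesis
        proof cases
          case 1
          then show ?thesis using fr[of w] vw eq by auto
        next
          case 2
          then show ?thesis using fr[of v] vw eq adj_sym[of v w] by auto
        next
          case 3
          then show ?thesis using vw t(2) eq by auto
        qed
      qed
      show ?thesis using 1 2 3 4 by blast
    qed
  next
    have "v < n" if "v \<in> L" for v using that by (simp add: L_def on_def)
    then show "?J (reg ?s rN) (set_reg rV (reg ?s rN) ?s)"
      using clear s1 by (fastforce simp: cfg_reg)
  qed
  then have J: "?J 0 (sem greedy s)" by (simp add: greedy_def)
  show "v \<notin> L \<Longrightarrow> arr (sem greedy s) aCol v = arr s aCol v"
    "v \<in> L \<Longrightarrow> b \<le> arr (sem greedy s) aCol v \<and> arr (sem greedy s) aCol v < b + d"
    "v \<in> L \<Longrightarrow> w \<in> L \<Longrightarrow> adj v w \<Longrightarrow> arr (sem greedy s) aCol v \<noteq> arr (sem greedy s) aCol w"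
    using J by simp_all
qed

definition bip :: "nat set \<Rightarrow> bool" where
  "bip A \<longleftrightarrow> (\<exists>\<chi> :: nat \<Rightarrow> bool. \<forall>u\<in>A. \<forall>w\<in>A. adj u w \<longrightarrow> \<chi> u \<noteq> \<chi> w)"

lemma bip_mono: "bip B \<Longrightarrow> A \<subseteq> B \<Longrightarrow> bip A"
proof -
  assume "bip B" and A: "A \<subseteq> B"
  then obtain \<chi> :: "nat \<Rightarrow> bool" where "\<forall>u\<in>B. \<forall>w\<in>B. adj u w \<longrightarrow> \<chi> u \<noteq> \<chi> w"
    unfolding bip_def by (elim exE)
  then show "bip A"
    unfolding bip_def by (intro exI[of _ \<chi>] ballI impI) (use A in \<open>simp add: subset_iff\<close>)
qed

lemma two_color_col:
  assumes "cfg s"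
  shows "x \<notin> on aCls s \<Longrightarrow> arr (sem two_color s) aCol x = arr s aCol x"
    and "x \<in> on aCls s \<Longrightarrow>
      reg s rCol \<le> arr (sem two_color s) aCol x \<and> arr (sem two_color s) aCol x \<le> Suc (reg s rCol)"
  using sem_two_color[OF assms, of x] by (auto simp: cls_on)

lemma two_color_bip:
  assumes "cfg s" "bip (on aCls s)" "u \<in> on aCls s" "w \<in> on aCls s" "adj u w"
  shows "arr (sem two_color s) aCol u \<noteq> arr (sem two_color s) aCol w"
proof -
  from assms(2) obtain \<chi> :: "nat \<Rightarrow> bool"
    where "\<forall>u\<in>on aCls s. \<forall>w\<in>on aCls s. adj u w \<longrightarrow> \<chi> u \<noteq> \<chi> w" unfolding bip_def by blast
  then show ?thesis using two_color_proper[OF assms(1), of \<chi> u w] assms by (auto simp: cls_on)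
qed

lemma sem_remove:
  assumes s: "cfg s"
  shows "on aRest (sem remove s) = on aRest s - on aCls s" "reg (sem remove s) rF = 2 + reg s rF"
proof -
  let ?body = "Ite (elt aCls rX) (Sto aRest (Var rX) (Num 0)) Skip"
  let ?I = "\<lambda>i t. \<forall>x<n. 0 < arr t aRest x \<longleftrightarrow> 0 < arr s aRest x \<and> (i \<le> x \<longrightarrow> arr s aCls x = 0)"
  have "?I 0 (sem (For rX rN ?body) s)"
    by (rule For_inv[of ?I]) (use s in \<open>auto simp: cfg_reg same_but_def less_Suc_eq not_le Suc_le_eq le_eq_less_or_eq\<close>)
  then show "on aRest (sem remove s) = on aRest s - on aCls s" "reg (sem remove s) rF = 2 + reg s rF"
    by (auto simp: remove_def on_def sem_reg)
qed

definition high :: "nat set \<Rightarrow> nat set" where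
  "high B = {v\<in>B. d \<le> deg_in B v}"

text \<open>The colors outside \<open>B\<close>, on the low part and on the high part lie in
  disjoint ranges, so only edges within one part can be violated. The last two colors are demanded
  only if the high part is nonempty; this lets \<open>f = d = 1\<close> get by with
  \<open>q = 3\<close>.\<close>

lemma sem_finish:
  assumes s: "cfg s"
  defines "B \<equiv> on aRest s - on aNb s" and "f \<equiv> reg s rF" and "s' \<equiv> sem finish s"
  shows "x \<notin> B \<Longrightarrow> arr s' aCol x = arr s aCol x"
    and "0 < reg s' rDone \<longleftrightarrow> fine s' {..<n}"
    and "bip (high B) \<Longrightarrow> f + 1 + d \<le> q \<Longrightarrow> (high B \<noteq> {} \<longrightarrow> f + 3 + d \<le> q) \<Longrightarrow>
      (\<And>u. u < n \<Longrightarrow> u \<notin> B \<Longrightarrow> 1 \<le> arr s aCol u \<and> arr s aCol u \<le> f + 1) \<Longrightarrow>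
      (\<And>u w. u < n \<Longrightarrow> w < n \<Longrightarrow> u \<notin> B \<Longrightarrow> w \<notin> B \<Longrightarrow> adj u w \<Longrightarrow> arr s aCol u \<noteq> arr s aCol w) \<Longrightarrow>
      0 < reg s' rDone"
proof -
  let ?L = "{v\<in>B. deg_in B v < d}" and ?H = "high B"
  define s1 where "s1 = sem split s"
  have s1: "cfg s1" "on aLow s1 = ?L" "on aCls s1 = ?H" "arr s1 aCol = arr s aCol" "reg s1 rF = f" "reg s1 rD = d"
    using cfg_sem[OF s, of split] sem_split[OF s] s
    by (simp_all add: s1_def B_def high_def sem_reg sem_arr f_def cfg_reg)
  define b where "b = 2 + f"
  define b' where "b' = d + b"
  define s2 where "s2 = set_reg rCol b s1"
  have s2: "cfg s2" "on aLow s2 = ?L" "on aCls s2 = ?H" "arr s2 aCol = arr s aCol" "reg s2 rF = f"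
    "reg s2 rCol = b"
    using s1 by (simp_all add: s2_def)
  define s3 where "s3 = sem greedy s2"
  have deg: "deg_in ?L v < d" if "v \<in> ?L" for v
  proof -
    have "deg_in ?L v \<le> deg_in B v" by (rule deg_in_mono) (auto simp: B_def)
    then show ?thesis using that by simp
  qed
  note g = sem_greedy[OF s2(1), unfolded s2, folded s3_def, OF _ ballI[OF deg]]
  define s4 where "s4 = set_reg rCol b' s3"
  have s4: "cfg s4" "on aCls s4 = ?H" "arr s4 aCol = arr s3 aCol" "reg s4 rCol = b'" "reg s3 rF = f" "reg s3 rD = d"
    using cfg_sem[OF s2(1), of greedy] s2 by (simp_all add: s4_def s3_def sem_reg on_sem cfg_reg)
  define s5 where "s5 = sem two_color s4"
  note t = two_color_col[OF s4(1), unfolded s4, folded s5_def]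
  note tb = two_color_bip[OF s4(1), unfolded s4, folded s5_def]
  have c5: "cfg s5" using cfg_sem[OF s4(1), of two_color] by (simp add: s5_def)
  let ?all = "For rX rN (Sto aCls (Var rX) (Num 1))"
  define s6 where "s6 = sem ?all s5"
  let ?I = "\<lambda>i t. \<forall>x<n. i \<le> x \<longrightarrow> 0 < arr t aCls x"
  have "?I 0 s6" unfolding s6_def
    by (rule For_inv[of ?I]) (use c5 in \<open>auto simp: cfg_reg Suc_le_eq le_eq_less_or_eq\<close>)
  then have all: "on aCls s6 = {..<n}" by (auto simp: on_def)
  have c6: "cfg s6" using cfg_sem[OF c5, of ?all] by (simp add: s6_def)
  have col6: "arr s6 aCol = arr s5 aCol" by (simp add: s6_def sem_arr)
  have s': "s' = set_reg rDone (reg (sem check s6) rOk) (sem check s6)"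
    using s1(5) s4(5,6) by (simp add: s'_def finish_def s1_def s2_def s3_def s4_def s5_def s6_def b_def b'_def)
  have col': "arr s' aCol = arr s5 aCol" using col6 by (simp add: s' sem_arr)
  show out: "arr s' aCol x = arr s aCol x" if "x \<notin> B" for x
    using that t(1)[of x] g(1)[of x] by (simp add: col' high_def b_def)
  have low: "2 + f \<le> arr s' aCol v" "arr s' aCol v < 2 + f + d" if "v \<in> ?L" for v
    using that t(1)[of v] g(2)[of v] by (auto simp: col' high_def b_def)
  have hi: "d + (2 + f) \<le> arr s' aCol v" "arr s' aCol v \<le> d + (3 + f)" if "v \<in> ?H" for v
    using that t(2)[of v] by (auto simp: col' b'_def b_def)
  have "0 < reg s' rDone \<longleftrightarrow> fine s6 {..<n}" using sem_check[OF c6] all by (simp add: s')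
  also have "\<dots> \<longleftrightarrow> fine s' {..<n}" by (simp add: fine_def col' col6)
  finally show fine: "0 < reg s' rDone \<longleftrightarrow> fine s' {..<n}" .
  assume H: "bip (high B)" "f + 1 + d \<le> q" "high B \<noteq> {} \<longrightarrow> f + 3 + d \<le> q"
    and o: "\<And>u. u < n \<Longrightarrow> u \<notin> B \<Longrightarrow> 1 \<le> arr s aCol u \<and> arr s aCol u \<le> f + 1"
    and p: "\<And>u w. u < n \<Longrightarrow> w < n \<Longrightarrow> u \<notin> B \<Longrightarrow> w \<notin> B \<Longrightarrow> adj u w \<Longrightarrow> arr s aCol u \<noteq> arr s aCol w"
  have cases: "u \<notin> B \<or> u \<in> ?L \<or> u \<in> ?H" for u by (auto simp: high_def)
  have range: "1 \<le> arr s' aCol u \<and> arr s' aCol u \<le> q" if "u < n" for u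
    using cases[of u]
  proof (elim disjE)
    assume "u \<notin> B"
    then show ?thesis using o[OF that] out H(2) by fastforce
  next
    assume "u \<in> ?L"
    then show ?thesis using low[of u] H(2) by linarith
  next
    assume "u \<in> ?H"
    then have "f + 3 + d \<le> q" using H(3) by blast
    then show ?thesis using hi[OF \<open>u \<in> ?H\<close>] by linarith
  qed
  have proper: "arr s' aCol u \<noteq> arr s' aCol w" if "u < n" "w < n" "adj u w" for u w
    using cases[of u] cases[of w]
  proof (elim disjE)
    assume "u \<notin> B" "w \<notin> B"
    then show ?thesis using p[OF that(1,2) _ _ that(3)] out by simp
  next
    assume "u \<in> ?L" "w \<in> ?L"
    then show ?thesis using g(3)[of u w] t(1)[of u] t(1)[of w] that by (auto simp: col' high_def b_def)
  next
    assume "u \<in> ?H" "w \<in> ?H"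
    then show ?thesis using tb[OF H(1)] that by (simp add: col')
  next
    assume "u \<notin> B" "w \<in> ?L"
    then show ?thesis using o[OF that(1)] out[of u] low[of w] by force
  next
    assume "u \<notin> B" "w \<in> ?H"
    then show ?thesis using o[OF that(1)] out[of u] hi[of w] by force
  next
    assume "u \<in> ?L" "w \<notin> B"
    then show ?thesis using o[OF that(2)] out[of w] low[of u] by force
  next
    assume "u \<in> ?H" "w \<notin> B"
    then show ?thesis using o[OF that(2)] out[of w] hi[of u] by force
  next
    assume "u \<in> ?L" "w \<in> ?H"
    then show ?thesis using low(2)[of u] hi(1)[of w] by linarith
  next
    assume "u \<in> ?H" "w \<in> ?L"
    then show ?thesis using low(2)[of w] hi(1)[of u] by linarith
  qed
  show "0 < reg s' rDone" unfolding fine using range proper by (simp add: fine_def)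
qed

text \<open>
  Each of the \<open>r\<close> removals so far took at least \<open>T\<close> vertices out of the remaining set and used up two colors.
\<close>

definition inv :: "state \<Rightarrow> bool" where
  "inv s \<longleftrightarrow> cfg s \<and> (\<forall>u<n. u \<notin> on aRest s \<longrightarrow> 1 \<le> arr s aCol u \<and> arr s aCol u < reg s rF) \<and>
     (\<forall>u<n. \<forall>w<n. u \<notin> on aRest s \<longrightarrow> w \<notin> on aRest s \<longrightarrow> adj u w \<longrightarrow> arr s aCol u \<noteq> arr s aCol w) \<and>
     (\<exists>r. reg s rF = 1 + 2 * r \<and> r * T + card (on aRest s) \<le> n)"

text \<open>Sufficient for progress with tuple \<open>j\<close>. It depends on the remaining set and
  the next color only, so it survives unsuccessful tuples tried before \<open>j\<close>.\<close>

definition good :: "nat \<Rightarrow> nat set \<Rightarrow> nat \<Rightarrow> bool" where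
  "good j R f \<longleftrightarrow> bip (R \<inter> nbs (chosen j)) \<and> f + 1 \<le> q \<and> (T \<le> card (R \<inter> nbs (chosen j)) \<or>
     bip (high (R - nbs (chosen j))) \<and> f + 1 + d \<le> q \<and>
     (high (R - nbs (chosen j)) \<noteq> {} \<longrightarrow> f + 3 + d \<le> q))"

text \<open>Three guarantees: success is never claimed wrongly; without success, either nothing
  relevant has changed or the remaining set has shrunk; and a good tuple cannot fail. In the first
  branch the two-coloring is rejected, in the second a large neighborhood is removed, in the third
  \<open>finish\<close> is run.\<close>

lemma sem_attempt:
  assumes s: "inv s" "reg s rDone = 0" "reg s rJ < Suc n ^ k" and T: "1 \<le> T"
  defines "R \<equiv> on aRest s" and "f \<equiv> reg s rF" and "s' \<equiv> sem attempt s"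
  shows "(0 < reg s' rDone \<longrightarrow> fine s' {..<n}) \<and>
    (reg s' rDone = 0 \<longrightarrow> inv s' \<and> (on aRest s' = R \<and> reg s' rF = f \<or> on aRest s' \<subset> R)) \<and>
    (good (reg s rJ) R f \<longrightarrow> 0 < reg s' rDone \<or> on aRest s' \<subset> R)"
proof -
  let ?M = "nbs (chosen (reg s rJ))"
  let ?N = "R \<inter> ?M"
  have c: "cfg s" using s(1) by (simp add: inv_def)
  from s(1) obtain r where r: "f = 1 + 2 * r" "r * T + card R \<le> n" by (auto simp: inv_def R_def f_def)
  have old: "1 \<le> arr s aCol u" "arr s aCol u < f" if "u < n" "u \<notin> R" for u
    using s(1) that by (auto simp: inv_def R_def f_def)
  have oldp: "arr s aCol u \<noteq> arr s aCol w" if "u < n" "w < n" "u \<notin> R" "w \<notin> R" "adj u w" for u w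
    using s(1) that by (auto simp: inv_def R_def f_def)
  define s1 where "s1 = sem decode s"
  have c1: "cfg s1" using cfg_sem[OF c, of decode] by (simp add: s1_def)
  have s1: "on aNb s1 = ?M" "on aRest s1 = R" "arr s1 aCol = arr s aCol" "reg s1 rF = f" "reg s1 rDone = 0"
    using sem_decode[OF c s(3)] s(2) by (simp_all add: s1_def on_sem sem_arr sem_reg R_def f_def)
  define s2 where "s2 = set_reg rCol f (sem select s1)"
  have c2: "cfg s2" using cfg_sem[OF c1, of select] by (simp add: s2_def)
  have s2: "on aNb s2 = ?M" "on aRest s2 = R" "arr s2 aCol = arr s aCol" "reg s2 rF = f" "reg s2 rDone = 0"
    "on aCls s2 = ?N" "reg s2 rCnt = card ?N" "reg s2 rCol = f"
    using sem_select[OF c1] s1 by (simp_all add: s2_def on_sem sem_arr sem_reg)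
  define s3 where "s3 = sem check (sem two_color s2)"
  have c2': "cfg (sem two_color s2)" using cfg_sem[OF c2, of two_color] by simp
  then have c3: "cfg s3" using cfg_sem[of "sem two_color s2" check] by (simp add: s3_def)
  have s3: "on aNb s3 = ?M" "on aRest s3 = R" "reg s3 rF = f" "reg s3 rDone = 0"
    "on aCls s3 = ?N" "reg s3 rCnt = card ?N" "reg s3 rT = T" "arr s3 aCol = arr (sem two_color s2) aCol"
    using s2 c3 by (simp_all add: s3_def on_sem sem_arr sem_reg cfg_reg)
  have "fine (sem two_color s2) ?N \<longleftrightarrow> fine s3 ?N" by (simp add: fine_def s3)
  then have ok: "0 < reg s3 rOk \<longleftrightarrow> fine s3 ?N"
    using sem_check[OF c2'] s2 by (simp add: s3_def on_sem)
  have col: "x \<notin> ?N \<Longrightarrow> arr s3 aCol x = arr s aCol x"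
    "x \<in> ?N \<Longrightarrow> f \<le> arr s3 aCol x \<and> arr s3 aCol x \<le> f + 1" for x
    using two_color_col[OF c2, of x] s2 s3 by auto
  have s': "s' = (if 0 < reg s3 rOk then if T \<le> card ?N then sem remove s3 else sem finish s3 else s3)"
    using s1(4) s3 by (simp add: s'_def attempt_def s1_def s2_def s3_def sem_reg)
  have fine3: "fine s3 ?N" if "bip ?N" "f + 1 \<le> q"
    unfolding fine_def
  proof (intro conjI ballI impI)
    fix u assume u: "u \<in> ?N"
    show "1 \<le> arr s3 aCol u" "arr s3 aCol u \<le> q" using col(2)[OF u] that r by auto
    fix w assume "w \<in> ?N" "adj u w"
    then show "arr s3 aCol u \<noteq> arr s3 aCol w"
      using two_color_bip[OF c2, of u w] u s2(6) s3(8) that by simp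
  qed
  have out: "1 \<le> arr s3 aCol u \<and> arr s3 aCol u \<le> f + 1" if "u < n" "u \<notin> R - ?M" for u
    using col[of u] old[of u] that r by (cases "u \<in> ?N") auto
  have outp: "arr s3 aCol u \<noteq> arr s3 aCol w"
    if uw: "fine s3 ?N" "u < n" "w < n" "u \<notin> R - ?M" "w \<notin> R - ?M" "adj u w" for u w
  proof -
    consider "u \<in> ?N" "w \<in> ?N" | "u \<in> ?N" "w \<notin> R" | "u \<notin> R" "w \<in> ?N" | "u \<notin> R" "w \<notin> R"
      using uw by blast
    then show ?thesis
    proof cases
      case 1
      then show ?thesis using uw by (simp add: fine_def)
    next
      case 2
      then show ?thesis using col(2)[of u] col(1)[of w] old[of w] uw by auto
    next
      case 3
      then show ?thesis using col(1)[of u] col(2)[of w] old[of u] uw by auto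
    next
      case 4
      then show ?thesis using col(1)[of u] col(1)[of w] oldp[of u w] uw by auto
    qed
  qed
  \<comment> \<open>The invariant ignores colors inside \<open>R\<close>, so whatever a failed
    \<open>finish\<close> writes there is harmless.\<close>
  have keep: "inv t" if "cfg t" "on aRest t = R" "reg t rF = f" "\<And>x. x \<notin> R \<Longrightarrow> arr t aCol x = arr s aCol x" for t
    using that old oldp r unfolding inv_def by auto
  consider "\<not> fine s3 ?N" | "fine s3 ?N" "T \<le> card ?N" | "fine s3 ?N" "\<not> T \<le> card ?N" by blast
  then show ?thesis
  proof cases
    case 1
    then have "s' = s3" using s' ok by simp
    moreover have "inv s3" using c3 s3 col by (intro keep) auto
    moreover have "\<not> good (reg s rJ) R f" using 1 fine3 by (auto simp: good_def)
    ultimately show ?thesis using s3 by simp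
  next
    case 2
    then have eq: "s' = sem remove s3" using s' ok by simp
    have R': "on aRest s' = R - ?M" "reg s' rF = f + 2"
      using sem_remove[OF c3] s3 by (auto simp: eq)
    have col': "arr s' aCol = arr s3 aCol" by (simp add: eq sem_arr)
    have fin: "finite R" by (simp add: R_def)
    have "card R = card (R - ?M) + card ?N"
      using card_Int_Diff[OF fin, of ?M] by simp
    then have "Suc r * T + card (R - ?M) \<le> n" using r(2) 2(2) by simp
    moreover have "f + 2 = 1 + 2 * Suc r" using r(1) by simp
    ultimately have "\<exists>r. f + 2 = 1 + 2 * r \<and> r * T + card (R - ?M) \<le> n" by blast
    moreover have "cfg s'" using cfg_sem[OF c3, of remove] by (simp add: eq)
    ultimately have "inv s'"
      unfolding inv_def R' col' using out outp[OF 2(1)] by (fastforce simp: less_Suc_eq_le)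
    moreover have "?N \<noteq> {}" using 2(2) T by auto
    then have "on aRest s' \<subset> R" unfolding R' by auto
    moreover have "reg s' rDone = 0" using s3 by (simp add: eq sem_reg)
    ultimately show ?thesis by simp
  next
    case 3
    then have eq: "s' = sem finish s3" using s' ok by simp
    note F = sem_finish[OF c3, folded eq, unfolded s3(1-7)]
    have cs: "cfg s'" using cfg_sem[OF c3, of finish] by (simp add: eq)
    have "on aRest s' = R" "reg s' rF = f" using s3 by (simp_all add: eq on_sem sem_reg)
    moreover have "arr s' aCol x = arr s aCol x" if "x \<notin> R" for x
      using F(1)[of x] col(1)[of x] that by auto
    then have "inv s'" using cs calculation by (intro keep) auto
    moreover have "0 < reg s' rDone" if "good (reg s rJ) R f"
      by (rule F(3)) (use that 3 out outp[OF 3(1)] in \<open>auto simp: good_def\<close>)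
    ultimately show ?thesis using F(2) by simp
  qed
qed

text \<open>Until the loop reaches \<open>j\<close>, either the set has shrunk already, or set and
  next color are as on entry and \<open>j\<close> is still good when its turn comes.\<close>

lemma sem_pass:
  assumes s: "inv s" "reg s rDone = 0" and T: "1 \<le> T"
    and j: "j < Suc n ^ k" "good j (on aRest s) (reg s rF)"
  defines "s' \<equiv> sem (For rJ rTuples (Ite (Var rDone) Skip attempt)) s"
  shows "(0 < reg s' rDone \<longrightarrow> fine s' {..<n}) \<and> (reg s' rDone = 0 \<longrightarrow> inv s' \<and> on aRest s' \<subset> on aRest s)"
proof -
  let ?R = "on aRest s" and ?f = "reg s rF"
  let ?body = "Ite (Var rDone) Skip attempt"
  let ?I = "\<lambda>i t. (0 < reg t rDone \<longrightarrow> fine t {..<n}) \<and>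
    (reg t rDone = 0 \<longrightarrow> inv t \<and> (on aRest t \<subset> ?R \<or> on aRest t = ?R \<and> reg t rF = ?f \<and> j < i))"
  have inv_reg: "inv (set_reg rJ v t) \<longleftrightarrow> inv t" for v t by (simp add: inv_def)
  have fine_reg: "fine (set_reg rJ v t) A \<longleftrightarrow> fine t A" for v t A by (simp add: fine_def)
  have c: "cfg s" using s by (simp add: inv_def)
  have "?I 0 s'"
    unfolding s'_def
  proof (rule For_inv[of ?I])
    fix i t
    assume i: "i < reg s rTuples" and t: "?I (Suc i) t"
    let ?t = "set_reg rJ i t"
    show "?I i (sem ?body ?t)"
    proof (cases "0 < reg t rDone")
      case True
      then show ?thesis using t by (simp add: fine_reg)
    next
      case False
      then have it: "inv t" and
        R: "on aRest t \<subset> ?R \<or> on aRest t = ?R \<and> reg t rF = ?f \<and> j < Suc i" using t by auto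
      have "i < Suc n ^ k" using i c by (simp add: cfg_reg)
      then have "(0 < reg (sem attempt ?t) rDone \<longrightarrow> fine (sem attempt ?t) {..<n}) \<and>
        (reg (sem attempt ?t) rDone = 0 \<longrightarrow> inv (sem attempt ?t) \<and>
          (on aRest (sem attempt ?t) = on aRest t \<and> reg (sem attempt ?t) rF = reg t rF \<or>
           on aRest (sem attempt ?t) \<subset> on aRest t)) \<and>
        (good i (on aRest t) (reg t rF) \<longrightarrow> 0 < reg (sem attempt ?t) rDone \<or> on aRest (sem attempt ?t) \<subset> on aRest t)"
        using sem_attempt[of ?t] it T False by (simp add: inv_reg)
      moreover have "sem ?body ?t = sem attempt ?t" using False by simp
      ultimately show ?thesis using R j(2) by (auto simp: less_Suc_eq)
    qed
  qed (use s j c in \<open>auto simp: inv_reg fine_reg cfg_reg\<close>)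
  then show ?thesis by auto
qed

text \<open>The pass counter exceeds the size of the remaining set. At counter 0 this is impossible,
  so the program must have finished by then.\<close>

lemma sem_main:
  assumes s: "cfg s" and T: "1 \<le> T"
    and ex: "\<And>R r. R \<subseteq> {..<n} \<Longrightarrow> r * T + card R \<le> n \<Longrightarrow> \<exists>j<Suc n ^ k. good j R (1 + 2 * r)"
  shows "fine (sem main s) {..<n}"
proof -
  let ?init = "For rX rN (Sto aRest (Var rX) (Num 1))"
  define s1 where "s1 = sem ?init (set_reg rDone 0 (set_reg rF 1 s))"
  let ?C = "\<lambda>i t. \<forall>x<n. i \<le> x \<longrightarrow> 0 < arr t aRest x"
  have "?C 0 s1" unfolding s1_def
    by (rule For_inv[of ?C]) (use s in \<open>auto simp: cfg_reg Suc_le_eq le_eq_less_or_eq\<close>)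
  then have R1: "on aRest s1 = {..<n}" by (auto simp: on_def)
  have c1: "cfg s1" using cfg_sem[of _ ?init] s by (simp add: s1_def)
  have i1: "inv s1" "reg s1 rDone = 0"
    using c1 R1 by (auto simp: inv_def s1_def sem_reg)
  let ?body = "For rJ rTuples (Ite (Var rDone) Skip attempt)"
  let ?I = "\<lambda>i t. (0 < reg t rDone \<longrightarrow> fine t {..<n}) \<and> (reg t rDone = 0 \<longrightarrow> inv t \<and> card (on aRest t) < i)"
  have inv_reg: "inv (set_reg rPass v t) \<longleftrightarrow> inv t" for v t by (simp add: inv_def)
  have fine_reg: "fine (set_reg rPass v t) A \<longleftrightarrow> fine t A" for v t A by (simp add: fine_def)
  have "?I 0 (sem (For rPass rBase ?body) s1)"
  proof (rule For_inv[of ?I])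
    fix i t
    assume t: "?I (Suc i) t"
    let ?t = "set_reg rPass i t"
    show "?I i (sem ?body ?t)"
    proof (cases "0 < reg t rDone")
      case True
      let ?J = "\<lambda>i v. 0 < reg v rDone \<and> fine v {..<n}"
      have "?J 0 (sem ?body ?t)"
        by (rule For_inv[of ?J]) (use True t in \<open>auto simp: fine_def\<close>)
      then show ?thesis by auto
    next
      case False
      then have it: "inv t" "card (on aRest t) < Suc i" using t by auto
      then obtain r where r: "reg t rF = 1 + 2 * r" "r * T + card (on aRest t) \<le> n" by (auto simp: inv_def)
      have "on aRest t \<subseteq> {..<n}" by (auto simp: on_def)
      from ex[OF this r(2)] obtain j where j: "j < Suc n ^ k" "good j (on aRest t) (reg t rF)" using r by auto
      have "(0 < reg (sem ?body ?t) rDone \<longrightarrow> fine (sem ?body ?t) {..<n}) \<and>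
        (reg (sem ?body ?t) rDone = 0 \<longrightarrow> inv (sem ?body ?t) \<and> on aRest (sem ?body ?t) \<subset> on aRest t)"
        using sem_pass[of ?t j] it False T j by (simp add: inv_reg)
      moreover have "on aRest (sem ?body ?t) \<subset> on aRest t \<Longrightarrow>
          card (on aRest (sem ?body ?t)) < card (on aRest t)"
        by (rule psubset_card_mono) simp
      ultimately show ?thesis using it(2) by linarith
    qed
  qed (use i1 c1 R1 in \<open>auto simp: inv_reg cfg_reg\<close>)
  moreover have "sem main s = sem (For rPass rBase ?body) s1" by (simp add: main_def s1_def)
  ultimately show ?thesis by auto
qed

section \<open>Existence of a good tuple\<close>

lemma exists_maximal:
  assumes "finite (A :: 'a set set)" "a \<in> A"
  obtains m where "m \<in> A" "a \<subseteq> m" "\<And>b. b \<in> A \<Longrightarrow> m \<subseteq> b \<Longrightarrow> m = b"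
proof -
  from finite_has_maximal2[OF assms] obtain m
    where m: "m \<in> A" "a \<subseteq> m" "\<forall>b\<in>A. m \<subseteq> b \<longrightarrow> m = b" by auto
  show thesis by (rule that[OF m(1,2)]) (use m(3) in simp)
qed

text \<open>
  If the set \<open>S\<close> chosen greedily inside the independent set \<open>C\<close> gets stuck, every vertex of \<open>C\<close> has low
  degree outside the neighborhood of \<open>S\<close>. Maximality of \<open>C\<close> only matters if \<open>d = 1\<close>, i.e.\ for few colors:
  then no vertex of high degree is left, and three colors suffice.
\<close>

lemma exists_good:
  assumes C3: "three_colorable {..<n} E" and T: "T \<le> d * k" and d: "1 \<le> d" and R: "R \<subseteq> {..<n}"
    and q: "2 * r + 4 + d \<le> q \<or> d = 1 \<and> 2 * r + 3 \<le> q"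
  shows "\<exists>j<Suc n ^ k. good j R (1 + 2 * r)"
proof -
  from C3 obtain c where c: "proper_coloring {..<n} E 3 c" by (auto simp: three_colorable_def)
  have c1: "c v = 1 \<or> c v = 2 \<or> c v = 3" if "v < n" for v
  proof -
    have "c v \<in> {1..3}" using c that by (simp add: proper_coloring_def)
    then show ?thesis by auto
  qed
  have c2: "c u \<noteq> c v" if "u < n" "v < n" "adj u v" for u v
    using c that by (simp add: proper_coloring_def adj_def)
  let ?ind = "\<lambda>C. \<forall>u\<in>C. \<forall>v\<in>C. \<not> adj u v"
  let ?A = "{C. C \<subseteq> {..<n} \<and> ?ind C}"
  have "finite ?A" by (rule finite_subset[of _ "Pow {..<n}"]) auto
  moreover have "{v. v < n \<and> c v = 1} \<in> ?A" using c2 by fastforce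
  \<comment> \<open>A maximal independent set containing color class 1: its complement uses only
    colors 2 and 3, hence is bipartite, and every vertex outside it has a neighbor in it.\<close>
  ultimately obtain C where C: "C \<in> ?A" "{v. v < n \<and> c v = 1} \<subseteq> C" "\<And>D. D \<in> ?A \<Longrightarrow> C \<subseteq> D \<Longrightarrow> C = D"
    by (rule exists_maximal) blast
  have bipC: "bip ({..<n} - C)"
    unfolding bip_def
  proof (intro exI[of _ "\<lambda>v. c v = 2"] ballI impI)
    fix u w assume uw: "u \<in> {..<n} - C" "w \<in> {..<n} - C" "adj u w"
    then have "c u \<noteq> 1" "c w \<noteq> 1" using C(2) by auto
    then show "(c u = 2) \<noteq> (c w = 2)" using c1[of u] c1[of w] c2[of u w] uw by auto
  qed
  have dom: "\<exists>u\<in>C. adj u x" if "x < n" "x \<notin> C" for x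
  proof (rule ccontr)
    assume "\<not> ?thesis"
    then have "insert x C \<in> ?A" using C(1) that adj_sym by auto
    then show False using C(3)[of "insert x C"] that by auto
  qed
  \<comment> \<open>The sets that greedy growth may reach: on average each member accounts for at
    least \<open>d\<close> vertices of the neighborhood. An inclusion-maximal one replaces the
    growth process.\<close>
  let ?P = "{S. S \<subseteq> C \<and> card S \<le> k \<and> d * card S \<le> card (R \<inter> nbs S)}"
  have finC: "finite C" using C(1) finite_subset by blast
  then have "finite ?P" by simp
  moreover have "{} \<in> ?P" by simp
  ultimately obtain S where S: "S \<in> ?P" "\<And>S'. S' \<in> ?P \<Longrightarrow> S \<subseteq> S' \<Longrightarrow> S = S'"
    by (rule exists_maximal) blast
  have "S \<subseteq> {..<n}" "card S \<le> k" using S(1) C(1) by auto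
  then obtain j where j: "j < Suc n ^ k" "chosen j = S" using exists_chosen by blast
  let ?B = "R - nbs S"
  have finR: "finite R" using R finite_subset by blast
  \<comment> \<open>Neighbors of an independent set avoid it.\<close>
  have "R \<inter> nbs S \<subseteq> {..<n} - C" using S(1) C(1) R by (auto simp: nbs_def)
  then have bipN: "bip (R \<inter> nbs S)" using bip_mono[OF bipC] by blast
  show ?thesis
  proof (cases "card S = k")
    case True
    then have "T \<le> card (R \<inter> nbs S)" using S(1) T by auto
    then show ?thesis using j bipN q d by (auto simp: good_def intro!: exI[of _ j])
  next
    case False
    have low: "deg_in ?B v < d" if "v \<in> C" for v
    proof (cases "v \<in> S")
      case True
      then have e: "{w \<in> ?B. adj v w} = {}" using R by (auto simp: nbs_def)
      show ?thesis unfolding deg_in_def e using d by simp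
    next
      case vS: False
      have finS: "finite S" using S(1) finC finite_subset by blast
      have "card (insert v S) = Suc (card S)" using vS finS by simp
      moreover have "R \<inter> nbs (insert v S) = (R \<inter> nbs S) \<union> {w \<in> ?B. adj v w}"
        using R by (auto simp: nbs_def)
      \<comment> \<open>Adding \<open>v\<close> gains exactly its neighbors in \<open>?B\<close>; by
        maximality of \<open>S\<close> and since \<open>card S < k\<close>, the gain is below
        \<open>d\<close>.\<close>
      then have "card (R \<inter> nbs (insert v S)) = card (R \<inter> nbs S) + deg_in ?B v"
        using finR unfolding deg_in_def by (simp add: card_Un_disjoint[symmetric] disjoint_iff)
      moreover have "insert v S \<notin> ?P" using S(2)[of "insert v S"] vS by auto
      ultimately have "card (R \<inter> nbs S) + deg_in ?B v < d * Suc (card S)"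
        using False S(1) that by auto
      moreover have "d * card S \<le> card (R \<inter> nbs S)" using S(1) by simp
      ultimately show ?thesis by simp
    qed
    have "high ?B \<subseteq> {..<n} - C" using R low by (fastforce simp: high_def)
    then have bipH: "bip (high ?B)" using bip_mono[OF bipC] by blast
    \<comment> \<open>With \<open>d = 1\<close> no vertex of \<open>C\<close> has a neighbor in
      \<open>?B\<close>. As \<open>C\<close> dominates its complement, \<open>?B\<close> lies inside
      \<open>C\<close>, where all degrees are low.\<close>
    have "high ?B = {}" if d1: "d = 1"
    proof -
      have "?B \<subseteq> C"
      proof
        fix x assume x: "x \<in> ?B"
        show "x \<in> C"
        proof (rule ccontr)
          assume "x \<notin> C"
          then obtain u where u: "u \<in> C" "adj u x" using dom x R by blast
          then have "{w \<in> ?B. adj u w} \<noteq> {}" using x by blast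
          then have "0 < deg_in ?B u" using finR by (simp add: deg_in_def card_gt_0_iff)
          then show False using low[OF u(1)] d1 by simp
        qed
      qed
      moreover have "high ?B \<inter> C = {}" using low by (fastforce simp: high_def)
      ultimately show ?thesis by (auto simp: high_def)
    qed
    then show ?thesis using j bipN bipH q d by (auto simp: good_def intro!: exI[of _ j])
  qed
qed

end

section \<open>The complete program\<close>

definition quarter :: cmd where
  "quarter = Asg rD (Num 0) ;; For rX rQ
     (Ite (le_exp (Plus (Num 4) (Plus (Plus (Var rD) (Var rD)) (Plus (Var rD) (Var rD)))) (Var rQ))
       (Asg rD (Plus (Num 1) (Var rD))) Skip)"

text \<open>Division by \<open>rD\<close>, rounded up. If \<open>rD\<close> is 0, as for
  \<open>q = 3\<close>, the counter never moves and the result is the value of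
  \<open>y\<close>.\<close>

definition ceil_div :: "nat \<Rightarrow> nat \<Rightarrow> cmd" where
  "ceil_div x y = Asg x (Num 0) ;; Asg rCnt (Num 0) ;; For rX y
     (Ite (lt_exp (Var rCnt) (Var y)) (Asg x (Plus (Num 1) (Var x)) ;; Asg rCnt (Plus (Var rD) (Var rCnt))) Skip)"

text \<open>\<open>rT = n + 1\<close> exceeds every possible neighborhood, which rules out removals,
  and \<open>rK = n + 1\<close> keeps \<open>T \<le> d * k\<close> with
  \<open>d = 1\<close>.\<close>

definition few_colors :: cmd where
  "few_colors = Asg rBase (Plus (Num 1) (Var rN)) ;; Ite (lt_exp (Var rQ) (Num 16))
     (Asg rD (Num 1) ;; Asg rT (Var rBase) ;; Asg rK (Var rBase)) Skip"

definition tuples :: cmd where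
  "tuples = Asg rTuples (Num 1) ;; For rX rK (Asg rCnt (Num 0) ;;
     For rW rBase (Asg rCnt (Plus (Var rTuples) (Var rCnt))) ;; Asg rTuples (Var rCnt))"

definition rows :: cmd where
  "rows = Asg rW (Num 0) ;; Asg rCnt (Num 0) ;; For rX rN (Sto aRow (Var rW) (Var rCnt) ;;
     Asg rCnt (Plus (Var rN) (Var rCnt)) ;; Asg rW (Plus (Num 1) (Var rW)))"

text \<open>The preparation is cut into pieces because the cost estimate needs commands that do not
  write their own loop bounds, while the registers computed here are the bounds of later
  loops.\<close>

definition prepare1 :: cmd where
  "prepare1 = ceil_div rK rT ;; few_colors"

definition prepare2 :: cmd where
  "prepare2 = tuples ;; rows"

text \<open>The last loop only spends time: it makes the running time at least the number of tuples.\<close>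

definition color_graph :: cmd where
  "color_graph = quarter ;; ceil_div rT rN ;; prepare1 ;; prepare2 ;; main ;; For rX rTuples Skip"

lemma sem_quarter: "reg (sem quarter s) rD = reg s rQ div 4"
proof -
  let ?body = "Ite (le_exp (Plus (Num 4) (Plus (Plus (Var rD) (Var rD)) (Plus (Var rD) (Var rD)))) (Var rQ))
       (Asg rD (Plus (Num 1) (Var rD))) Skip"
  let ?I = "\<lambda>i t. 4 * reg t rD \<le> reg s rQ \<and> (reg s rQ < 4 * reg t rD + 4 \<or> reg s rQ \<le> reg t rD + i)"
  have "?I 0 (sem (For rX rQ ?body) (set_reg rD 0 s))"
    by (rule For_inv[of ?I]) (auto simp: same_but_def)
  then show ?thesis by (auto simp: quarter_def)
qed

text \<open>The last two bounds say that \<open>z\<close> is the quotient rounded up. For divisor 0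
  the invariant ends with \<open>z = m\<close>.\<close>

lemma sem_ceil_div:
  fixes s :: state
  assumes xy: "x \<noteq> y" "x \<noteq> rX" "x \<noteq> rCnt" "x \<noteq> rD" "y \<noteq> rX" "y \<noteq> rCnt"
  defines "m \<equiv> reg s y" and "h \<equiv> reg s rD" and "z \<equiv> reg (sem (ceil_div x y) s) x"
  shows "z \<le> m" and "1 \<le> m \<Longrightarrow> 1 \<le> z" and "1 \<le> h \<Longrightarrow> m \<le> z * h" and "1 \<le> m \<Longrightarrow> (z - 1) * h < m"
proof -
  let ?body = "Ite (lt_exp (Var rCnt) (Var y)) (Asg x (Plus (Num 1) (Var x)) ;; Asg rCnt (Plus (Var rD) (Var rCnt))) Skip"
  let ?s = "set_reg rCnt 0 (set_reg x 0 s)"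
  let ?I = "\<lambda>i t. reg t rCnt = reg t x * h \<and> reg t x + i \<le> m \<and> (m \<le> reg t rCnt \<or> reg t x + i = m) \<and>
    (1 \<le> reg t x \<longrightarrow> (reg t x - 1) * h < m)"
  have "?I 0 (sem (For rX y ?body) ?s)"
  proof (rule For_inv[of ?I])
    fix i t
    assume t: "same_but (insert rX (written ?body)) (written_arrs ?body) ?s t" "?I (Suc i) t"
    have "reg t y = m" "reg t rD = h" using t(1) xy by (simp_all add: same_but_def m_def h_def)
    then show "?I i (sem ?body (set_reg rX i t))"
      using t(2) xy by (auto simp: algebra_simps)
  qed (use xy in \<open>auto simp: m_def\<close>)
  moreover have "z = reg (sem (For rX y ?body) ?s) x" by (simp add: z_def ceil_div_def)
  ultimately have z: "z \<le> m" "m \<le> z * h \<or> z = m" "1 \<le> z \<longrightarrow> (z - 1) * h < m" by auto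
  moreover from this have "1 \<le> m \<longrightarrow> 1 \<le> z" by (cases z) auto
  ultimately show "z \<le> m" "1 \<le> m \<Longrightarrow> 1 \<le> z" "1 \<le> h \<Longrightarrow> m \<le> z * h" "1 \<le> m \<Longrightarrow> (z - 1) * h < m"
    by (auto elim: disjE)
qed

lemma sem_tuples: "reg (sem tuples s) rTuples = reg s rBase ^ reg s rK"
proof -
  let ?inner = "For rW rBase (Asg rCnt (Plus (Var rTuples) (Var rCnt)))"
  let ?body = "Asg rCnt (Num 0) ;; ?inner ;; Asg rTuples (Var rCnt)"
  let ?b = "reg s rBase"
  have inner: "reg (sem ?body t) rTuples = reg t rTuples * reg t rBase" for t
  proof -
    let ?J = "\<lambda>i v. reg v rCnt + i * reg t rTuples = reg t rBase * reg t rTuples"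
    have "?J 0 (sem ?inner (set_reg rCnt 0 t))"
      by (rule For_inv[of ?J]) (auto simp: same_but_def)
    then show ?thesis by simp
  qed
  let ?I = "\<lambda>i t. reg t rTuples * ?b ^ i = ?b ^ reg s rK"
  have "?I 0 (sem (For rX rK ?body) (set_reg rTuples 1 s))"
  proof (rule For_inv[of ?I])
    fix i t
    assume t: "same_but (insert rX (written ?body)) (written_arrs ?body) (set_reg rTuples 1 s) t" "?I (Suc i) t"
    have "reg t rBase = ?b" using t(1) by (simp add: same_but_def)
    then show "?I i (sem ?body (set_reg rX i t))"
      using t(2) unfolding inner by (simp add: mult.assoc)
  qed simp
  then show ?thesis by (simp add: tuples_def)
qed

lemma sem_rows: "\<forall>u<reg s rN. arr (sem rows s) aRow u = u * reg s rN"
proof -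
  let ?n = "reg s rN"
  let ?body = "Sto aRow (Var rW) (Var rCnt) ;; Asg rCnt (Plus (Var rN) (Var rCnt)) ;; Asg rW (Plus (Num 1) (Var rW))"
  let ?I = "\<lambda>i t. reg t rW + i = ?n \<and> reg t rCnt = reg t rW * ?n \<and> (\<forall>u<reg t rW. arr t aRow u = u * ?n)"
  have "?I 0 (sem (For rX rN ?body) (set_reg rCnt 0 (set_reg rW 0 s)))"
    by (rule For_inv[of ?I]) (auto simp: same_but_def less_Suc_eq algebra_simps)
  then show ?thesis by (auto simp: rows_def)
qed

text \<open>Other registers and arrays may hold anything, so that the coloring program can also
  start where another program has stopped.\<close>

definition ready :: "nat \<Rightarrow> nat \<Rightarrow> nat set set \<Rightarrow> state \<Rightarrow> bool" where
  "ready n q E s \<longleftrightarrow> reg s rN = n \<and> reg s rQ = q \<and>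
     (\<forall>u<n. \<forall>w<n. arr s aAdj (u * n + w) = (if {u, w} \<in> E then 1 else 0))"

text \<open>For many colors \<open>k\<close> is of order \<open>n / q ^ 2\<close>. The two estimates
  are all that the growth argument uses.\<close>

definition tuple_length :: "nat \<Rightarrow> nat \<Rightarrow> nat \<Rightarrow> bool" where
  "tuple_length n q k \<longleftrightarrow> 1 \<le> k \<and> (16 \<le> q \<longrightarrow> n \<le> k * q ^ 2 \<and> (k - 1) * q ^ 2 \<le> 64 * (n + q))"

text \<open>From \<open>q \<ge> 16\<close> follow \<open>4 \<le> h\<close> and
  \<open>q \<le> 8 * h\<close>; the factor 64 is the square of 8. The bound \<open>r \<le> h\<close>
  gives \<open>2 * r + 4 + h \<le> 3 * h + 4 \<le> 4 * h \<le> q\<close>.\<close>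

lemma parameters:
  assumes h: "h = q div 4" and q: "16 \<le> q" and n: "1 \<le> n"
    and T: "1 \<le> T" "n \<le> T * h" "(T - 1) * h < n" and k: "1 \<le> k" "T \<le> k * h" "(k - 1) * h < T"
  shows "tuple_length n q k" "r * T \<le> n \<Longrightarrow> 2 * r + 4 + h \<le> q"
proof -
  have h4: "4 \<le> h" "4 * h \<le> q" "q \<le> 8 * h" using h q by auto
  have "n \<le> T * h" by fact
  also have "\<dots> \<le> k * h * h" using k(2) by simp
  also have "\<dots> \<le> k * q * q" using h4 by (intro mult_le_mono) auto
  finally have lower: "n \<le> k * q ^ 2" by (simp add: power2_eq_square mult.assoc)
  have "(k - 1) * h * h \<le> T * h" using k(3) by (intro mult_le_mono1) simp
  also have "\<dots> = (T - 1) * h + h" using T(1) by (simp add: algebra_simps)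
  also have "\<dots> \<le> n + q" using T(3) h4 by linarith
  finally have *: "(k - 1) * h * h \<le> n + q" .
  have "(k - 1) * q ^ 2 \<le> (k - 1) * (8 * h) ^ 2" using h4 by (intro mult_le_mono2 power_mono) auto
  also have "\<dots> = 64 * ((k - 1) * h * h)" by (simp add: power2_eq_square)
  also have "\<dots> \<le> 64 * (n + q)" using * by simp
  finally show "tuple_length n q k" using lower k by (simp add: tuple_length_def)
  assume "r * T \<le> n"
  then have "T * r \<le> T * h" using T(2) by (metis le_trans mult.commute)
  moreover have "0 < T" using T(1) by linarith
  ultimately have "r \<le> h" by simp
  then show "2 * r + 4 + h \<le> q" using h4 by linarith
qed

lemma sem_prepare:
  assumes s: "ready n q E s" and n: "1 \<le> n" and q: "3 \<le> q" and E: "simple_graph {..<n} E"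
  defines "s2 \<equiv> sem (ceil_div rT rN) (sem quarter s)"
  defines "s3 \<equiv> sem prepare1 s2"
  obtains d T k where "config.cfg n q d T k E (sem prepare2 s3)" "tuple_length n q k"
    "1 \<le> d" "1 \<le> T" "T \<le> d * k" "d \<le> q"
    "\<And>r. r * T \<le> n \<Longrightarrow> 2 * r + 4 + d \<le> q \<or> d = 1 \<and> 2 * r + 3 \<le> q"
    "reg s2 rT \<le> n" "reg s3 rK = k" "reg s3 rBase = Suc n" "reg s3 rN = n"
proof -
  \<comment> \<open>The zeros are placeholders: adjacency depends on \<open>E\<close> only.\<close>
  interpret A: config n q 0 0 0 E by unfold_locales (use n E in auto)
  let ?h = "q div 4"
  define s1 where "s1 = sem quarter s"
  have s1: "reg s1 rD = ?h" "reg s1 rN = n" "reg s1 rQ = q" "arr s1 = arr s"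
    using s sem_quarter[of s] by (auto simp: s1_def ready_def sem_reg quarter_def sem_arr)
  define T where "T = reg s2 rT"
  have s2: "reg s2 rD = ?h" "reg s2 rN = n" "reg s2 rQ = q" "arr s2 = arr s"
    using s1 by (auto simp: s2_def s1_def[symmetric] ceil_div_def sem_reg sem_arr)
  have T: "T \<le> n" "1 \<le> T" "1 \<le> ?h \<Longrightarrow> n \<le> T * ?h" "(T - 1) * ?h < n"
    using sem_ceil_div[of rT rN s1] s1 n by (auto simp: T_def s2_def s1_def[symmetric])
  define s2' where "s2' = sem (ceil_div rK rT) s2"
  define k where "k = reg s2' rK"
  have s2': "reg s2' rD = ?h" "reg s2' rN = n" "reg s2' rQ = q" "arr s2' = arr s" "reg s2' rT = T"
    using s2 by (auto simp: s2'_def ceil_div_def sem_reg sem_arr T_def)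
  have k: "1 \<le> k" "1 \<le> ?h \<Longrightarrow> T \<le> k * ?h" "(k - 1) * ?h < T"
    using sem_ceil_div[of rK rT s2] s2 T(2) by (auto simp: k_def s2'_def T_def)
  let ?d = "if q < 16 then 1 else ?h" and ?T = "if q < 16 then Suc n else T" and ?k = "if q < 16 then Suc n else k"
  have s3_eq: "s3 = sem few_colors s2'" by (simp add: s3_def prepare1_def s2'_def)
  have s3: "reg s3 rD = ?d" "reg s3 rT = ?T" "reg s3 rK = ?k" "reg s3 rN = n" "reg s3 rQ = q"
    "reg s3 rBase = Suc n" "arr s3 = arr s"
    using s2' by (simp_all add: s3_eq few_colors_def k_def)
  have t3: "reg (sem tuples s3) rTuples = Suc n ^ ?k" using sem_tuples[of s3] s3 by simp
  have wt: "written tuples = {rTuples, rX, rCnt, rW}" "written_arrs tuples = {}"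
    "written rows = {rW, rCnt, rX}" "written_arrs rows = {aRow}"
    by (auto simp: tuples_def rows_def)
  have cfg: "config.cfg n q ?d ?T ?k E (sem prepare2 s3)"
    using sem_rows[of "sem tuples s3"] s3 t3 s wt
    by (simp add: A.cfg_def config.cfg_def[OF A.config_axioms] prepare2_def sem_reg sem_arr ready_def A.adj_def)
  show thesis
  proof (rule that[OF cfg])
    show "tuple_length n q ?k"
      using parameters(1)[OF refl, of q n T k] T k n by (cases "16 \<le> q") (auto simp: tuple_length_def)
    show "1 \<le> ?d" "1 \<le> ?T" "reg s2 rT \<le> n" "?d \<le> q" using q T T_def by auto
    show "?T \<le> ?d * ?k" using k(2) by (auto simp: mult.commute)
    show "2 * r + 4 + ?d \<le> q \<or> ?d = 1 \<and> 2 * r + 3 \<le> q" if "r * ?T \<le> n" for r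
    proof (cases "16 \<le> q")
      case True
      then show ?thesis using parameters(2)[OF refl True n, of T k r] T k that by auto
    next
      case False
      \<comment> \<open>With \<open>T = n + 1\<close> no removal can have happened, and
        \<open>2 * r + 3\<close> is just 3.\<close>
      then have "r * Suc n < Suc n" using that by simp
      then have "r = 0" by (cases r) auto
      then show ?thesis using False q by simp
    qed
  qed (use s3 T_def in auto)
qed

text \<open>Registers from 40 on hold the temporary values of compiled expressions.\<close>

lemma wf_color_graph: "wf_cmd 40 color_graph"
  by (simp add: color_graph_def prepare1_def prepare2_def quarter_def ceil_div_def few_colors_def tuples_def rows_def
      main_def attempt_def decode_def divide_def mark_def select_def two_color_def merge_all_def merge_def
      relabel_def check_def remove_def finish_def split_def degree_def greedy_def color_vertex_def conflict_def)

lemma bounds_main: "bounds main = {rN, rBase, rTuples, rK, rD}"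
  by (auto simp: main_def attempt_def decode_def divide_def mark_def select_def two_color_def merge_all_def
      merge_def relabel_def check_def remove_def finish_def split_def degree_def greedy_def color_vertex_def
      conflict_def)

lemma written_main:
  "written main \<inter> {..6} = {}" "written_arrs main \<inter> {aAdj, aRow} = {}"
  by (auto simp: main_def attempt_def)

text \<open>One program and one pair of constants serve all \<open>n\<close>, \<open>q\<close> and
  \<open>E\<close>. Both time bounds are expressed through the number of tuples; the lower one comes
  from the idle loop.\<close>

lemma algorithm:
  "\<exists>p C D. \<forall>n\<ge>1. \<forall>q\<ge>3. \<forall>E\<in>three_colorable_graphs n. \<forall>s. ready n q E s \<longrightarrow>
     (\<exists>t s' k. exec p s t s' \<and> proper_coloring {..<n} E q (arr s' 1) \<and> tuple_length n q k \<and>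
        Suc n ^ k \<le> t \<and> t \<le> C * (Suc n ^ k + q + 2) ^ D)"
proof -
  have "\<exists>C D. \<forall>s. \<forall>m\<ge>1. (\<forall>y\<in>bounds c. reg s y \<le> m) \<longrightarrow> cost c s \<le> C * m ^ D"
    if "bounds c \<inter> written c = {}" for c
    using cost_poly[OF that] .
  note poly = this
  have "bounds quarter \<inter> written quarter = {}" by (simp add: quarter_def)
  from poly[OF this] obtain C1 D1 where 1: "\<And>s m. 1 \<le> m \<Longrightarrow> \<forall>y\<in>bounds quarter. reg s y \<le> m \<Longrightarrow>
      cost quarter s \<le> C1 * m ^ D1" by blast
  have "bounds (ceil_div rT rN) \<inter> written (ceil_div rT rN) = {}" by (simp add: ceil_div_def)
  from poly[OF this] obtain C2 D2 where 2: "\<And>s m. 1 \<le> m \<Longrightarrow> \<forall>y\<in>bounds (ceil_div rT rN). reg s y \<le> m \<Longrightarrow>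
      cost (ceil_div rT rN) s \<le> C2 * m ^ D2" by blast
  define c3 where "c3 = ceil_div rK rT"
  have "bounds c3 \<inter> written c3 = {}" by (simp add: c3_def ceil_div_def)
  from poly[OF this] obtain C3 D3 where 3: "\<And>s m. 1 \<le> m \<Longrightarrow> \<forall>y\<in>bounds c3. reg s y \<le> m \<Longrightarrow>
      cost c3 s \<le> C3 * m ^ D3" by blast
  have "bounds few_colors \<inter> written few_colors = {}" by (simp add: few_colors_def)
  from poly[OF this] obtain C4 D4 where 4: "\<And>s m. 1 \<le> m \<Longrightarrow> \<forall>y\<in>bounds few_colors. reg s y \<le> m \<Longrightarrow>
      cost few_colors s \<le> C4 * m ^ D4" by blast
  have "bounds prepare2 \<inter> written prepare2 = {}" by (simp add: prepare2_def tuples_def rows_def)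
  from poly[OF this] obtain C5 D5 where 5: "\<And>s m. 1 \<le> m \<Longrightarrow> \<forall>y\<in>bounds prepare2. reg s y \<le> m \<Longrightarrow>
      cost prepare2 s \<le> C5 * m ^ D5" by blast
  have "bounds main \<inter> written main = {}" using written_main by (auto simp: bounds_main)
  from poly[OF this] obtain C6 D6 where 6: "\<And>s m. 1 \<le> m \<Longrightarrow> \<forall>y\<in>bounds main. reg s y \<le> m \<Longrightarrow>
      cost main s \<le> C6 * m ^ D6" by blast
  define c7 where "c7 = For rX rTuples Skip"
  have "bounds c7 \<inter> written c7 = {}" by (simp add: c7_def)
  from poly[OF this] obtain C7 D7 where 7: "\<And>s m. 1 \<le> m \<Longrightarrow> \<forall>y\<in>bounds c7. reg s y \<le> m \<Longrightarrow>
      cost c7 s \<le> C7 * m ^ D7" by blast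
  let ?C = "C1 + (C2 + (C3 + (C4 + (C5 + (C6 + C7)))))" and ?D = "D1 + (D2 + (D3 + (D4 + (D5 + (D6 + D7)))))"
  have "\<exists>t s' k. exec (code 40 color_graph) s t s' \<and> proper_coloring {..<n} E q (arr s' 1) \<and> tuple_length n q k \<and>
        Suc n ^ k \<le> t \<and> t \<le> ?C * (Suc n ^ k + q + 2) ^ ?D"
    if n: "n \<ge> 1" and q: "q \<ge> 3" and E: "E \<in> three_colorable_graphs n" and s: "ready n q E s" for n q E s
  proof -
    have E: "simple_graph {..<n} E" "three_colorable {..<n} E" using E by (auto simp: three_colorable_graphs_def)
    let ?s1 = "sem quarter s"
    let ?s2 = "sem (ceil_div rT rN) ?s1"
    let ?s3' = "sem c3 ?s2"
    let ?s3 = "sem prepare1 ?s2"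
    let ?s4 = "sem prepare2 ?s3"
    let ?s5 = "sem main ?s4"
    obtain d T k where cfg: "config.cfg n q d T k E ?s4" and k: "tuple_length n q k"
      and dT: "1 \<le> d" "1 \<le> T" "T \<le> d * k" "d \<le> q"
      and qr: "\<And>r. r * T \<le> n \<Longrightarrow> 2 * r + 4 + d \<le> q \<or> d = 1 \<and> 2 * r + 3 \<le> q"
      and b: "reg ?s2 rT \<le> n" "reg ?s3 rK = k" "reg ?s3 rBase = Suc n" "reg ?s3 rN = n"
      by (rule sem_prepare[OF s n q E(1)]) blast
    interpret config n q d T k E by unfold_locales (use n E in auto)
    have "fine ?s5 {..<n}"
    proof (rule sem_main[OF cfg dT(2)])
      fix R r assume "R \<subseteq> {..<n}" "r * T + card R \<le> n"
      then show "\<exists>j<Suc n ^ k. good j R (1 + 2 * r)"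
        using exists_good[OF E(2) dT(3,1), of R r] qr[of r] by simp
    qed
    then have col: "proper_coloring {..<n} E q (arr ?s5 1)"
      by (auto simp: proper_coloring_def fine_def adj_def)
    have cg: "sem color_graph s = sem c7 ?s5"
      "cost color_graph s = cost quarter s + (cost (ceil_div rT rN) ?s1 + (cost c3 ?s2 + (cost few_colors ?s3' +
        (cost prepare2 ?s3 + (cost main ?s4 + cost c7 ?s5)))))"
      by (simp_all add: color_graph_def prepare1_def c7_def c3_def)
    have r4: "reg ?s4 rN = n" "reg ?s4 rBase = Suc n" "reg ?s4 rTuples = Suc n ^ k" "reg ?s4 rK = k" "reg ?s4 rD = d"
      using cfg by (simp_all add: cfg_reg)
    have r5: "reg ?s5 rTuples = Suc n ^ k"
      using r4 written_main by (subst sem_reg) auto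
    \<comment> \<open>A common bound for every register that limits a loop: \<open>n\<close>,
      \<open>n + 1\<close>, \<open>k\<close>, \<open>d\<close>, \<open>T\<close> and the number of
      tuples itself.\<close>
    let ?m = "Suc n ^ k + q + 2"
    have k1: "1 \<le> k" using k by (simp add: tuple_length_def)
    have nk: "Suc n \<le> Suc n ^ k" using k1 by (intro self_le_power) auto
    have "k < 2 ^ k" by simp
    also have "(2::nat) ^ k \<le> Suc n ^ k" using n by (intro power_mono) auto
    finally have kk: "k \<le> Suc n ^ k" by simp
    have m: "1 \<le> ?m" by simp
    have rs: "reg s rQ = q" "reg ?s1 rN = n" using s by (auto simp: ready_def sem_reg quarter_def)
    have "cost color_graph s \<le> ?C * ?m ^ ?D"
      unfolding cg
    proof (intro power_bound_add m)
      show "cost quarter s \<le> C1 * ?m ^ D1" by (rule 1[OF m]) (use rs in \<open>auto simp: quarter_def\<close>)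
      show "cost (ceil_div rT rN) ?s1 \<le> C2 * ?m ^ D2"
        by (rule 2[OF m]) (use rs nk in \<open>auto simp: ceil_div_def\<close>)
      show "cost c3 ?s2 \<le> C3 * ?m ^ D3"
        by (rule 3[OF m]) (use b nk in \<open>auto simp: ceil_div_def c3_def\<close>)
      show "cost few_colors ?s3' \<le> C4 * ?m ^ D4" by (rule 4[OF m]) (simp add: few_colors_def)
      show "cost prepare2 ?s3 \<le> C5 * ?m ^ D5"
        by (rule 5[OF m]) (use b nk kk in \<open>auto simp: prepare2_def tuples_def rows_def\<close>)
      show "cost main ?s4 \<le> C6 * ?m ^ D6"
        by (rule 6[OF m]) (use r4 nk kk dT in \<open>auto simp: bounds_main\<close>)
      show "cost c7 ?s5 \<le> C7 * ?m ^ D7" by (rule 7[OF m]) (use r5 in \<open>auto simp: c7_def\<close>)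
    qed
    moreover have "Suc n ^ k \<le> cost color_graph s"
    proof -
      have "Suc n ^ k \<le> cost c7 ?s5" using cost_For_ge[of ?s5 rTuples rX Skip] r5 by (simp add: c7_def)
      then show ?thesis unfolding cg by linarith
    qed
    moreover obtain s' where s': "exec (code 40 color_graph) s (cost color_graph s) s'" "agree 40 (sem color_graph s) s'"
      using exec_code[OF wf_color_graph agree_refl] by blast
    moreover have "arr s' 1 = arr ?s5 1"
      using s'(2) cg(1) by (simp add: agree_def c7_def sem_arr)
    ultimately show ?thesis using col k by metis
  qed
  then show ?thesis by blast
qed

section \<open>Computing the number of colors first\<close>

primrec confined :: "nat \<Rightarrow> program \<Rightarrow> bool" where
  "confined b (Const x k) \<longleftrightarrow> x < b"
| "confined b (Add x y z) \<longleftrightarrow> x < b \<and> y < b \<and> z < b"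
| "confined b (Sub x y z) \<longleftrightarrow> x < b \<and> y < b \<and> z < b"
| "confined b (Load x a y) \<longleftrightarrow> x < b \<and> a < b \<and> y < b"
| "confined b (Store a y x) \<longleftrightarrow> a < b \<and> y < b \<and> x < b"
| "confined b (Seq p p') \<longleftrightarrow> confined b p \<and> confined b p'"
| "confined b (Cond x p p') \<longleftrightarrow> x < b \<and> confined b p \<and> confined b p'"
| "confined b (While x p) \<longleftrightarrow> x < b \<and> confined b p"

lemma confined_mono: "confined b p \<Longrightarrow> b \<le> b' \<Longrightarrow> confined b' p"
  by (induction p) auto

lemma exists_confined: "\<exists>b. confined b p"
proof (induction p)
  case (Seq p p')
  then obtain b b' where "confined b p" "confined b' p'" by auto
  then have "confined (max b b') (Seq p p')" by (auto intro: confined_mono)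
  then show ?case ..
next
  case (Cond x p p')
  then obtain b b' where "confined b p" "confined b' p'" by auto
  then have "confined (max (Suc x) (max b b')) (Cond x p p')" by (auto intro: confined_mono)
  then show ?case ..
next
  case (While x p)
  then obtain b where "confined b p" by auto
  then have "confined (max (Suc x) b) (While x p)" by (auto intro: confined_mono)
  then show ?case ..
next
  case (Const x k)
  show ?case by (rule exI[of _ "Suc x"]) simp
next
  case (Add x y z)
  show ?case by (rule exI[of _ "Suc (x + y + z)"]) simp
next
  case (Sub x y z)
  show ?case by (rule exI[of _ "Suc (x + y + z)"]) simp
next
  case (Load x y z)
  show ?case by (rule exI[of _ "Suc (x + y + z)"]) simp
next
  case (Store x y z)
  show ?case by (rule exI[of _ "Suc (x + y + z)"]) simp
qed

definition same_below :: "nat \<Rightarrow> state \<Rightarrow> state \<Rightarrow> bool" where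
  "same_below b s u \<longleftrightarrow> (\<forall>r<b. reg u r = reg s r) \<and> (\<forall>a<b. arr u a = arr s a)"

definition same_above :: "nat \<Rightarrow> state \<Rightarrow> state \<Rightarrow> bool" where
  "same_above b s u \<longleftrightarrow> (\<forall>r\<ge>b. reg u r = reg s r) \<and> (\<forall>a\<ge>b. arr u a = arr s a)"

text \<open>Frame property: with only finitely many registers and arrays mentioned, a run is
  repeated step by step in every state that looks the same below \<open>b\<close>, and nothing from
  \<open>b\<close> on is touched.\<close>

lemma exec_local:
  "exec p s t s' \<Longrightarrow> confined b p \<Longrightarrow> same_below b s u \<Longrightarrow>
     \<exists>u'. exec p u t u' \<and> same_below b s' u' \<and> same_above b u u'"
proof (induction arbitrary: u rule: exec.induct)
  case (Const x k s)
  then show ?case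
    by (intro exI[of _ "set_reg x k u"] conjI exec_ConstI) (auto simp: same_below_def same_above_def)
next
  case (Add x y z s)
  then show ?case
    by (intro exI[of _ "set_reg x (reg u y + reg u z) u"] conjI exec_AddI) (auto simp: same_below_def same_above_def)
next
  case (Sub x y z s)
  then show ?case
    by (intro exI[of _ "set_reg x (reg u y - reg u z) u"] conjI exec_SubI) (auto simp: same_below_def same_above_def)
next
  case (Load x a y s)
  then show ?case
    by (intro exI[of _ "set_reg x (arr u a (reg u y)) u"] conjI exec_LoadI) (auto simp: same_below_def same_above_def)
next
  case (Store a y x s)
  then show ?case
    by (intro exI[of _ "set_arr a (reg u y) (reg u x) u"] conjI exec_StoreI) (auto simp: same_below_def same_above_def)
next
  case (Seq p s t s' p' t' s'')
  from Seq.IH(1)[of u] Seq.prems obtain u1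
    where u1: "exec p u t u1" "same_below b s' u1" "same_above b u u1" by auto
  from Seq.IH(2)[of u1] Seq.prems u1 obtain u2
    where u2: "exec p' u1 t' u2" "same_below b s'' u2" "same_above b u1 u2" by auto
  have "same_above b u u2" using u1(3) u2(3) by (simp add: same_above_def)
  then show ?case using exec.Seq[OF u1(1) u2(1)] u2(2) by blast
next
  case (CondPos s x p t s' p')
  from CondPos.IH[of u] CondPos.prems obtain u1
    where u1: "exec p u t u1" "same_below b s' u1" "same_above b u u1" by auto
  have "reg u x > 0" using CondPos by (simp add: same_below_def)
  then show ?case using exec.CondPos[OF _ u1(1)] u1(2,3) by blast
next
  case (CondZero s x p' t s' p)
  from CondZero.IH[of u] CondZero.prems obtain u1
    where u1: "exec p' u t u1" "same_below b s' u1" "same_above b u u1" by auto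
  have "reg u x = 0" using CondZero by (simp add: same_below_def)
  then show ?case using exec.CondZero[OF _ u1(1)] u1(2,3) by blast
next
  case (WhileZero s x p)
  then have "reg u x = 0" by (simp add: same_below_def)
  then have "exec (While x p) u 1 u" by (rule exec.WhileZero)
  moreover have "same_above b u u" by (simp add: same_above_def)
  ultimately show ?case using WhileZero.prems by blast
next
  case (WhilePos s x p t s' t' s'')
  from WhilePos.IH(1)[of u] WhilePos.prems obtain u1
    where u1: "exec p u t u1" "same_below b s' u1" "same_above b u u1" by auto
  from WhilePos.IH(2)[of u1] WhilePos.prems u1 obtain u2
    where u2: "exec (While x p) u1 t' u2" "same_below b s'' u2" "same_above b u1 u2" by auto
  have "same_above b u u2" using u1(3) u2(3) by (simp add: same_above_def)
  moreover have "reg u x > 0" using WhilePos by (simp add: same_below_def)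
  ultimately show ?case using exec.WhilePos[OF _ u1(1) u2(1)] u2(2) by blast
qed

text \<open>
  A program that uses only registers and arrays below \<open>b\<close> can be run in between: \<open>save\<close> moves the input
  to registers and arrays from \<open>b\<close> on and leaves zeros behind, and \<open>restore\<close> moves it back.
\<close>

definition square :: "nat \<Rightarrow> cmd" where
  "square b = Asg b (Var rN) ;; Asg (b + 1) (Num 0) ;;
     For (b + 2) rN (Asg (b + 1) (Plus (Var (b + 1)) (Var rN)))"

definition save :: "nat \<Rightarrow> cmd" where
  "save b = For (b + 2) (b + 1) (Sto b (Var (b + 2)) (Elem aAdj (Var (b + 2))) ;; Sto aAdj (Var (b + 2)) (Num 0))"

definition restore :: "nat \<Rightarrow> cmd" where
  "restore b = Asg rN (Var b) ;; For (b + 2) (b + 1) (Sto aAdj (Var (b + 2)) (Elem b (Var (b + 2))))"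

lemma sem_square: "2 \<le> b \<Longrightarrow> reg (sem (square b) s) (b + 1) = reg s rN * reg s rN"
proof -
  assume b: "2 \<le> b"
  let ?body = "Asg (b + 1) (Plus (Var (b + 1)) (Var rN))"
  let ?I = "\<lambda>i t. reg t (b + 1) + i * reg s rN = reg s rN * reg s rN"
  have "?I 0 (sem (For (b + 2) rN ?body) (set_reg (b + 1) 0 (set_reg b (reg s rN) s)))"
    by (rule For_inv[of ?I]) (use b in \<open>auto simp: same_but_def\<close>)
  then show ?thesis by (simp add: square_def)
qed

text \<open>The program run in between may read the adjacency array anywhere, so it must be zero
  everywhere. The loop clears the first \<open>n * n\<close> entries; the assumption covers the
  rest.\<close>

lemma sem_save:
  assumes b: "2 \<le> b" and z: "\<And>i. reg s (b + 1) \<le> i \<Longrightarrow> arr s aAdj i = 0"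
  shows "arr (sem (save b) s) aAdj i = 0" "i < reg s (b + 1) \<Longrightarrow> arr (sem (save b) s) b i = arr s aAdj i"
proof -
  let ?body = "Sto b (Var (b + 2)) (Elem aAdj (Var (b + 2))) ;; Sto aAdj (Var (b + 2)) (Num 0)"
  let ?I = "\<lambda>i t. \<forall>x. arr t aAdj x = (if x < i then arr s aAdj x else 0) \<and>
    (x < reg s (b + 1) \<longrightarrow> i \<le> x \<longrightarrow> arr t b x = arr s aAdj x)"
  have "arr s aAdj x = 0" if "\<not> x < reg s (b + 1)" for x using z that by simp
  then have "?I 0 (sem (save b) s)"
    unfolding save_def
    by (intro For_inv[of ?I]) (use b in \<open>auto simp: le_eq_less_or_eq\<close>)
  then show "arr (sem (save b) s) aAdj i = 0" "i < reg s (b + 1) \<Longrightarrow> arr (sem (save b) s) b i = arr s aAdj i"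
    by auto
qed

lemma sem_restore:
  assumes b: "2 \<le> b" and i: "i < reg s (b + 1)"
  shows "arr (sem (restore b) s) aAdj i = arr s b i"
proof -
  let ?body = "Sto aAdj (Var (b + 2)) (Elem b (Var (b + 2)))"
  let ?I = "\<lambda>i t. \<forall>x<reg s (b + 1). i \<le> x \<longrightarrow> arr t aAdj x = arr s b x"
  have "?I 0 (sem (For (b + 2) (b + 1) ?body) (set_reg rN (reg s b) s))"
    by (rule For_inv[of ?I]) (use b in \<open>auto simp: same_but_def le_eq_less_or_eq\<close>)
  then show ?thesis using i by (simp add: restore_def)
qed

lemma index_less: "u < n \<Longrightarrow> w < n \<Longrightarrow> u * n + w < n * n" for n :: nat
proof -
  assume "u < n" "w < n"
  then have "u * n + w < Suc u * n" by simp
  also have "\<dots> \<le> n * n" using \<open>u < n\<close> by (intro mult_le_mono1) simp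
  finally show ?thesis .
qed

lemma ready_input: "ready n a E (input n a E)"
  by (auto simp: ready_def input_def index_less)

text \<open>The given program is known to work on the input with the empty graph only. After saving,
  the memory below \<open>b\<close> looks exactly like that input, and the hidden data outlive the
  run because they lie from \<open>b\<close> on.\<close>

lemma compute_first:
  "\<exists>p C D. \<forall>n\<ge>1. \<forall>E q t s. exec r (input n 0 {}) t s \<longrightarrow> reg s 1 = q \<longrightarrow>
     (\<exists>t' u. exec p (input n 0 E) t' u \<and> ready n q E u \<and> t' \<le> t + C * (n * n + n + 1) ^ D)"
proof -
  obtain b0 where "confined b0 r" using exists_confined by blast
  define b where "b = b0 + 2"
  have b: "2 \<le> b" "confined b r" using confined_mono[OF \<open>confined b0 r\<close>] by (auto simp: b_def)
  have "bounds (square b) \<inter> written (square b) = {}" using b by (auto simp: square_def)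
  from cost_poly[OF this] obtain C1 D1 where 1: "\<And>s m. 1 \<le> m \<Longrightarrow> \<forall>y\<in>bounds (square b). reg s y \<le> m \<Longrightarrow>
      cost (square b) s \<le> C1 * m ^ D1" by blast
  have "bounds (save b) \<inter> written (save b) = {}" using b by (auto simp: save_def)
  from cost_poly[OF this] obtain C2 D2 where 2: "\<And>s m. 1 \<le> m \<Longrightarrow> \<forall>y\<in>bounds (save b). reg s y \<le> m \<Longrightarrow>
      cost (save b) s \<le> C2 * m ^ D2" by blast
  have "bounds (restore b) \<inter> written (restore b) = {}" using b by (auto simp: restore_def)
  from cost_poly[OF this] obtain C3 D3 where 3: "\<And>s m. 1 \<le> m \<Longrightarrow> \<forall>y\<in>bounds (restore b). reg s y \<le> m \<Longrightarrow>
      cost (restore b) s \<le> C3 * m ^ D3" by blast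
  \<comment> \<open>Registers \<open>b\<close>, \<open>b + 1\<close> and \<open>b + 2\<close> hold
    \<open>n\<close>, \<open>n * n\<close> and the loop counter, so scratch starts at
    \<open>b + 3\<close>.\<close>
  have wf: "wf_cmd (b + 3) (square b)" "wf_cmd (b + 3) (save b)" "wf_cmd (b + 3) (restore b)"
    using b by (auto simp: square_def save_def restore_def)
  let ?p = "Seq (code (b + 3) (square b)) (Seq (code (b + 3) (save b)) (Seq r (code (b + 3) (restore b))))"
  let ?C = "C1 + (C2 + C3)" and ?D = "D1 + (D2 + D3)"
  have "\<exists>t' u. exec ?p (input n 0 E) t' u \<and> ready n q E u \<and> t' \<le> t + ?C * (n * n + n + 1) ^ ?D"
    if n: "n \<ge> 1" and r: "exec r (input n 0 {}) t s" "reg s 1 = q" for n E q t s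
  proof -
    let ?i = "input n 0 E"
    let ?m = "n * n + n + 1"
    have i: "reg ?i = (\<lambda>_. 0)(0 := n, 1 := 0)"
      "arr ?i = (\<lambda>_ _. 0)(0 := (\<lambda>i. if i < n * n \<and> {i div n, i mod n} \<in> E then 1 else 0))"
      by (simp_all add: input_def)
    define s1 where "s1 = sem (square b) ?i"
    have s1: "reg s1 b = n" "reg s1 (b + 1) = n * n" "\<And>x. x < b \<Longrightarrow> reg s1 x = reg ?i x" "arr s1 = arr ?i"
    proof -
      show "reg s1 (b + 1) = n * n" using sem_square[OF b(1), of ?i] i by (simp add: s1_def)
      show "reg s1 b = n" using b i by (simp add: s1_def square_def sem_reg)
      show "reg s1 x = reg ?i x" if "x < b" for x using that by (simp add: s1_def square_def sem_reg)
      show "arr s1 = arr ?i" by (auto simp: s1_def square_def sem_arr)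
    qed
    obtain u1 where u1: "exec (code (b + 3) (square b)) ?i (cost (square b) ?i) u1" "agree (b + 3) s1 u1"
      using exec_code[OF wf(1) agree_refl] s1_def by blast
    define s2 where "s2 = sem (save b) s1"
    obtain u2 where u2: "exec (code (b + 3) (save b)) u1 (cost (save b) s1) u2" "agree (b + 3) s2 u2"
      using exec_code[OF wf(2) u1(2)] s2_def by blast
    have z: "arr s1 aAdj i = 0" if "reg s1 (b + 1) \<le> i" for i using that s1 i by simp
    have s2: "reg s2 x = reg s1 x" if "x \<noteq> b + 2" for x using that by (simp add: s2_def sem_reg save_def)
    have s2a: "arr s2 aAdj i = 0" "i < n * n \<Longrightarrow> arr s2 b i = arr ?i aAdj i"
      "a \<noteq> aAdj \<Longrightarrow> a \<noteq> b \<Longrightarrow> arr s2 a i = 0" for a i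
      using sem_save[OF b(1) z] s1 i by (auto simp: s2_def sem_arr save_def)
    have u2r: "reg u2 x = reg s1 x" if "x < b + 2" for x using u2(2) s2 that by (auto simp: agree_def)
    have u2a: "arr u2 = arr s2" using u2(2) by (simp add: agree_def)
    \<comment> \<open>The point of \<open>save\<close>: below \<open>b\<close> the graph has become
      invisible.\<close>
    have "same_below b (input n 0 {}) u2"
      unfolding same_below_def
    proof (intro conjI allI impI ext)
      fix x assume "x < b"
      then show "reg u2 x = reg (input n 0 {}) x" using u2r[of x] s1 by (simp add: input_def)
    next
      fix a i assume "a < b"
      then show "arr u2 a i = arr (input n 0 {}) a i" using s2a u2a by (cases "a = 0") (auto simp: input_def)
    qed
    from exec_local[OF r(1) b(2) this] obtain u3
      where u3: "exec r u2 t u3" "same_below b s u3" "same_above b u2 u3" by blast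
    have u3r: "reg u3 1 = q" "reg u3 b = n" "reg u3 (b + 1) = n * n" "arr u3 b = arr s2 b"
      using u3(2,3) r(2) b u2r[of b] u2r[of "b + 1"] s1 u2a by (auto simp: same_below_def same_above_def)
    define s4 where "s4 = sem (restore b) u3"
    obtain u4 where u4: "exec (code (b + 3) (restore b)) u3 (cost (restore b) u3) u4" "agree (b + 3) s4 u4"
      using exec_code[OF wf(3) agree_refl] s4_def by blast
    have "reg s4 rN = n" "reg s4 rQ = q" using b u3r by (simp_all add: s4_def restore_def sem_reg)
    moreover have "arr s4 aAdj j = arr ?i aAdj j" if "j < n * n" for j
      using sem_restore[OF b(1), of j u3] that u3r s2a by (simp add: s4_def)
    then have "\<forall>u<n. \<forall>w<n. arr s4 aAdj (u * n + w) = (if {u, w} \<in> E then 1 else 0)"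
      using i by (auto simp: index_less)
    ultimately have ready: "ready n q E u4" using u4(2) b by (simp add: ready_def agree_def)
    have m: "1 \<le> ?m" by simp
    have "cost (square b) ?i + (cost (save b) s1 + cost (restore b) u3) \<le> ?C * ?m ^ ?D"
    proof (intro power_bound_add m)
      show "cost (square b) ?i \<le> C1 * ?m ^ D1" by (rule 1[OF m]) (use i in \<open>simp add: square_def\<close>)
      show "cost (save b) s1 \<le> C2 * ?m ^ D2" by (rule 2[OF m]) (use s1 in \<open>simp add: save_def\<close>)
      show "cost (restore b) u3 \<le> C3 * ?m ^ D3" by (rule 3[OF m]) (use u3r in \<open>simp add: restore_def\<close>)
    qed
    moreover have "exec ?p ?i (cost (square b) ?i + (cost (save b) s1 + (t + cost (restore b) u3))) u4"
      by (rule exec.Seq[OF u1(1) exec.Seq[OF u2(1) exec.Seq[OF u3(1) u4(1)]]])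
    ultimately show ?thesis using ready by (intro exI[of _ u4] exI conjI) (assumption, assumption, linarith)
  qed
  then show ?thesis by blast
qed

section \<open>Growth of the running time\<close>

locale growth =
  fixes \<epsilon> :: real and q :: "nat \<Rightarrow> nat"
  assumes eps: "0 < \<epsilon>" "\<epsilon> < 1 / 2"
    and q_ge: "\<And>n. 1 \<le> n \<Longrightarrow> 3 \<le> q n"
    and q_theta: "(\<lambda>n. real (q n)) \<in> \<Theta>(\<lambda>n. real n powr \<epsilon>)"
begin

definition f :: "nat \<Rightarrow> real" where
  "f n = real n powr (1 - 2 * \<epsilon>) * ln (real n)"

lemma ln_ge_1: "3 \<le> n \<Longrightarrow> 1 \<le> ln (real n)"
proof -
  assume n: "3 \<le> n"
  have "exp 1 \<le> (3::real)" by (rule exp_le)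
  also have "\<dots> \<le> real n" using n by simp
  finally show ?thesis using n by (subst ln_ge_iff) auto
qed

lemma powr_ge_1: "1 \<le> n \<Longrightarrow> 1 \<le> real n powr (1 - 2 * \<epsilon>)"
  using eps by (intro ge_one_powr_ge_zero) auto

lemma f_ge: "3 \<le> n \<Longrightarrow> ln (real n) \<le> f n" "3 \<le> n \<Longrightarrow> 1 \<le> f n"
proof -
  assume n: "3 \<le> n"
  show "ln (real n) \<le> f n"
    using mult_right_mono[OF powr_ge_1[of n], of "ln (real n)"] ln_ge_1[OF n] n by (simp add: f_def)
  then show "1 \<le> f n" using ln_ge_1[OF n] by linarith
qed

text \<open>Beyond \<open>(16 / A) powr (1 / \<epsilon>)\<close> the lower bound on
  \<open>q n\<close> reaches 16, which rules out the special parameters for few colors.\<close>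

lemma q_bounds:
  obtains A B where "0 < A" "1 \<le> B"
    "eventually (\<lambda>n. A * real n powr \<epsilon> \<le> q n \<and> q n \<le> B * real n powr \<epsilon> \<and> 16 \<le> q n \<and> 3 \<le> n) at_top"
proof -
  from bigthetaD1[OF q_theta] obtain B where B: "B > 0"
    "eventually (\<lambda>n. norm (real (q n)) \<le> B * norm (real n powr \<epsilon>)) at_top" by (elim landau_o.bigE)
  from bigthetaD2[OF q_theta] obtain A where A: "A > 0"
    "eventually (\<lambda>n. norm (real (q n)) \<ge> A * norm (real n powr \<epsilon>)) at_top" by (elim landau_omega.bigE)
  let ?M = "(16 / A) powr (1 / \<epsilon>)"
  have "eventually (\<lambda>n. 3 \<le> n \<and> nat \<lceil>?M\<rceil> \<le> n) at_top"
    by (intro eventually_conj eventually_ge_at_top)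
  with A(2) B(2) have "eventually (\<lambda>n. A * real n powr \<epsilon> \<le> q n \<and> q n \<le> max 1 B * real n powr \<epsilon> \<and>
      16 \<le> q n \<and> 3 \<le> n) at_top"
  proof eventually_elim
    case (elim n)
    then have n: "?M \<le> real n" "3 \<le> n" by linarith+
    have "16 / A = ?M powr \<epsilon>" using A(1) eps by (simp add: powr_powr)
    also have "\<dots> \<le> real n powr \<epsilon>" using n eps by (intro powr_mono2) auto
    finally have "16 \<le> A * real n powr \<epsilon>" using A(1) by (simp add: field_simps)
    then have "16 \<le> real (q n)" using elim by simp
    moreover have "q n \<le> B * real n powr \<epsilon>" using elim by simp
    then have "q n \<le> max 1 B * real n powr \<epsilon>" by (rule order_trans) (intro mult_right_mono, auto)
    ultimately show ?case using elim n by auto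
  qed
  then show thesis using A(1) by (intro that[of A "max 1 B"]) auto
qed

lemma exp_power: "exp x ^ n = exp (real n * x)" for x :: real
  by (simp add: exp_of_nat_mult)

lemma le_exp_self: "x \<le> exp x" for x :: real
  using exp_ge_add_one_self[of x] by linarith

text \<open>Squaring the bounds on \<open>q n\<close> places \<open>k\<close> between constant
  multiples of \<open>n powr (1 - 2 * \<epsilon>)\<close>. Then
  \<open>n ^ k = exp (k * ln n)\<close> has an exponent of order \<open>f n\<close>, and the
  polynomial overhead changes only the constant.\<close>

lemma time_bounds:
  fixes C D :: nat
  obtains c1 c2 where "0 < c1" "0 < c2"
    "eventually (\<lambda>n. \<forall>k t. tuple_length n (q n) k \<longrightarrow> Suc n ^ k \<le> t \<longrightarrow> t \<le> C * (Suc n ^ k + q n + 2) ^ D \<longrightarrow>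
        2 powr (c1 * f n) \<le> real t \<and> real t \<le> exp (c2 * f n)) at_top"
proof -
  obtain A B where A: "0 < A" and B: "1 \<le> B" and ev:
    "eventually (\<lambda>n. A * real n powr \<epsilon> \<le> q n \<and> q n \<le> B * real n powr \<epsilon> \<and> 16 \<le> q n \<and> 3 \<le> n) at_top"
    by (rule q_bounds)
  \<comment> \<open>From \<open>(k - 1) * q ^ 2 \<le> 64 * (n + q)\<close>, with
    \<open>q n \<le> B * n\<close> on the right and the lower bound \<open>A\<close> for
    \<open>q n\<close> on the left.\<close>
  define K where "K = 64 * (1 + B) / A\<^sup>2"
  have K: "0 < K" using A B by (simp add: K_def)
  \<comment> \<open>Collects \<open>C\<close>, then the factor \<open>B + 3\<close> raised to the
    power \<open>D\<close>, and finally \<open>2 * D\<close> times the bound \<open>K + 1\<close>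
    for the exponent; \<open>1 \<le> f n\<close> absorbs the constants.\<close>
  define c2 where "c2 = 1 + real C + real D * (B + 3) + 2 * real D * (K + 1)"
  have c2: "0 < c2" using K B by (simp add: c2_def add_pos_nonneg)
  have "eventually (\<lambda>n. \<forall>k t. tuple_length n (q n) k \<longrightarrow> Suc n ^ k \<le> t \<longrightarrow> t \<le> C * (Suc n ^ k + q n + 2) ^ D \<longrightarrow>
        2 powr (1 / B\<^sup>2 * f n) \<le> real t \<and> real t \<le> exp (c2 * f n)) at_top"
    using ev
  proof eventually_elim
    case (elim n)
    then have n: "3 \<le> n" and q1: "A * real n powr \<epsilon> \<le> q n" and q2: "q n \<le> B * real n powr \<epsilon>" and q16: "16 \<le> q n"
      by auto
    let ?x = "real n powr (1 - 2 * \<epsilon>)" and ?y = "real n powr (2 * \<epsilon>)" and ?L = "ln (real n)"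
    have x: "1 \<le> ?x" using powr_ge_1 n by simp
    have L: "1 \<le> ?L" using ln_ge_1[OF n] .
    have y: "0 < ?y" using n by simp
    have xy: "real n = ?x * ?y" using n by (simp add: powr_add[symmetric])
    have y2: "(real n powr \<epsilon>)\<^sup>2 = ?y" using n by (simp add: power2_eq_square powr_add[symmetric])
    have qy1: "A\<^sup>2 * ?y \<le> (real (q n))\<^sup>2"
      using power_mono[OF q1, of 2] A by (simp add: power_mult_distrib y2)
    have qy2: "(real (q n))\<^sup>2 \<le> B\<^sup>2 * ?y"
      using power_mono[OF q2, of 2] by (simp add: power_mult_distrib y2)
    have "real n powr \<epsilon> \<le> real n powr 1" using n eps by (intro powr_mono) auto
    then have qn: "real (q n) \<le> B * real n" using q2 B n
      by (smt (verit) mult_left_mono powr_one of_nat_0_le_iff)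
    show ?case
    proof (intro allI impI)
      fix k t
      assume k: "tuple_length n (q n) k" and t: "Suc n ^ k \<le> t" "t \<le> C * (Suc n ^ k + q n + 2) ^ D"
      have k1: "1 \<le> k" and ka: "n \<le> k * q n ^ 2" and kb: "(k - 1) * q n ^ 2 \<le> 64 * (n + q n)"
        using k q16 by (auto simp: tuple_length_def)
      have "real n \<le> real k * (real (q n))\<^sup>2" using ka by (metis of_nat_le_iff of_nat_mult of_nat_power)
      also have "\<dots> \<le> real k * (B\<^sup>2 * ?y)" using qy2 by (intro mult_left_mono) auto
      finally have "?x * ?y \<le> real k * B\<^sup>2 * ?y" using xy by (simp add: mult.assoc)
      then have "?x \<le> real k * B\<^sup>2" using y by simp
      then have klow: "1 / B\<^sup>2 * ?x \<le> real k" using B by (simp add: field_simps)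
      have "real (k - 1) * (A\<^sup>2 * ?y) \<le> real (k - 1) * (real (q n))\<^sup>2" using qy1 by (intro mult_left_mono) auto
      also have "\<dots> \<le> 64 * (real n + real (q n))" using kb
        by (metis of_nat_add of_nat_le_iff of_nat_mult of_nat_numeral of_nat_power)
      also have "\<dots> \<le> 64 * ((1 + B) * real n)" using qn by (simp add: algebra_simps)
      also have "\<dots> = 64 * (1 + B) * (?x * ?y)" by (simp only: xy[symmetric] mult.assoc)
      finally have "real (k - 1) * A\<^sup>2 * ?y \<le> 64 * (1 + B) * ?x * ?y" by (simp only: mult.assoc)
      then have "real (k - 1) * A\<^sup>2 \<le> 64 * (1 + B) * ?x" using y by simp
      then have "real (k - 1) \<le> K * ?x" using A by (simp add: K_def field_simps)
      then have "real k \<le> K * ?x + 1" using k1 by linarith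
      also have "\<dots> \<le> (K + 1) * ?x" using x by (simp add: algebra_simps)
      finally have kup: "real k \<le> (K + 1) * ?x" .
      have fL: "f n = ?x * ?L" by (simp add: f_def)
      have nk: "real n ^ k = exp (real k * ?L)" using n by (simp add: exp_power[symmetric])
      have "1 / B\<^sup>2 * f n * ln 2 \<le> 1 / B\<^sup>2 * f n * 1"
        using f_ge(2)[OF n] ln_2_less_1 B by (intro mult_left_mono) auto
      also have "\<dots> = (1 / B\<^sup>2 * ?x) * ?L" by (simp add: fL)
      also have "\<dots> \<le> real k * ?L" using klow L by (intro mult_right_mono) auto
      finally have "2 powr (1 / B\<^sup>2 * f n) \<le> real n ^ k" by (simp add: powr_def nk)
      also have "\<dots> \<le> real (Suc n ^ k)" by (simp add: power_mono)
      also have "\<dots> \<le> real t" using t(1) by (rule of_nat_mono)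
      finally have lower: "2 powr (1 / B\<^sup>2 * f n) \<le> real t" .
      let ?N = "real (Suc n ^ k)"
      have "Suc n \<le> Suc n ^ k" using k1 by (intro self_le_power) auto
      then have nN: "real n \<le> ?N" and N1: "1 \<le> ?N" by (metis Suc_leD of_nat_le_iff, simp)
      \<comment> \<open>Replacing \<open>n + 1\<close> by \<open>n ^ 2\<close> merely doubles the
        exponent.\<close>
      have "Suc n \<le> n * n" using n by (cases n) auto
      then have "real (Suc n) \<le> real n * real n" by (metis of_nat_le_iff of_nat_mult)
      then have "?N \<le> (real n * real n) ^ k" by (simp add: power_mono)
      also have "\<dots> = exp (2 * (real k * ?L))"
        by (simp add: power_mult_distrib nk exp_add[symmetric])
      finally have Ne: "?N \<le> exp (2 * (real k * ?L))" .
      have "B * real n \<le> B * ?N" using nN B by (intro mult_left_mono) auto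
      moreover have "real (Suc n ^ k + q n + 2) = ?N + real (q n) + 2" by (simp only: of_nat_add of_nat_numeral)
      ultimately have "real (Suc n ^ k + q n + 2) \<le> ?N + B * ?N + 2 * ?N" using qn N1 by linarith
      also have "\<dots> = (B + 3) * ?N" by (simp add: algebra_simps)
      also have "\<dots> \<le> exp (B + 3) * exp (2 * (real k * ?L))"
        using le_exp_self[of "B + 3"] Ne B by (intro mult_mono) auto
      finally have base: "real (Suc n ^ k + q n + 2) \<le> exp (B + 3 + 2 * (real k * ?L))" by (simp add: exp_add)
      have "real t \<le> real (C * (Suc n ^ k + q n + 2) ^ D)" using t(2) by (rule of_nat_mono)
      also have "\<dots> = real C * real (Suc n ^ k + q n + 2) ^ D" by (simp only: of_nat_mult of_nat_power)
      also have "\<dots> \<le> exp (real C) * exp (B + 3 + 2 * (real k * ?L)) ^ D"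
        using le_exp_self[of "real C"] base by (intro mult_mono power_mono) auto
      also have "\<dots> = exp (real C + real D * (B + 3) + 2 * real D * (real k * ?L))"
        by (simp add: exp_power exp_add[symmetric] algebra_simps)
      also have "\<dots> \<le> exp (c2 * f n)"
      proof -
        have "real k * ?L \<le> (K + 1) * ?x * ?L" using kup L by (intro mult_right_mono) auto
        also have "\<dots> = (K + 1) * f n" by (simp add: fL)
        finally have "2 * real D * (real k * ?L) \<le> 2 * real D * ((K + 1) * f n)" by (intro mult_left_mono) auto
        moreover have "(real C + real D * (B + 3)) * 1 \<le> (1 + real C + real D * (B + 3)) * f n"
          using f_ge(2)[OF n] B by (intro mult_mono) auto
        ultimately show ?thesis by (simp add: c2_def algebra_simps)
      qed
      finally show "2 powr (1 / B\<^sup>2 * f n) \<le> real t \<and> real t \<le> exp (c2 * f n)" using lower by blast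
    qed
  qed
  moreover have "0 < 1 / B\<^sup>2" using B by simp
  ultimately show thesis using c2 that by blast
qed

text \<open>The maximum over the finitely many inputs, of which the empty graph is one, is attained
  by some graph. Hence any property of all running times passes to it, without monotonicity.\<close>

lemma worst_case:
  assumes run: "\<And>n E. 1 \<le> n \<Longrightarrow> E \<in> three_colorable_graphs n \<Longrightarrow>
      \<exists>t s. exec p (input n (a n) E) t s \<and> P n t \<and> 1 \<le> t"
    and n: "1 \<le> n"
  shows "P n (worst_case_time p a n) \<and> 1 \<le> worst_case_time p a n"
proof -
  let ?T = "(\<lambda>E. running_time p (input n (a n) E)) ` three_colorable_graphs n"
  have "three_colorable_graphs n \<subseteq> Pow (Pow {..<n})"
    by (auto simp: three_colorable_graphs_def simple_graph_def)
  then have fin: "finite (three_colorable_graphs n)" by (rule finite_subset) simp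
  have "{} \<in> three_colorable_graphs n"
    by (auto simp: three_colorable_graphs_def simple_graph_def three_colorable_def proper_coloring_def intro!: exI[of _ "\<lambda>_. 1"])
  then have "Max ?T \<in> ?T" using fin by (intro Max_in) auto
  then obtain E where E: "E \<in> three_colorable_graphs n" "worst_case_time p a n = running_time p (input n (a n) E)"
    by (auto simp: worst_case_time_def)
  from run[OF n E(1)] obtain t s where "exec p (input n (a n) E) t s" "P n t" "1 \<le> t" by blast
  then show ?thesis using E(2) running_time_eq by metis
qed

text \<open>\<open>g\<close> is the binary logarithm of the worst-case time. The equation holds for
  all \<open>n \<ge> 1\<close> because the time is at least 1, while the estimates are needed only
  eventually.\<close>

lemma worst_case_theta:
  assumes run: "\<And>n E. 1 \<le> n \<Longrightarrow> E \<in> three_colorable_graphs n \<Longrightarrow>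
      \<exists>t s. exec p (input n (a n) E) t s \<and> P n t \<and> 1 \<le> t"
    and ev: "eventually (\<lambda>n. \<forall>t. P n t \<longrightarrow> 2 powr (c1 * f n) \<le> real t \<and> real t \<le> exp (c2 * f n)) at_top"
    and c: "0 < c1" "0 < c2"
  shows "\<exists>g\<in>\<Theta>(\<lambda>n. real n powr (1 - 2 * \<epsilon>) * ln (real n)). \<forall>n\<ge>1. real (worst_case_time p a n) = 2 powr g n"
proof -
  let ?w = "\<lambda>n. real (worst_case_time p a n)"
  let ?g = "\<lambda>n. log 2 (?w n)"
  have w: "P n (worst_case_time p a n)" "1 \<le> ?w n" if "1 \<le> n" for n
    using worst_case[OF run that] by auto
  have "eventually (\<lambda>n. c1 * norm (f n) \<le> norm (?g n) \<and> norm (?g n) \<le> c2 / ln 2 * norm (f n)) at_top"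
    using ev eventually_ge_at_top[of 3]
  proof eventually_elim
    case (elim n)
    then have b: "2 powr (c1 * f n) \<le> ?w n" "?w n \<le> exp (c2 * f n)" and w1: "1 \<le> ?w n" using w[of n] by auto
    have "c1 * f n \<le> ?g n" using b(1) w1 by (simp add: le_log_iff)
    moreover have "ln (?w n) \<le> c2 * f n" using b(2) w1 by (metis exp_gt_zero less_le_trans ln_exp ln_le_cancel_iff zero_less_one)
    then have "?g n \<le> c2 / ln 2 * f n" by (simp add: log_def divide_right_mono)
    moreover have "1 \<le> f n" using f_ge(2) elim by blast
    moreover have "0 \<le> ?g n" using w1 by simp
    ultimately show ?case by simp
  qed
  then have "?g \<in> \<Theta>(f)" using c by (intro bigthetaI'[of c1 "c2 / ln 2"]) auto
  moreover have "\<forall>n\<ge>1. ?w n = 2 powr ?g n"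
  proof (intro allI impI)
    fix n :: nat assume "1 \<le> n"
    then show "?w n = 2 powr ?g n" using w(2)[of n] by simp
  qed
  ultimately show ?thesis by (auto simp: f_def[abs_def])
qed

end

theorem theorem6p4:
  fixes \<epsilon> :: real and q :: "nat \<Rightarrow> nat"
  assumes "0 < \<epsilon>" and "\<epsilon> < 1 / 2"
    and "\<forall>n\<ge>1. q n \<ge> 3"
    and "(\<lambda>n. real (q n)) \<in> \<Theta>(\<lambda>n. real n powr \<epsilon>)"
  shows "(\<exists>p. finds_coloring p q q \<and>
            (\<exists>g\<in>\<Theta>(\<lambda>n. real n powr (1 - 2 * \<epsilon>) * ln (real n)).
               \<forall>n\<ge>1. real (worst_case_time p q n) = 2 powr g n)) \<and>
         (computable_in_exp_O q (\<lambda>n. real n powr (1 - 2 * \<epsilon>) * ln (real n)) \<longrightarrow>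
          (\<exists>p. finds_coloring p (\<lambda>_. 0) q \<and>
            (\<exists>g\<in>\<Theta>(\<lambda>n. real n powr (1 - 2 * \<epsilon>) * ln (real n)).
               \<forall>n\<ge>1. real (worst_case_time p (\<lambda>_. 0) n) = 2 powr g n)))"
proof (intro conjI impI)
  interpret growth \<epsilon> q by unfold_locales (use assms in auto)
  obtain p C D where p: "\<And>n q E s. 1 \<le> n \<Longrightarrow> 3 \<le> q \<Longrightarrow> E \<in> three_colorable_graphs n \<Longrightarrow> ready n q E s \<Longrightarrow>
     \<exists>t s' k. exec p s t s' \<and> proper_coloring {..<n} E q (arr s' 1) \<and> tuple_length n q k \<and>
        Suc n ^ k \<le> t \<and> t \<le> C * (Suc n ^ k + q + 2) ^ D"
    using algorithm by blast
  obtain c1 c2 where c: "0 < c1" "0 < c2" and ev: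
    "eventually (\<lambda>n. \<forall>k t. tuple_length n (q n) k \<longrightarrow> Suc n ^ k \<le> t \<longrightarrow> t \<le> C * (Suc n ^ k + q n + 2) ^ D \<longrightarrow>
        2 powr (c1 * f n) \<le> real t \<and> real t \<le> exp (c2 * f n)) at_top"
    by (rule time_bounds)
  define P where "P n t \<longleftrightarrow> (\<exists>k. tuple_length n (q n) k \<and> Suc n ^ k \<le> t \<and> t \<le> C * (Suc n ^ k + q n + 2) ^ D)"
    for n t
  have P1: "1 \<le> t" if "P n t" for n t
  proof -
    from that obtain k where "Suc n ^ k \<le> t" by (auto simp: P_def)
    moreover have "1 \<le> Suc n ^ k" by simp
    ultimately show ?thesis by (rule order_trans[rotated])
  qed
  have pP: "\<exists>t s'. exec p s t s' \<and> proper_coloring {..<n} E (q n) (arr s' 1) \<and> P n t"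
    if "1 \<le> n" "E \<in> three_colorable_graphs n" "ready n (q n) E s" for n E s
    using p[OF that(1) q_ge[OF that(1)] that(2,3)] unfolding P_def by blast
  have evP: "eventually (\<lambda>n. \<forall>t. P n t \<longrightarrow> 2 powr (c1 * f n) \<le> real t \<and> real t \<le> exp (c2 * f n)) at_top"
    using ev by eventually_elim (auto simp: P_def)
  show "\<exists>p. finds_coloring p q q \<and> (\<exists>g\<in>\<Theta>(\<lambda>n. real n powr (1 - 2 * \<epsilon>) * ln (real n)).
      \<forall>n\<ge>1. real (worst_case_time p q n) = 2 powr g n)"
  proof (intro exI conjI)
    show "finds_coloring p q q"
      unfolding finds_coloring_def using pP ready_input by blast
    show "\<exists>g\<in>\<Theta>(\<lambda>n. real n powr (1 - 2 * \<epsilon>) * ln (real n)). \<forall>n\<ge>1. real (worst_case_time p q n) = 2 powr g n"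
      by (rule worst_case_theta[where P = P, OF _ evP c]) (use pP P1 ready_input in blast)
  qed
  assume "computable_in_exp_O q (\<lambda>n. real n powr (1 - 2 * \<epsilon>) * ln (real n))"
  then obtain r h where h: "h \<in> O(f)" and
    r: "\<And>n. 1 \<le> n \<Longrightarrow> \<exists>t s. exec r (input n 0 {}) t s \<and> reg s 1 = q n \<and> real t \<le> 2 powr h n"
    unfolding computable_in_exp_O_def f_def[abs_def] by blast
  obtain p0 C0 D0 where p0: "\<And>n E q t s. 1 \<le> n \<Longrightarrow> exec r (input n 0 {}) t s \<Longrightarrow> reg s 1 = q \<Longrightarrow>
     \<exists>t' u. exec p0 (input n 0 E) t' u \<and> ready n q E u \<and> t' \<le> t + C0 * (n * n + n + 1) ^ D0"
    using compute_first[of r] by blast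
  \<comment> \<open>The time \<open>t1\<close> before the coloring is kept apart: it enters the
    upper bound, while the lower bound comes from \<open>t2\<close> alone.\<close>
  define Q where "Q n t \<longleftrightarrow> (\<exists>t1 t2. t = t1 + t2 \<and> P n t2 \<and> real t1 \<le> 2 powr h n + C0 * (n * n + n + 1) ^ D0)" for n t
  have pQ: "\<exists>t s'. exec (Seq p0 p) (input n 0 E) t s' \<and> proper_coloring {..<n} E (q n) (arr s' 1) \<and> Q n t"
    if n: "1 \<le> n" and E: "E \<in> three_colorable_graphs n" for n E
  proof -
    from r[OF n] obtain t s where t: "exec r (input n 0 {}) t s" "reg s 1 = q n" "real t \<le> 2 powr h n" by blast
    from p0[OF n t(1,2)] obtain t1 u where u: "exec p0 (input n 0 E) t1 u" "ready n (q n) E u"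
      "t1 \<le> t + C0 * (n * n + n + 1) ^ D0" by blast
    from pP[OF n E u(2)] obtain t2 s' where s': "exec p u t2 s'" "proper_coloring {..<n} E (q n) (arr s' 1)" "P n t2"
      by blast
    have "real t1 \<le> real (t + C0 * (n * n + n + 1) ^ D0)" using u(3) by (rule of_nat_mono)
    also have "\<dots> \<le> 2 powr h n + C0 * (n * n + n + 1) ^ D0" using t(3) by simp
    finally have "Q n (t1 + t2)" using s'(3) unfolding Q_def by blast
    then show ?thesis using exec.Seq[OF u(1) s'(1)] s'(2) by blast
  qed
  have Q1: "1 \<le> t" if "Q n t" for n t
    using that P1 unfolding Q_def by (auto intro: trans_le_add2)
  obtain c where c0: "0 < c" and ch: "eventually (\<lambda>n. norm (h n) \<le> c * norm (f n)) at_top"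
    using h by (elim landau_o.bigE)
  \<comment> \<open>\<open>c2\<close> pays for the coloring, \<open>c\<close> for computing
    \<open>q\<close>, and \<open>C0 + 3 * D0\<close> for moving the input; the 2 covers the sum of
    three terms, by \<open>3 \<le> exp 2\<close>.\<close>
  define c3 where "c3 = 2 + c2 + c + C0 + 3 * D0"
  have c3: "0 < c3" using c c0 by (simp add: c3_def add_pos_nonneg)
  have evQ: "eventually (\<lambda>n. \<forall>t. Q n t \<longrightarrow> 2 powr (c1 * f n) \<le> real t \<and> real t \<le> exp (c3 * f n)) at_top"
    using evP ch eventually_ge_at_top[of 3]
  proof eventually_elim
    case (elim n)
    then have n: "3 \<le> n" by simp
    have f1: "1 \<le> f n" using f_ge(2)[OF n] .
    show ?case
    proof (intro allI impI)
      fix t assume "Q n t"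
      then obtain t1 t2 where t: "t = t1 + t2" "P n t2" "real t1 \<le> 2 powr h n + C0 * (n * n + n + 1) ^ D0"
        unfolding Q_def by blast
      have t2: "2 powr (c1 * f n) \<le> real t2" "real t2 \<le> exp (c2 * f n)" using elim t(2) by auto
      let ?M = "c2 * f n + c * f n + C0 * f n + 3 * D0 * f n"
      have pos: "0 \<le> c2 * f n" "0 \<le> c * f n" "0 \<le> C0 * f n" "0 \<le> 3 * D0 * f n" using f1 c c0 by auto
      have 1: "real t2 \<le> exp ?M" using t2(2) pos by (meson add_increasing2 exp_le_cancel_iff order_trans order_refl)
      have "h n * ln 2 \<le> c * f n * 1"
      proof -
        have "h n * ln 2 \<le> norm (h n) * 1" using ln_2_less_1 by (intro mult_mono) auto
        also have "\<dots> \<le> c * f n" using elim f1 by simp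
        finally show ?thesis by simp
      qed
      then have "2 powr h n \<le> exp (c * f n)" by (simp add: powr_def)
      also have "\<dots> \<le> exp ?M" using pos by simp
      finally have 2: "2 powr h n \<le> exp ?M" .
      \<comment> \<open>Turns the cost of moving the input into a power of
        \<open>n ^ 3 = exp (3 * ln n)\<close>, and \<open>ln n \<le> f n\<close>.\<close>
      have "n * n + n + 1 \<le> n * n * n"
      proof -
        have "1 * 1 \<le> n * n" "n * 1 \<le> n * n" using n by (intro mult_le_mono; simp)+
        then have "n * n + n + 1 \<le> n * n + n * n + n * n" by linarith
        also have "\<dots> = 3 * (n * n)" by simp
        also have "\<dots> \<le> n * (n * n)" using n by (intro mult_le_mono1)
        finally show ?thesis by (simp add: mult.assoc)
      qed
      then have "real (n * n + n + 1) \<le> real n * real n * real n" by (metis of_nat_le_iff of_nat_mult)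
      also have "\<dots> = exp (3 * ln (real n))"
      proof -
        have "exp (3 * ln (real n)) = exp (ln (real n)) ^ 3" by (simp add: exp_power)
        then show ?thesis using n by (simp add: power3_eq_cube)
      qed
      finally have "real (n * n + n + 1) ^ D0 \<le> exp (3 * ln (real n)) ^ D0" by (intro power_mono) auto
      also have "\<dots> = exp (3 * D0 * ln (real n))" by (simp add: exp_power)
      also have "\<dots> \<le> exp (3 * D0 * f n)" using f_ge(1)[OF n] by (simp add: mult_left_mono)
      finally have "C0 * real (n * n + n + 1) ^ D0 \<le> exp (C0 * f n) * exp (3 * D0 * f n)"
      proof (intro mult_mono)
        have "real C0 * 1 \<le> C0 * f n" using f1 by (intro mult_left_mono) auto
        then show "real C0 \<le> exp (C0 * f n)" using le_exp_self[of "C0 * f n"] by linarith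
      qed auto
      also have "\<dots> \<le> exp ?M" unfolding exp_add[symmetric] using pos by simp
      finally have 3: "C0 * real (n * n + n + 1) ^ D0 \<le> exp ?M" .
      have "real t \<le> 3 * exp ?M" using t 1 2 3 by simp
      also have "(3::real) \<le> exp 2" using exp_ge_add_one_self[of 2] by simp
      then have "3 * exp ?M \<le> exp (2 * f n) * exp ?M"
        using f1 by (intro mult_right_mono) (auto intro: order_trans)
      also have "\<dots> = exp (c3 * f n)" by (simp add: c3_def exp_add[symmetric] algebra_simps)
      finally show "2 powr (c1 * f n) \<le> real t \<and> real t \<le> exp (c3 * f n)" using t(1) t2(1) by simp
    qed
  qed
  show "\<exists>p. finds_coloring p (\<lambda>_. 0) q \<and> (\<exists>g\<in>\<Theta>(\<lambda>n. real n powr (1 - 2 * \<epsilon>) * ln (real n)).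
      \<forall>n\<ge>1. real (worst_case_time p (\<lambda>_. 0) n) = 2 powr g n)"
  proof (intro exI conjI)
    show "finds_coloring (Seq p0 p) (\<lambda>_. 0) q"
      unfolding finds_coloring_def using pQ by blast
    show "\<exists>g\<in>\<Theta>(\<lambda>n. real n powr (1 - 2 * \<epsilon>) * ln (real n)).
        \<forall>n\<ge>1. real (worst_case_time (Seq p0 p) (\<lambda>_. 0) n) = 2 powr g n"
      by (rule worst_case_theta[where P = Q, OF _ evQ c(1) c3]) (use pQ Q1 in blast)
  qed
qed

end
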